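(* Let $K\ge 2$ and consider the real Gaussian single-antenna $K$-user multiple-access channel with an external eavesdropper, $$Y=\sum_{k=1}^K h_kX_k+\widetilde W_1,\qquad Z=\sum_{k=1}^K h_{k,e}X_k+\widetilde W_2,$$ with real channel gains $h_k,h_{k,e}$ and per-user average power constraint $P$. Then for Lebesgue-almost all channel gain vectors $(h_1,\dots,h_K,h_{1,e},\dots,h_{K,e})\in\mathbb{R}^{2K}$, a total secure degrees-of-freedom of $\frac{K-1}{K}$ is achievable.
   Context: Here $X_k$ is the real input of user $k$, subject to $E[X_k^2]\le P$; $Y$ and $Z$ are the real outputs at the legitimate receiver and eavesdropper; $\widetilde W_1,\widetilde W_2$ are zero-mean unit-variance real Gaussian noises, i.i.d. over time, independent of each other, of the inputs and of the messages. The channel gains are fixed and known perfectly at all transmitters and receivers. A $((2^{nR_1},\dots,2^{nR_K}),n)$ secret code consists of message sets $\mathcal{W}_k=\{1,\dots,2^{nR_k}\}$ (independent uniform messages $W_k$), stochastic encoders $f_k:w_k\mapsto X_k^n$ satisfying the average power constraint $P$, and a decoder $\phi(Y^n)=(\hat W_1,\dots,\hat W_K)$. The average error probability is $P_e^{(n)}=\frac{1}{\prod_k 2^{nR_k}}\sum_{(w_1,\dots,w_K)}P\{\phi(Y^n)\ne(w_1,\dots,w_K)\mid(w_1,\dots,w_K)\text{ sent}\}$, and for $\mathcal{S}\subseteq\{1,\dots,K\}$ the normalized equivocation is $\Delta_{\mathcal{S}}=H(W_{\mathcal{S}}\mid Z^n)/H(W_{\mathcal{S}})$. A rate tuple is achievable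 with perfect secrecy if for every $\epsilon>0$ there are secret codes with, for large $n$, $P_e^{(n)}\le\epsilon$ and $\Delta_{\mathcal{S}}\ge1-\epsilon$ for all $\mathcal{S}$. A total secure degrees-of-freedom (S-DoF) $\eta$ is achievable if there exist, for each $P$, perfectly secure achievable rate tuples $(R_1,\dots,R_K)$ (depending on $P$) with $\eta=\lim_{P\to\infty}\frac{\sum_{k=1}^K R_k}{\frac12\log P}$. *)

theory Defs
  imports "HOL-Probability.Probability"
begin

text \<open>Gaussian K-user wiretap multiple-access channel (real, single antenna).
  Users are indexed by 0..K-1, time symbols by 0..n-1.  A length-n real signal is a
  function nat => real (extensional on {..<n}).\<close>

definition msg_set :: "nat set \<Rightarrow> (nat \<Rightarrow> nat) \<Rightarrow> (nat \<Rightarrow> nat) set" where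
  "msg_set S M = PiE S (\<lambda>k. {..<M k})"

definition sig_space :: "nat \<Rightarrow> (nat \<Rightarrow> real) measure" where
  "sig_space n = PiM {..<n} (\<lambda>_. lborel)"

definition noise_space :: "nat \<Rightarrow> (nat \<Rightarrow> real) measure" where
  "noise_space n = PiM {..<n} (\<lambda>_. density lborel std_normal_density)"

definition rand_space :: "nat \<Rightarrow> (nat \<Rightarrow> real) measure" where
  "rand_space K = PiM {..<K} (\<lambda>_. uniform_measure lborel {0..1})"

text \<open>Sample space: (messages, encoder randomness, receiver noise, eavesdropper noise);
  messages are independent and uniform.\<close>
definition sample_space ::
  "nat \<Rightarrow> nat \<Rightarrow> (nat \<Rightarrow> nat) \<Rightarrow> ((nat \<Rightarrow> nat) \<times> (nat \<Rightarrow> real) \<times> (nat \<Rightarrow> real) \<times> (nat \<Rightarrow> real)) measure" where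
  "sample_space K n M = uniform_count_measure (msg_set {..<K} M) \<Otimes>\<^sub>M
      (rand_space K \<Otimes>\<^sub>M (noise_space n \<Otimes>\<^sub>M noise_space n))"

text \<open>Transmitted codeword of user k: the stochastic encoder is f k w u, with u the
  private randomness of user k.\<close>
definition tx :: "nat \<Rightarrow> (nat \<Rightarrow> nat \<Rightarrow> real \<Rightarrow> nat \<Rightarrow> real) \<Rightarrow> nat
    \<Rightarrow> (nat \<Rightarrow> nat) \<times> (nat \<Rightarrow> real) \<times> (nat \<Rightarrow> real) \<times> (nat \<Rightarrow> real) \<Rightarrow> nat \<Rightarrow> real" where
  "tx n f k \<omega> = restrict (f k (fst \<omega> k) (fst (snd \<omega>) k)) {..<n}"

definition rx_Y :: "nat \<Rightarrow> nat \<Rightarrow> (nat \<Rightarrow> real) \<Rightarrow> (nat \<Rightarrow> nat \<Rightarrow> real \<Rightarrow> nat \<Rightarrow> real)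
    \<Rightarrow> (nat \<Rightarrow> nat) \<times> (nat \<Rightarrow> real) \<times> (nat \<Rightarrow> real) \<times> (nat \<Rightarrow> real) \<Rightarrow> nat \<Rightarrow> real" where
  "rx_Y K n h f \<omega> = restrict (\<lambda>t. (\<Sum>k<K. h k * tx n f k \<omega> t) + fst (snd (snd \<omega>)) t) {..<n}"

definition rx_Z :: "nat \<Rightarrow> nat \<Rightarrow> (nat \<Rightarrow> real) \<Rightarrow> (nat \<Rightarrow> nat \<Rightarrow> real \<Rightarrow> nat \<Rightarrow> real)
    \<Rightarrow> (nat \<Rightarrow> nat) \<times> (nat \<Rightarrow> real) \<times> (nat \<Rightarrow> real) \<times> (nat \<Rightarrow> real) \<Rightarrow> nat \<Rightarrow> real" where
  "rx_Z K n he f \<omega> = restrict (\<lambda>t. (\<Sum>k<K. he k * tx n f k \<omega> t) + snd (snd (snd \<omega>)) t) {..<n}"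

text \<open>A secret code of block length n with message set sizes M (power P, gains h, he),
  with error probability at most eps and normalized equivocation at least 1 - eps
  for every subset S of users.  The equivocation condition
  H(W_S | Z^n) / H(W_S) >= 1 - eps is written multiplicatively,
  H(W_S | Z^n) >= (1 - eps) H(W_S) (identical when H(W_S) > 0; for H(W_S) = 0 the ratio
  is undefined and the condition is vacuous).\<close>
definition secret_code ::
  "nat \<Rightarrow> nat \<Rightarrow> (nat \<Rightarrow> nat) \<Rightarrow> real \<Rightarrow> (nat \<Rightarrow> real) \<Rightarrow> (nat \<Rightarrow> real)
   \<Rightarrow> (nat \<Rightarrow> nat \<Rightarrow> real \<Rightarrow> nat \<Rightarrow> real) \<Rightarrow> ((nat \<Rightarrow> real) \<Rightarrow> (nat \<Rightarrow> nat)) \<Rightarrow> real \<Rightarrow> bool" where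
  "secret_code K n M P h he f \<phi> \<epsilon> \<longleftrightarrow>
     (\<forall>k<K. \<forall>w<M k. f k w \<in> lborel \<rightarrow>\<^sub>M sig_space n) \<and>
     \<phi> \<in> sig_space n \<rightarrow>\<^sub>M count_space UNIV \<and>
     (\<forall>k<K. (\<integral>\<^sup>+\<omega>. ennreal ((\<Sum>t<n. (tx n f k \<omega> t)\<^sup>2) / real n) \<partial>sample_space K n M)
              \<le> ennreal P) \<and>
     measure (sample_space K n M)
        {\<omega> \<in> space (sample_space K n M). \<phi> (rx_Y K n h f \<omega>) \<noteq> fst \<omega>} \<le> \<epsilon> \<and>
     (\<forall>S\<subseteq>{..<K}.
        prob_space.conditional_entropy (sample_space K n M) 2
            (count_space (msg_set S M)) (sig_space n)
            (\<lambda>\<omega>. restrict (fst \<omega>) S) (rx_Z K n he f)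
        \<ge> (1 - \<epsilon>) * prob_space.entropy (sample_space K n M) 2
            (count_space (msg_set S M)) (\<lambda>\<omega>. restrict (fst \<omega>) S))"

definition achievable_secure ::
  "nat \<Rightarrow> real \<Rightarrow> (nat \<Rightarrow> real) \<Rightarrow> (nat \<Rightarrow> real) \<Rightarrow> (nat \<Rightarrow> real) \<Rightarrow> bool" where
  "achievable_secure K P h he R \<longleftrightarrow>
     (\<forall>k<K. 0 \<le> R k) \<and>
     (\<forall>\<epsilon>>0. \<exists>N. \<forall>n\<ge>N. \<exists>f \<phi>.
        secret_code K n (\<lambda>k. nat \<lceil>2 powr (real n * R k)\<rceil>) P h he f \<phi> \<epsilon>)"

definition sdof_achievable ::
  "nat \<Rightarrow> (nat \<Rightarrow> real) \<Rightarrow> (nat \<Rightarrow> real) \<Rightarrow> real \<Rightarrow> bool" where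
  "sdof_achievable K h he \<eta> \<longleftrightarrow>
     (\<exists>R :: real \<Rightarrow> nat \<Rightarrow> real.
        (\<forall>P>0. achievable_secure K P h he (R P)) \<and>
        ((\<lambda>P. (\<Sum>k<K. R P k) / (1/2 * log 2 P)) \<longlongrightarrow> \<eta>) at_top)"

end

theory Submission
  imports Defs "HOL-Real_Asymp.Real_Asymp"
begin

text \<open>User 0 is a helper that sends an i.i.d. uniform integer vector and has rate zero; the other
  users share one random codebook of integer vectors with entries below \<open>Q = 2 ^ J\<close>. User \<open>k\<close> scales
  its integer codeword by \<open>a / he k\<close>, so the eavesdropper sees only the sum of all integer
  codewords plus noise (alignment), while the legitimate receiver sees the linear form with
  coefficients \<open>h k / he k\<close>. Per symbol, the sum leaks only a bounded number of bits because of the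
  helper; this is absorbed by \<open>16 ^ n\<close> randomization indices per message (soft covering, by a second
  moment bound over the random codebook), so the law of the eavesdropper's output is almost
  independent of the messages. By the convergence case of the Khinchin--Groshev theorem the linear
  forms are separated by about \<open>2 powr (- J * (K - 1))\<close> for almost all gains, hence the receiver recovers
  all but a small fraction of the integer symbols, and the minimum distance of the random codebook
  does the rest. Each of the \<open>K - 1\<close> users has rate about \<open>J\<close>, which can be taken close to
  \<open>(1 / K) * (1 / 2) * log 2 P\<close>.\<close>

section \<open>Equivocation of uniform messages\<close>

text \<open>Write x for half the binary logarithm of the power. Integer steps are sent with
  amplitude about 2^(x - J), and the linear forms are separated by about 2^(-J (K - 1)), so
  noiseless received points are about 2^(x - J K) apart: J close to x / K is the largest choice that
  keeps them above the noise. At fixed power the noise per symbol does not fade as n grows, so some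
  symbols of a block stay wrong; hence the Hamming distance between codewords matters. A noise
  threshold 2^(2 s) and an error fraction 1 / s with s near sqrt x make both losses of order sqrt x,
  negligible against x. Of the J bits per symbol, 4 go to the randomization, 1 to counting error
  patterns and 1 to make the failure terms decay. Random coding controls the leakage only on average
  over messages, so leakage bounds are sums of one-message terms that are averaged at the end.
  Messages are exchanged one user at a time with all other codewords frozen; this is why one helper
  vector hides every user and one codebook serves all of them.\<close>

text \<open>Converts closeness of laws into equivocation. The conditional entropy is the mean of log
  (Py / Pxy); wherever the joint density is at most twice its value under independence, this log is
  at least log (card F) - 1, and the remaining set has small probability. That set depends on
  \<open>x\<close>, hence the family \<open>A\<close> in \<open>leak\<close>.\<close>

lemma (in prob_space) conditional_entropy_uniform_ge:
  fixes X :: "'a \<Rightarrow> 'x" and Y :: "'a \<Rightarrow> 'y"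
  assumes F: "finite F" "F \<noteq> {}"
    and T: "sigma_finite_measure T"
    and X[measurable]: "X \<in> M \<rightarrow>\<^sub>M count_space F" and Y[measurable]: "Y \<in> M \<rightarrow>\<^sub>M T"
    and unif: "\<And>x. x \<in> F \<Longrightarrow> prob {\<omega> \<in> space M. X \<omega> = x} = 1 / card F"
    and ac: "absolutely_continuous T (distr M T Y)"
    and leak: "\<And>A. (\<And>x. x \<in> F \<Longrightarrow> A x \<in> sets T) \<Longrightarrow>
      (\<Sum>x\<in>F. prob {\<omega> \<in> space M. X \<omega> = x \<and> Y \<omega> \<in> A x}
         - prob {\<omega> \<in> space M. Y \<omega> \<in> A x} / card F) \<le> \<eta>"
  shows "(1 - 2 * \<eta>) * log 2 (card F) - 1 \<le> conditional_entropy 2 (count_space F) T X Y"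
    and "0 \<le> conditional_entropy 2 (count_space F) T X Y"
proof -
  interpret information_space M 2 by standard simp
  interpret T: sigma_finite_measure T by fact
  interpret C: sigma_finite_measure "count_space F" by (rule sigma_finite_measure_count_space_finite[OF F(1)])
  interpret CT: pair_sigma_finite "count_space F" T ..
  let ?CT = "count_space F \<Otimes>\<^sub>M T"
  define m where "m = real (card F)"
  have m1: "m \<ge> 1" using F by (auto simp: m_def Suc_le_eq card_gt_0_iff)
  have sec: "{x} \<times> B \<in> sets ?CT" if "x \<in> F" "B \<in> sets T" for x B using that by (intro pair_measureI) auto
  \<comment> \<open>\<open>F\<close> is finite, so a null set of the product has finitely many
    sections, all null; this yields a joint density.\<close>
  have ac2: "absolutely_continuous ?CT (distr M ?CT (\<lambda>\<omega>. (X \<omega>, Y \<omega>)))"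
    unfolding absolutely_continuous_def
  proof
    fix N assume N: "N \<in> null_sets ?CT"
    then have [measurable]: "N \<in> sets ?CT" by auto
    have sN: "Pair x -` N \<in> sets T" for x by (rule sets_Pair1) fact
    have "(\<integral>\<^sup>+x. emeasure T (Pair x -` N) \<partial>count_space F) = 0"
      using N by (simp add: T.emeasure_pair_measure_alt null_sets_def)
    then have "(\<Sum>x\<in>F. emeasure T (Pair x -` N)) = 0"
      by (simp add: nn_integral_count_space_finite[OF F(1)])
    then have nl: "Pair x -` N \<in> null_sets T" if "x \<in> F" for x using that F sN by auto
    have "emeasure (distr M ?CT (\<lambda>\<omega>. (X \<omega>, Y \<omega>))) N = emeasure M {\<omega>\<in>space M. (X \<omega>, Y \<omega>) \<in> N}"
      by (subst emeasure_distr) (auto intro!: arg_cong[where f="emeasure M"])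
    also have "\<dots> \<le> emeasure M (\<Union>x\<in>F. Y -` (Pair x -` N) \<inter> space M)"
      using measurable_space[OF X] sN F by (intro emeasure_mono sets.finite_UN measurable_sets[OF Y]) auto
    also have "\<dots> \<le> (\<Sum>x\<in>F. emeasure M (Y -` (Pair x -` N) \<inter> space M))"
      using F sN by (intro emeasure_subadditive_finite) (auto intro: measurable_sets[OF Y])
    also have "\<dots> = 0"
    proof (rule sum.neutral, rule ballI)
      fix x assume "x \<in> F"
      then have "Pair x -` N \<in> null_sets (distr M T Y)"
        using nl ac unfolding absolutely_continuous_def by blast
      then show "emeasure M (Y -` (Pair x -` N) \<inter> space M) = 0"
        using sN by (auto simp: null_sets_def emeasure_distr[OF Y])
    qed
    finally show "N \<in> null_sets (distr M ?CT (\<lambda>\<omega>. (X \<omega>, Y \<omega>)))"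
      by (auto simp: null_sets_def)
  qed
  have fin: "finite_measure (distr M ?CT (\<lambda>\<omega>. (X \<omega>, Y \<omega>)))"
    by (rule finite_measure_distr) simp
  obtain Pxy :: "'x \<times> 'y \<Rightarrow> real" where Pm[measurable]: "Pxy \<in> borel_measurable ?CT"
    and PR: "AE x in ?CT. RN_deriv ?CT (distr M ?CT (\<lambda>\<omega>. (X \<omega>, Y \<omega>))) x = ennreal (Pxy x)"
    and P0: "\<And>x. 0 \<le> Pxy x"
    by (rule CT.P.real_RN_deriv[OF fin ac2]) (simp, blast)
  have dens: "distr M ?CT (\<lambda>\<omega>. (X \<omega>, Y \<omega>)) = density ?CT Pxy"
  proof -
    have "distr M ?CT (\<lambda>\<omega>. (X \<omega>, Y \<omega>)) = density ?CT (RN_deriv ?CT (distr M ?CT (\<lambda>\<omega>. (X \<omega>, Y \<omega>))))"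
      using CT.P.density_RN_deriv[OF ac2] by simp
    also have "\<dots> = density ?CT Pxy" by (rule density_cong) (use PR in auto)
    finally show ?thesis .
  qed
  have DXY: "distributed M ?CT (\<lambda>\<omega>. (X \<omega>, Y \<omega>)) Pxy"
    unfolding distributed_def using dens by simp
  have Psec[measurable]: "(\<lambda>y. Pxy (x, y)) \<in> borel_measurable T" if "x \<in> F" for x
    using that by (intro measurable_compose[OF _ Pm] measurable_Pair1') auto
  define Py where "Py = (\<lambda>y. \<Sum>x\<in>F. Pxy (x, y))"
  have Pym[measurable]: "Py \<in> borel_measurable T" unfolding Py_def by (intro borel_measurable_sum Psec)
  have Py0: "0 \<le> Py y" for y unfolding Py_def by (intro sum_nonneg P0)
  have Ple: "Pxy (x, y) \<le> Py y" if "x \<in> F" for x y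
    unfolding Py_def using that F by (intro member_le_sum P0) auto
  have joint: "emeasure M {\<omega>\<in>space M. X \<omega> = x \<and> Y \<omega> \<in> B} = (\<integral>\<^sup>+y. ennreal (Pxy (x,y)) * indicator B y \<partial>T)"
    if "x \<in> F" "B \<in> sets T" for x B
  proof -
    have "emeasure M {\<omega>\<in>space M. X \<omega> = x \<and> Y \<omega> \<in> B} = emeasure (distr M ?CT (\<lambda>\<omega>. (X \<omega>, Y \<omega>))) ({x}\<times>B)"
      using sec[OF that] by (subst emeasure_distr) (auto intro!: arg_cong[where f="emeasure M"])
    also have "\<dots> = (\<integral>\<^sup>+z. ennreal (Pxy z) * indicator ({x}\<times>B) z \<partial>?CT)"
      unfolding dens using sec[OF that] by (subst emeasure_density) auto
    also have "\<dots> = (\<integral>\<^sup>+x'. \<integral>\<^sup>+y. ennreal (Pxy (x',y)) * indicator ({x}\<times>B) (x',y) \<partial>T \<partial>count_space F)"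
      using sec[OF that] by (subst T.nn_integral_fst[symmetric]) auto
    also have "\<dots> = (\<Sum>x'\<in>F. \<integral>\<^sup>+y. ennreal (Pxy (x',y)) * indicator ({x}\<times>B) (x',y) \<partial>T)"
      by (rule nn_integral_count_space_finite[OF F(1)])
    also have "\<dots> = (\<Sum>x'\<in>F. if x' = x then \<integral>\<^sup>+y. ennreal (Pxy (x',y)) * indicator B y \<partial>T else 0)"
      by (intro sum.cong refl) (auto simp: indicator_def)
    finally show ?thesis using that F by simp
  qed
  have marg: "emeasure M {\<omega>\<in>space M. Y \<omega> \<in> B} = (\<integral>\<^sup>+y. ennreal (Py y) * indicator B y \<partial>T)"
    if B[measurable]: "B \<in> sets T" for B
  proof -
    have "{\<omega>\<in>space M. Y \<omega> \<in> B} = (\<Union>x\<in>F. {\<omega>\<in>space M. X \<omega> = x \<and> Y \<omega> \<in> B})"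
      using measurable_space[OF X] by auto
    also have "emeasure M \<dots> = (\<Sum>x\<in>F. emeasure M {\<omega>\<in>space M. X \<omega> = x \<and> Y \<omega> \<in> B})"
      using F by (intro sum_emeasure[symmetric]) (auto simp: disjoint_family_on_def)
    also have "\<dots> = (\<Sum>x\<in>F. \<integral>\<^sup>+y. ennreal (Pxy (x,y)) * indicator B y \<partial>T)"
      by (intro sum.cong refl joint) auto
    also have "\<dots> = (\<integral>\<^sup>+y. (\<Sum>x\<in>F. ennreal (Pxy (x,y)) * indicator B y) \<partial>T)"
      by (intro nn_integral_sum[symmetric]) simp
    also have "\<dots> = (\<integral>\<^sup>+y. ennreal (Py y) * indicator B y \<partial>T)"
      unfolding Py_def by (intro nn_integral_cong) (simp add: sum_ennreal P0 sum_distrib_right[symmetric])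
    finally show ?thesis .
  qed
  have DY: "distributed M T Y Py"
    unfolding distributed_def
  proof (intro conjI measure_eqI)
    show "emeasure (distr M T Y) A = emeasure (density T Py) A" if "A \<in> sets (distr M T Y)" for A
      using that marg[of A] by (subst emeasure_distr) (auto simp: emeasure_density Int_def conj_commute vimage_def)
  qed (auto)
  \<comment> \<open>Sign moved inside the logarithm: since \<open>Pxy (x, y)\<close> is one summand
    of \<open>Py y\<close>, the integrand becomes nonnegative.\<close>
  define g where "g = (\<lambda>z. Pxy z * log 2 (Py (snd z) / Pxy z))"
  have gm[measurable]: "g \<in> borel_measurable ?CT" unfolding g_def by measurable
  have H: "conditional_entropy 2 (count_space F) T X Y = (\<integral>z. g z \<partial>?CT)"
  proof -
    have "conditional_entropy 2 (count_space F) T X Y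
        = - (\<integral>(x, y). Pxy (x, y) * log 2 (Pxy (x, y) / Py y) \<partial>?CT)"
      by (rule conditional_entropy_generic_eq[OF C.sigma_finite_measure_axioms T DY Py0 DXY P0])
    also have "\<dots> = (\<integral>z. - (case z of (x, y) \<Rightarrow> Pxy (x, y) * log 2 (Pxy (x, y) / Py y)) \<partial>?CT)"
      by simp
    also have "\<dots> = (\<integral>z. g z \<partial>?CT)"
    proof (rule Bochner_Integration.integral_cong[OF refl])
      fix z assume "z \<in> space ?CT"
      then obtain x y where z: "z = (x, y)" "x \<in> F" by (cases z) (auto simp: space_pair_measure)
      show "- (case z of (x, y) \<Rightarrow> Pxy (x, y) * log 2 (Pxy (x, y) / Py y)) = g z"
      proof (cases "Pxy (x,y) = 0")
        case False
        then have "Pxy (x,y) > 0" using P0[of "(x,y)"] by simp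
        moreover then have "Py y > 0" using Ple[OF z(2), of y] by simp
        ultimately have "log 2 (Py y / Pxy (x,y)) = - log 2 (Pxy (x,y) / Py y)"
          by (simp add: log_divide_pos)
        then show ?thesis unfolding g_def z by simp
      qed (simp add: g_def z)
    qed
    finally show ?thesis .
  qed
  have gbd: "0 \<le> g z \<and> g z \<le> Py (snd z) / ln 2" if "z \<in> space ?CT" for z
  proof -
    define x y where "x = fst z" and "y = snd z"
    then have z: "z = (x, y)" "x \<in> F" using that by (auto simp: space_pair_measure)
    show ?thesis
    proof (cases "Pxy (x,y) = 0")
      case False
      then have p: "Pxy (x,y) > 0" using P0[of "(x,y)"] by simp
      with Ple[OF z(2), of y] have q: "Py y > 0" "1 \<le> Py y / Pxy (x,y)" by (auto simp: field_simps)
      have "0 \<le> log 2 (Py y / Pxy (x,y))" using q by simp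
      \<comment> \<open>From ln t \<le> t, the integrand is dominated by \<open>Py / ln 2\<close>,
        whose total mass is \<open>card F / ln 2\<close>.\<close>
      moreover have "log 2 (Py y / Pxy (x,y)) \<le> (Py y / Pxy (x,y)) / ln 2"
      proof -
        have "ln (Py y / Pxy (x,y)) \<le> Py y / Pxy (x,y)"
          using ln_le_minus_one[of "Py y / Pxy (x,y)"] p q by simp
        then show ?thesis unfolding log_def by (intro divide_right_mono) auto
      qed
      then have "Pxy (x,y) * log 2 (Py y / Pxy (x,y)) \<le> Pxy (x,y) * ((Py y / Pxy (x,y)) / ln 2)"
        using p by (intro mult_left_mono) auto
      ultimately show ?thesis unfolding g_def z using p by (simp add: field_simps)
    qed (simp add: g_def z Py0)
  qed
  have tot: "(\<integral>\<^sup>+y. ennreal (Py y) \<partial>T) = 1"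
  proof -
    have "{\<omega>\<in>space M. Y \<omega> \<in> space T} = space M" using measurable_space[OF Y] by auto
    then have "(\<integral>\<^sup>+y. ennreal (Py y) * indicator (space T) y \<partial>T) = 1"
      using marg[of "space T"] emeasure_space_1 by simp
    moreover have "(\<integral>\<^sup>+y. ennreal (Py y) * indicator (space T) y \<partial>T) = (\<integral>\<^sup>+y. ennreal (Py y) \<partial>T)"
      by (rule nn_integral_cong) simp
    ultimately show ?thesis by simp
  qed
  have intPy: "integrable ?CT (\<lambda>z. Py (snd z))"
  proof (rule integrableI_nonneg)
    have "(\<integral>\<^sup>+z. ennreal (Py (snd z)) \<partial>?CT) = (\<integral>\<^sup>+x. \<integral>\<^sup>+y. ennreal (Py y) \<partial>T \<partial>count_space F)"
      by (subst T.nn_integral_fst[symmetric]) auto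
    also have "\<dots> < \<infinity>" using F by (simp add: tot nn_integral_count_space_finite of_nat_less_top)
    finally show "(\<integral>\<^sup>+z. ennreal (Py (snd z)) \<partial>?CT) < \<infinity>" .
  qed (auto simp: Py0)
  have intg: "integrable ?CT g"
  proof (rule Bochner_Integration.integrable_bound)
    show "integrable ?CT (\<lambda>z. Py (snd z) / ln 2)" using intPy by (rule integrable_divide_zero)
    show "AE z in ?CT. norm (g z) \<le> norm (Py (snd z) / ln 2)"
    proof (rule AE_I2)
      fix z assume "z \<in> space ?CT"
      from gbd[OF this] have "norm (g z) = g z" "g z \<le> Py (snd z) / ln 2" by auto
      then show "norm (g z) \<le> norm (Py (snd z) / ln 2)" by (metis abs_ge_self order_trans real_norm_def)
    qed
  qed (rule gm)
  show ge0: "0 \<le> conditional_entropy 2 (count_space F) T X Y"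
    unfolding H using gbd by (intro Bochner_Integration.integral_nonneg) auto
  \<comment> \<open>The points where the joint density exceeds twice the product of the uniform
    weight and \<open>Py\<close>. There the marginal term takes away less than half of the joint
    probability, so \<open>leak\<close> bounds their total probability \<open>q\<close> by
    \<open>2 * \<eta>\<close>.\<close>
  define A where "A = (\<lambda>x. {y \<in> space T. m * Pxy (x,y) > 2 * Py y})"
  have Am[measurable]: "A x \<in> sets T" if "x \<in> F" for x unfolding A_def using that by measurable
  have ev: "{\<omega> \<in> space M. X \<omega> = x \<and> Y \<omega> \<in> A x} \<in> events" if "x \<in> F" for x
  proof -
    have "{\<omega> \<in> space M. X \<omega> = x \<and> Y \<omega> \<in> A x} = (X -` {x} \<inter> space M) \<inter> (Y -` A x \<inter> space M)" by auto
    also have "\<dots> \<in> events"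
      using measurable_sets[OF X, of "{x}"] measurable_sets[OF Y Am[OF that]] that
      by (intro sets.Int[of "X -` {x} \<inter> space M"]) auto
    finally show ?thesis .
  qed
  define G where "G = {z \<in> space ?CT. m * Pxy z \<le> 2 * Py (snd z)}"
  have Gm[measurable]: "G \<in> sets ?CT" unfolding G_def by measurable
  define q where "q = (\<Sum>x\<in>F. prob {\<omega> \<in> space M. X \<omega> = x \<and> Y \<omega> \<in> A x})"
  have "q \<le> 2 * \<eta>"
  proof -
    have "prob {\<omega> \<in> space M. Y \<omega> \<in> A x} / m \<le> prob {\<omega> \<in> space M. X \<omega> = x \<and> Y \<omega> \<in> A x} / 2" if x: "x \<in> F" for x
    proof -
      have "ennreal (2 * prob {\<omega> \<in> space M. Y \<omega> \<in> A x}) = 2 * emeasure M {\<omega> \<in> space M. Y \<omega> \<in> A x}"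
        by (simp add: ennreal_mult emeasure_eq_measure)
      also have "\<dots> = (\<integral>\<^sup>+y. 2 * (ennreal (Py y) * indicator (A x) y) \<partial>T)"
        using x by (simp add: marg nn_integral_cmult)
      also have "\<dots> \<le> (\<integral>\<^sup>+y. ennreal m * (ennreal (Pxy (x,y)) * indicator (A x) y) \<partial>T)"
      proof (rule nn_integral_mono)
        fix y
        show "2 * (ennreal (Py y) * indicator (A x) y) \<le> ennreal m * (ennreal (Pxy (x,y)) * indicator (A x) y)"
        proof (cases "y \<in> A x")
          case True
          then have "ennreal (2 * Py y) \<le> ennreal (m * Pxy (x,y))" by (intro ennreal_leI) (auto simp: A_def)
          then show ?thesis using True Py0 P0 m1 by (simp add: ennreal_mult)
        qed simp
      qed
      also have "\<dots> = ennreal m * emeasure M {\<omega> \<in> space M. X \<omega> = x \<and> Y \<omega> \<in> A x}"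
        using x by (simp add: joint nn_integral_cmult)
      also have "\<dots> = ennreal (m * prob {\<omega> \<in> space M. X \<omega> = x \<and> Y \<omega> \<in> A x})"
        using m1 by (simp add: ennreal_mult emeasure_eq_measure)
      finally show ?thesis using m1 by (simp add: field_simps)
    qed
    then have "(\<Sum>x\<in>F. prob {\<omega> \<in> space M. Y \<omega> \<in> A x} / m) \<le> (\<Sum>x\<in>F. prob {\<omega> \<in> space M. X \<omega> = x \<and> Y \<omega> \<in> A x} / 2)"
      by (rule sum_mono)
    with leak[of A] Am show ?thesis unfolding q_def m_def by (simp add: sum_subtractf sum_divide_distrib[symmetric])
  qed
  have \<eta>0: "0 \<le> \<eta>" using leak[of "\<lambda>_. {}"] by simp
  have PG: "(\<integral>z. Pxy z * indicator G z \<partial>?CT) = 1 - q"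
  proof -
    have "(\<integral>z. Pxy z * indicator G z \<partial>?CT) = measure (density ?CT Pxy) G"
      using P0 by (simp add: measure_def emeasure_density integral_eq_nn_integral ennreal_mult ennreal_indicator)
    also have "\<dots> = prob {\<omega>\<in>space M. (X \<omega>, Y \<omega>) \<in> G}"
      unfolding dens[symmetric] by (subst measure_distr) (auto intro!: arg_cong[where f=prob])
    also have "{\<omega>\<in>space M. (X \<omega>, Y \<omega>) \<in> G} = space M - (\<Union>x\<in>F. {\<omega> \<in> space M. X \<omega> = x \<and> Y \<omega> \<in> A x})"
      using measurable_space[OF X] measurable_space[OF Y] by (auto simp: G_def A_def space_pair_measure not_less)
    also have "prob \<dots> = 1 - prob (\<Union>x\<in>F. {\<omega> \<in> space M. X \<omega> = x \<and> Y \<omega> \<in> A x})"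
      using F ev by (intro prob_compl sets.finite_UN) auto
    also have "prob (\<Union>x\<in>F. {\<omega> \<in> space M. X \<omega> = x \<and> Y \<omega> \<in> A x}) = q"
      unfolding q_def using F ev by (intro finite_measure_finite_Union) (auto simp: disjoint_family_on_def)
    finally show ?thesis .
  qed
  have intP: "integrable ?CT (\<lambda>z. Pxy z * indicator G z)"
  proof (rule Bochner_Integration.integrable_bound[OF intPy])
    show "AE z in ?CT. norm (Pxy z * indicator G z) \<le> norm (Py (snd z))"
    proof (rule AE_I2)
      fix z assume "z \<in> space ?CT"
      then have "Pxy z \<le> Py (snd z)" using Ple[of "fst z" "snd z"] by (simp add: space_pair_measure mem_Times_iff)
      then show "norm (Pxy z * indicator G z) \<le> norm (Py (snd z))"
        using P0[of z] Py0[of "snd z"] by (simp add: indicator_def)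
    qed
  qed simp
  have "(\<integral>z. (log 2 m - 1) * (Pxy z * indicator G z) \<partial>?CT) \<le> (\<integral>z. g z \<partial>?CT)"
  proof (rule integral_mono)
    fix z assume z: "z \<in> space ?CT"
    show "(log 2 m - 1) * (Pxy z * indicator G z) \<le> g z"
    proof (cases "z \<in> G \<and> Pxy z \<noteq> 0")
      case True
      then have p: "Pxy z > 0" using P0[of z] by simp
      have "m / 2 \<le> Py (snd z) / Pxy z" using True p by (simp add: G_def field_simps)
      then have "log 2 (m / 2) \<le> log 2 (Py (snd z) / Pxy z)" using m1 by (intro log_mono) auto
      moreover have "log 2 (m / 2) = log 2 m - 1" using m1 by (simp add: log_divide_pos)
      ultimately have "Pxy z * (log 2 m - 1) \<le> Pxy z * log 2 (Py (snd z) / Pxy z)"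
        using p by (intro mult_left_mono) auto
      then show ?thesis using True by (simp add: g_def mult.commute)
    next
      case False
      then show ?thesis using gbd[OF z] by auto
    qed
  qed (use intP intg in auto)
  then have Hge: "(log 2 m - 1) * (1 - q) \<le> conditional_entropy 2 (count_space F) T X Y"
    unfolding H by (simp add: PG)
  show "(1 - 2 * \<eta>) * log 2 (card F) - 1 \<le> conditional_entropy 2 (count_space F) T X Y"
  \<comment> \<open>For \<open>m < 2\<close> the factor \<open>log 2 m - 1\<close> is negative and
    cannot multiply the bound on \<open>q\<close>; nonnegativity of the entropy suffices
    there.\<close>
  proof (cases "log 2 m \<ge> 1")
    case True
    have "(log 2 m - 1) * (1 - 2 * \<eta>) \<le> (log 2 m - 1) * (1 - q)"
      using True \<open>q \<le> 2 * \<eta>\<close> by (intro mult_left_mono) auto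
    with Hge \<eta>0 show ?thesis unfolding m_def by (simp add: algebra_simps)
  next
    case False
    have "0 \<le> log 2 m" using m1 by simp
    then have "(1 - 2 * \<eta>) * log 2 m \<le> 1 * log 2 m" using \<eta>0 by (intro mult_right_mono) auto
    with False ge0 show ?thesis unfolding m_def by simp
  qed
qed

section \<open>The sample space and Gaussian noise\<close>

text \<open>Extracts a uniform index below \<open>L\<close> from a uniform real of the unit
  interval; \<open>min\<close> sends the endpoint 1 to the last cell and keeps the index below
  \<open>L\<close> for every real input.\<close>

definition cell_index :: "nat \<Rightarrow> real \<Rightarrow> nat" where
  "cell_index L u = min (L - 1) (nat \<lfloor>real L * u\<rfloor>)"

definition rand_index :: "nat \<Rightarrow> (nat \<Rightarrow> nat) \<Rightarrow> (nat \<Rightarrow> real) \<Rightarrow> nat \<Rightarrow> nat" where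
  "rand_index K L u = (\<lambda>k\<in>{..<K}. cell_index (L k) (u k))"

lemma cell_index_measurable[measurable]: "cell_index L \<in> borel \<rightarrow>\<^sub>M count_space UNIV"
  unfolding cell_index_def by measurable

lemma cell_index_less: "L > 0 \<Longrightarrow> cell_index L u < L"
  by (auto simp: cell_index_def)

lemma emeasure_cell_index:
  assumes "j < L"
  shows "emeasure (uniform_measure lborel {0..1}) {u. cell_index L u = j} = ennreal (1 / real L)"
proof -
  have S: "{u. cell_index L u = j} \<in> sets borel"
    using measurable_sets[OF cell_index_measurable, of "{j}" L] by (simp add: vimage_def)
  have fl: "nat \<lfloor>real L * u\<rfloor> = i \<longleftrightarrow> real i / real L \<le> u \<and> u < (real i + 1) / real L"
    if "0 \<le> u" for u i
  proof -
    have "nat \<lfloor>real L * u\<rfloor> = i \<longleftrightarrow> \<lfloor>real L * u\<rfloor> = int i" using that by auto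
    also have "\<dots> \<longleftrightarrow> real i \<le> real L * u \<and> real L * u < real i + 1" by (simp add: floor_eq_iff)
    finally show ?thesis using assms by (simp add: field_simps)
  qed
  have "emeasure lborel ({0..1} \<inter> {u. cell_index L u = j}) = ennreal (1 / real L)"
  proof (cases "j < L - 1")
    case True
    then have "{0..1} \<inter> {u. cell_index L u = j} = {real j / real L ..< (real j + 1) / real L}"
    proof (intro set_eqI iffI)
      fix u assume u: "u \<in> {real j / real L ..< (real j + 1) / real L}"
      then have "0 \<le> u" by (auto intro: order_trans[rotated])
      moreover have "(real j + 1) / real L \<le> 1" using True by simp
      then have "u \<le> 1" using u by auto
      ultimately show "u \<in> {0..1} \<inter> {u. cell_index L u = j}" using u True fl[of u j]
        by (auto simp: cell_index_def)
    next
      fix u assume u: "u \<in> {0..1} \<inter> {u. cell_index L u = j}"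
      then have "nat \<lfloor>real L * u\<rfloor> = j" using True by (auto simp: cell_index_def min_def split: if_splits)
      then show "u \<in> {real j / real L ..< (real j + 1) / real L}" using u fl[of u j] by auto
    qed
    then show ?thesis using True by (simp add: divide_right_mono diff_divide_distrib[symmetric])
  next
    \<comment> \<open>The last cell also contains the endpoint 1, so it is a closed
      interval.\<close>
    case False
    then have j: "j = L - 1" using assms by simp
    have "{0..1} \<inter> {u. cell_index L u = j} = {real j / real L .. 1}"
    proof (intro set_eqI iffI)
      fix u assume u: "u \<in> {real j / real L .. 1}"
      then have u0: "0 \<le> u" by (auto intro: order_trans[rotated])
      have "real j \<le> real L * u" using u assms by (simp add: field_simps)
      then have "int j \<le> \<lfloor>real L * u\<rfloor>" by (simp add: le_floor_iff)
      then show "u \<in> {0..1} \<inter> {u. cell_index L u = j}" using u u0 j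
        by (auto simp: cell_index_def)
    next
      fix u assume u: "u \<in> {0..1} \<inter> {u. cell_index L u = j}"
      then have "j \<le> nat \<lfloor>real L * u\<rfloor>" using j by (auto simp: cell_index_def)
      moreover have "0 \<le> \<lfloor>real L * u\<rfloor>" using u by auto
      ultimately have "int j \<le> \<lfloor>real L * u\<rfloor>" by linarith
      then have "real j \<le> real L * u" by (simp add: le_floor_iff)
      then show "u \<in> {real j / real L .. 1}" using u assms by (auto simp: field_simps)
    qed
    moreover have "real j / real L \<le> 1" "1 - real j / real L = 1 / real L" using assms j by (auto simp: field_simps of_nat_diff)
    ultimately show ?thesis by simp
  qed
  then show ?thesis using S by (simp add: divide_ennreal_def)
qed

lemma prob_space_unit_interval: "prob_space (uniform_measure lborel {0..1::real})"
  by (rule prob_space_uniform_measure) auto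

lemma prob_space_rand_space: "prob_space (rand_space K)"
  unfolding rand_space_def by (intro prob_space_PiM prob_space_unit_interval)

lemma prob_space_noise_space: "prob_space (noise_space n)"
  unfolding noise_space_def by (intro prob_space_PiM prob_space_normal_density) simp

lemma finite_msg_set: "finite S \<Longrightarrow> finite (msg_set S M)"
  unfolding msg_set_def by (intro finite_PiE) auto

lemma msg_set_nonempty: "(\<And>k. k \<in> S \<Longrightarrow> 0 < M k) \<Longrightarrow> msg_set S M \<noteq> {}"
  unfolding msg_set_def PiE_eq_empty_iff by (metis empty_iff lessThan_iff)

lemma prob_space_sample_space:
  assumes "\<And>k. k < K \<Longrightarrow> 0 < M k"
  shows "prob_space (sample_space K n M)"
proof -
  have U: "prob_space (uniform_count_measure (msg_set {..<K} M))"
    using assms by (intro prob_space_uniform_count_measure finite_msg_set msg_set_nonempty) auto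
  have pp: "prob_space (A \<Otimes>\<^sub>M B)" if "prob_space A" "prob_space B" for A :: "'q measure" and B :: "'r measure"
  proof -
    interpret A: prob_space A by fact
    interpret B: prob_space B by fact
    interpret AB: pair_prob_space A B ..
    show ?thesis by (rule AB.P.prob_space_axioms)
  qed
  show ?thesis unfolding sample_space_def
    by (intro pp U prob_space_rand_space prob_space_noise_space)
qed

lemma sets_noise_space: "sets (noise_space n) = sets (sig_space n)"
  unfolding noise_space_def sig_space_def by (intro sets_PiM_cong) auto

lemma space_noise_space: "space (noise_space n) = extensional {..<n}"
  unfolding noise_space_def by (auto simp: space_PiM PiE_def)

lemma space_sig_space: "space (sig_space n) = extensional {..<n}"
  unfolding sig_space_def by (auto simp: space_PiM PiE_def)

lemma emeasure_rand_index:
  assumes l: "l \<in> PiE {..<K} (\<lambda>k. {..<L k})"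
  defines "C \<equiv> {u \<in> space (rand_space K). rand_index K L u = l}"
  shows "C \<in> sets (rand_space K)" "emeasure (rand_space K) C = ennreal (1 / (\<Prod>k<K. real (L k)))"
proof -
  interpret product_sigma_finite "\<lambda>_::nat. uniform_measure lborel {0..1::real}"
    unfolding product_sigma_finite_def
    using prob_space_unit_interval prob_space_imp_sigma_finite by blast
  have C: "C = PiE {..<K} (\<lambda>k. {u. cell_index (L k) u = l k})"
    using l unfolding C_def rand_index_def rand_space_def
    by (auto simp: space_PiM PiE_def extensional_def fun_eq_iff restrict_def Pi_iff; metis)
  have S: "{u. cell_index (L k) u = l k} \<in> sets borel" for k
    using measurable_sets[OF cell_index_measurable, of "{l k}" "L k"] by (simp add: vimage_def)
  show "C \<in> sets (rand_space K)" unfolding C rand_space_def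
    by (rule sets_PiM_I_finite) (use S in auto)
  have "emeasure (rand_space K) C = (\<Prod>k<K. ennreal (1 / real (L k)))"
    unfolding C rand_space_def using S l
    by (subst emeasure_PiM) (auto intro!: prod.cong emeasure_cell_index simp: PiE_def Pi_iff simp del: emeasure_uniform_measure)
  then show "emeasure (rand_space K) C = ennreal (1 / (\<Prod>k<K. real (L k)))"
    by (simp add: prod_ennreal prod_dividef)
qed

text \<open>Bridge from the sample space to combinatorics: encoders see their private reals only
  through finite indices, so probabilities become finite averages over messages and indices of pure
  noise probabilities.\<close>

lemma measure_sample_space:
  fixes K n :: nat and M L :: "nat \<Rightarrow> nat"
    and Q :: "(nat \<Rightarrow> nat) \<Rightarrow> (nat \<Rightarrow> nat) \<Rightarrow> (nat \<Rightarrow> real) \<times> (nat \<Rightarrow> real) \<Rightarrow> bool"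
  assumes M: "\<And>k. k < K \<Longrightarrow> 0 < M k" and L: "\<And>k. k < K \<Longrightarrow> 0 < L k"
  defines "W \<equiv> msg_set {..<K} M" and "\<Lambda> \<equiv> PiE {..<K} (\<lambda>k. {..<L k})"
    and "NN \<equiv> noise_space n \<Otimes>\<^sub>M noise_space n"
  assumes Q: "\<And>w l. w \<in> W \<Longrightarrow> l \<in> \<Lambda> \<Longrightarrow> {z \<in> space NN. Q w l z} \<in> sets NN"
  defines "E \<equiv> {\<omega> \<in> space (sample_space K n M). Q (fst \<omega>) (rand_index K L (fst (snd \<omega>))) (snd (snd \<omega>))}"
  shows "E \<in> sets (sample_space K n M)"
    and "measure (sample_space K n M) E
      = (\<Sum>w\<in>W. \<Sum>l\<in>\<Lambda>. measure NN {z \<in> space NN. Q w l z}) / (real (card W) * (\<Prod>k<K. real (L k)))"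
proof -
  let ?S = "sample_space K n M"
  let ?U = "uniform_count_measure W"
  define C where "C l = {u \<in> space (rand_space K). rand_index K L u = l}" for l
  interpret P: prob_space ?S by (rule prob_space_sample_space) (rule M)
  interpret U: prob_space ?U unfolding W_def
    using M by (intro prob_space_uniform_count_measure finite_msg_set msg_set_nonempty) auto
  interpret R: prob_space "rand_space K" by (rule prob_space_rand_space)
  interpret N: prob_space "noise_space n" by (rule prob_space_noise_space)
  interpret NNi: pair_prob_space "noise_space n" "noise_space n" ..
  interpret RN: pair_prob_space "rand_space K" NN unfolding NN_def ..
  have finW: "finite W" unfolding W_def by (intro finite_msg_set) auto
  have fin\<Lambda>: "finite \<Lambda>" unfolding \<Lambda>_def by (intro finite_PiE) auto
  \<comment> \<open>The event is a finite disjoint union of boxes, one for each message tuple and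
    index tuple.\<close>
  define D where "D = (\<lambda>(w, l). {w} \<times> (C l \<times> {z \<in> space NN. Q w l z}))"
  have S: "?S = ?U \<Otimes>\<^sub>M (rand_space K \<Otimes>\<^sub>M NN)" unfolding sample_space_def W_def NN_def ..
  have ri: "rand_index K L u \<in> \<Lambda>" for u
    using L by (auto simp: rand_index_def \<Lambda>_def cell_index_less)
  have E: "E = (\<Union>p\<in>W \<times> \<Lambda>. D p)"
    using ri by (auto simp: E_def D_def C_def S space_pair_measure space_uniform_count_measure)
  have Cs: "C l \<in> sets (rand_space K)" "emeasure (rand_space K) (C l) = ennreal (1 / (\<Prod>k<K. real (L k)))" if "l \<in> \<Lambda>" for l
    using emeasure_rand_index[of l K L] that unfolding \<Lambda>_def C_def by auto
  have Ds: "D p \<in> sets ?S" if "p \<in> W \<times> \<Lambda>" for p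
    using that Cs Q unfolding S D_def by (auto intro!: pair_measureI simp: sets_uniform_count_measure)
  show "E \<in> sets ?S" unfolding E using finW fin\<Lambda> Ds by (intro sets.finite_UN) auto
  have Dm: "measure ?S (D (w, l)) = measure NN {z \<in> space NN. Q w l z} / (real (card W) * (\<Prod>k<K. real (L k)))"
    if wl: "w \<in> W" "l \<in> \<Lambda>" for w l
  proof -
    have "emeasure ?S (D (w, l)) = emeasure ?U {w} * (emeasure (rand_space K) (C l) * emeasure NN {z \<in> space NN. Q w l z})"
      unfolding S D_def using wl Cs Q
      by (simp add: RN.emeasure_pair_measure_Times RN.M2.emeasure_pair_measure_Times sets_uniform_count_measure)
    also have "\<dots> = ennreal (1 / real (card W)) * (ennreal (1 / (\<Prod>k<K. real (L k))) * ennreal (measure NN {z \<in> space NN. Q w l z}))"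
      using wl finW Cs by (simp add: emeasure_uniform_count_measure RN.M2.emeasure_eq_measure)
    also have "\<dots> = ennreal (measure NN {z \<in> space NN. Q w l z} / (real (card W) * (\<Prod>k<K. real (L k))))"
      by (simp add: ennreal_mult[symmetric] prod_nonneg field_simps)
    finally show ?thesis by (intro measure_eq_emeasure_eq_ennreal) (auto intro!: divide_nonneg_nonneg mult_nonneg_nonneg prod_nonneg)
  qed
  have "measure ?S E = (\<Sum>p\<in>W \<times> \<Lambda>. measure ?S (D p))"
    unfolding E using finW fin\<Lambda> Ds
    by (intro P.finite_measure_finite_Union) (auto simp: disjoint_family_on_def D_def C_def)
  also have "\<dots> = (\<Sum>(w,l)\<in>W \<times> \<Lambda>. measure NN {z \<in> space NN. Q w l z} / (real (card W) * (\<Prod>k<K. real (L k))))"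
    using Dm by (intro sum.cong) auto
  also have "\<dots> = (\<Sum>w\<in>W. \<Sum>l\<in>\<Lambda>. measure NN {z \<in> space NN. Q w l z}) / (real (card W) * (\<Prod>k<K. real (L k)))"
    by (simp add: sum.cartesian_product[symmetric] sum_divide_distrib)
  finally show "measure ?S E
      = (\<Sum>w\<in>W. \<Sum>l\<in>\<Lambda>. measure NN {z \<in> space NN. Q w l z}) / (real (card W) * (\<Prod>k<K. real (L k)))" .
qed

section \<open>Gaussian noise: density, and null sets under translation\<close>

lemma noise_space_density:
  "noise_space n = density (sig_space n) (\<lambda>x. \<Prod>t<n. ennreal (std_normal_density (x t)))"
proof -
  interpret B: product_sigma_finite "\<lambda>_::nat. lborel :: real measure"
    ..
  interpret D: product_sigma_finite "\<lambda>_::nat. density lborel std_normal_density"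
    unfolding product_sigma_finite_def
    using prob_space_normal_density[of 1 0] prob_space_imp_sigma_finite by auto
  show ?thesis unfolding noise_space_def
  proof (rule D.PiM_eqI[symmetric])
    show "sets (density (sig_space n) (\<lambda>x. \<Prod>t<n. ennreal (std_normal_density (x t))))
        = sets (Pi\<^sub>M {..<n} (\<lambda>_. density lborel std_normal_density))"
      using sets_noise_space[of n] unfolding noise_space_def by simp
    fix A :: "nat \<Rightarrow> real set" assume "\<And>i. i \<in> {..<n} \<Longrightarrow> A i \<in> sets (density lborel std_normal_density)"
    then have A: "\<And>i. i < n \<Longrightarrow> A i \<in> sets borel" by simp
    have [measurable]: "(\<lambda>x. \<Prod>t<n. ennreal (std_normal_density (x t))) \<in> borel_measurable (sig_space n)"
      unfolding sig_space_def by measurable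
    have AS: "PiE {..<n} A \<in> sets (sig_space n)" unfolding sig_space_def using A by (intro sets_PiM_I_finite) auto
    have "emeasure (density (sig_space n) (\<lambda>x. \<Prod>t<n. ennreal (std_normal_density (x t)))) (PiE {..<n} A)
      = (\<integral>\<^sup>+x. (\<Prod>t<n. ennreal (std_normal_density (x t))) * indicator (PiE {..<n} A) x \<partial>sig_space n)"
      using AS by (subst emeasure_density) auto
    also have "\<dots> = (\<integral>\<^sup>+x. (\<Prod>t<n. ennreal (std_normal_density (x t)) * indicator (A t) (x t)) \<partial>sig_space n)"
    proof (rule nn_integral_cong)
      fix x assume x: "x \<in> space (sig_space n)"
      show "(\<Prod>t<n. ennreal (std_normal_density (x t))) * indicator (PiE {..<n} A) x
         = (\<Prod>t<n. ennreal (std_normal_density (x t)) * indicator (A t) (x t))"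
      proof (cases "\<forall>t<n. x t \<in> A t")
        case True
        then show ?thesis using x by (auto simp: space_sig_space PiE_def intro!: prod.cong)
      next
        case False
        then obtain t where t: "t < n" "x t \<notin> A t" by auto
        then have "(\<Prod>t<n. ennreal (std_normal_density (x t)) * indicator (A t) (x t)) = 0"
          by (intro prod_zero bexI[of _ t]) auto
        moreover have "x \<notin> PiE {..<n} A" using t by auto
        ultimately show ?thesis by simp
      qed
    qed
    also have "\<dots> = (\<Prod>t<n. \<integral>\<^sup>+y. ennreal (std_normal_density y) * indicator (A t) y \<partial>lborel)"
      unfolding sig_space_def using A by (subst B.product_nn_integral_prod) auto
    also have "\<dots> = (\<Prod>i\<in>{..<n}. emeasure (density lborel std_normal_density) (A i))"
      using A by (intro prod.cong) (auto simp: emeasure_density)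
    finally show "emeasure (density (sig_space n) (\<lambda>x. \<Prod>t<n. ennreal (std_normal_density (x t)))) (PiE {..<n} A)
      = (\<Prod>i\<in>{..<n}. emeasure (density lborel std_normal_density) (A i))" .
  qed auto
qed

lemma shift_measurable: "(\<lambda>x. \<lambda>t\<in>{..<n}. v t + x t) \<in> sig_space n \<rightarrow>\<^sub>M sig_space n"
  unfolding sig_space_def by (intro measurable_restrict) measurable

lemma distr_sig_space_shift: "distr (sig_space n) (sig_space n) (\<lambda>x. \<lambda>t\<in>{..<n}. v t + x t) = sig_space n"
proof -
  interpret B: product_sigma_finite "\<lambda>_::nat. lborel :: real measure"
    ..
  show ?thesis
    unfolding sig_space_def
  proof (rule B.PiM_eqI)
    fix A :: "nat \<Rightarrow> real set" assume "\<And>i. i \<in> {..<n} \<Longrightarrow> A i \<in> sets lborel"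
    then have A: "\<And>i. i < n \<Longrightarrow> A i \<in> sets borel" by simp
    have As: "(+) (v t) -` A t \<in> sets borel" if "t < n" for t
      using measurable_sets[OF _ A[OF that], of "(+) (v t)" borel] by simp
    have tr: "emeasure lborel ((+) (v t) -` A t) = emeasure lborel (A t)" if "t < n" for t
    proof -
      have "emeasure (distr lborel borel ((+) (v t))) (A t) = emeasure lborel ((+) (v t) -` A t \<inter> space lborel)"
        by (rule emeasure_distr) (use A[OF that] in simp_all)
      then show ?thesis by (simp add: lborel_distr_plus)
    qed
    have "emeasure (distr (PiM {..<n} (\<lambda>_. lborel)) (PiM {..<n} (\<lambda>_. lborel)) (\<lambda>x. \<lambda>t\<in>{..<n}. v t + x t)) (PiE {..<n} A)
        = emeasure (PiM {..<n} (\<lambda>_. lborel)) (PiE {..<n} (\<lambda>t. (+) (v t) -` A t))"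
    proof -
      have "PiE {..<n} A \<in> sets (PiM {..<n} (\<lambda>_. lborel))" using A by (intro sets_PiM_I_finite) auto
      moreover have "(\<lambda>x. \<lambda>t\<in>{..<n}. v t + x t) -` PiE {..<n} A \<inter> space (PiM {..<n} (\<lambda>_. lborel :: real measure))
          = PiE {..<n} (\<lambda>t. (+) (v t) -` A t)"
        by (intro set_eqI) (simp add: space_PiM PiE_iff)
      ultimately show ?thesis
        using shift_measurable[of v n] unfolding sig_space_def by (simp add: emeasure_distr)
    qed
    also have "\<dots> = (\<Prod>i\<in>{..<n}. emeasure lborel (A i))"
      using As tr by (subst B.emeasure_PiM) auto
    finally show "emeasure (distr (PiM {..<n} (\<lambda>_. lborel)) (PiM {..<n} (\<lambda>_. lborel)) (\<lambda>x. \<lambda>t\<in>{..<n}. v t + x t)) (PiE {..<n} A)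
      = (\<Prod>i\<in>{..<n}. emeasure lborel (A i))" .
  qed auto
qed

text \<open>Lebesgue null sets are translation invariant and the noise has a density. This is the
  source of the density of the eavesdropper's output on which the conditional entropy bound
  rests.\<close>

lemma noise_shift_null:
  assumes N: "N \<in> null_sets (sig_space n)"
  shows "emeasure (noise_space n) {x \<in> space (noise_space n). (\<lambda>t\<in>{..<n}. v t + x t) \<in> N} = 0"
proof -
  let ?g = "\<lambda>x. \<lambda>t\<in>{..<n}. v t + x t"
  have "N \<in> null_sets (distr (sig_space n) (sig_space n) ?g)" using N by (simp add: distr_sig_space_shift)
  then have "?g -` N \<inter> space (sig_space n) \<in> null_sets (sig_space n)"
    by (simp add: null_sets_distr_iff[OF shift_measurable])
  moreover have "absolutely_continuous (sig_space n) (noise_space n)"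
    unfolding noise_space_density by (rule absolutely_continuousI_density) (simp add: sig_space_def)
  ultimately have "?g -` N \<inter> space (sig_space n) \<in> null_sets (noise_space n)"
    unfolding absolutely_continuous_def by auto
  then show ?thesis
    by (auto simp: space_noise_space space_sig_space null_sets_def Int_def conj_commute vimage_def)
qed

section \<open>Schemes with finite encoder randomness\<close>

definition gauss_shift :: "nat \<Rightarrow> (nat \<Rightarrow> real) \<Rightarrow> (nat \<Rightarrow> real) set \<Rightarrow> real" where
  "gauss_shift n v A = measure (noise_space n) {x \<in> space (noise_space n). (\<lambda>t\<in>{..<n}. v t + x t) \<in> A}"

lemma gauss_shift_sets:
  assumes "A \<in> sets (sig_space n)"
  shows "{x \<in> space (noise_space n). (\<lambda>t\<in>{..<n}. v t + x t) \<in> A} \<in> sets (noise_space n)"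
  using measurable_sets[OF shift_measurable assms, of v]
  by (simp add: sets_noise_space space_noise_space space_sig_space vimage_def Int_def conj_commute)

lemma gauss_shift_nonneg: "0 \<le> gauss_shift n v A"
  by (simp add: gauss_shift_def)

lemma gauss_shift_le_1: "gauss_shift n v A \<le> 1"
  unfolding gauss_shift_def by (rule prob_space.prob_le_1[OF prob_space_noise_space])

lemma gauss_shift_cong: "(\<And>t. t < n \<Longrightarrow> v t = v' t) \<Longrightarrow> gauss_shift n v A = gauss_shift n v' A"
  unfolding gauss_shift_def by (intro arg_cong[where f="measure _"] Collect_cong conj_cong refl arg_cong[where f="\<lambda>y. y \<in> A"] restrict_ext) simp

lemma measure_noise_pair:
  assumes B: "B \<in> sets (noise_space n)"
  shows "measure (noise_space n \<Otimes>\<^sub>M noise_space n) {z \<in> space (noise_space n \<Otimes>\<^sub>M noise_space n). fst z \<in> B} = measure (noise_space n) B"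
    and "measure (noise_space n \<Otimes>\<^sub>M noise_space n) {z \<in> space (noise_space n \<Otimes>\<^sub>M noise_space n). snd z \<in> B} = measure (noise_space n) B"
    and "{z \<in> space (noise_space n \<Otimes>\<^sub>M noise_space n). fst z \<in> B} \<in> sets (noise_space n \<Otimes>\<^sub>M noise_space n)"
    and "{z \<in> space (noise_space n \<Otimes>\<^sub>M noise_space n). snd z \<in> B} \<in> sets (noise_space n \<Otimes>\<^sub>M noise_space n)"
proof -
  interpret N: prob_space "noise_space n" by (rule prob_space_noise_space)
  have sub: "B \<subseteq> space (noise_space n)" by (rule sets.sets_into_space[OF B])
  have e: "{z \<in> space (noise_space n \<Otimes>\<^sub>M noise_space n). fst z \<in> B} = B \<times> space (noise_space n)"
    "{z \<in> space (noise_space n \<Otimes>\<^sub>M noise_space n). snd z \<in> B} = space (noise_space n) \<times> B"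
    using sub by (auto simp: space_pair_measure)
  show "measure (noise_space n \<Otimes>\<^sub>M noise_space n) {z \<in> space (noise_space n \<Otimes>\<^sub>M noise_space n). fst z \<in> B} = measure (noise_space n) B"
    unfolding e measure_def using B by (simp add: N.emeasure_pair_measure_Times N.emeasure_space_1)
  show "measure (noise_space n \<Otimes>\<^sub>M noise_space n) {z \<in> space (noise_space n \<Otimes>\<^sub>M noise_space n). snd z \<in> B} = measure (noise_space n) B"
    unfolding e measure_def using B by (simp add: N.emeasure_pair_measure_Times N.emeasure_space_1)
  show "{z \<in> space (noise_space n \<Otimes>\<^sub>M noise_space n). fst z \<in> B} \<in> sets (noise_space n \<Otimes>\<^sub>M noise_space n)"
    unfolding e using B by (intro pair_measureI) auto
  show "{z \<in> space (noise_space n \<Otimes>\<^sub>M noise_space n). snd z \<in> B} \<in> sets (noise_space n \<Otimes>\<^sub>M noise_space n)"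
    unfolding e using B by (intro pair_measureI) auto
qed

section \<open>Counting message tuples with prescribed components\<close>

lemma fiber_msg_set:
  assumes I: "finite I" "S \<subseteq> I" and x: "x \<in> msg_set S M"
  shows "{w \<in> msg_set I M. restrict w S = x} = PiE I (\<lambda>k. if k \<in> S then {x k} else {..<M k})" (is "?A = ?B")
proof (intro set_eqI iffI)
  fix w assume "w \<in> ?A"
  then have w: "w \<in> msg_set I M" "restrict w S = x" by auto
  have "w k = x k" if "k \<in> S" for k using w(2) that by auto
  then show "w \<in> ?B" using w(1) unfolding msg_set_def by (auto simp: PiE_iff)
next
  fix w assume w: "w \<in> ?B"
  have wk: "w k = x k" if "k \<in> S" for k using PiE_mem[OF w, of k] that I by auto
  have "restrict w S = x"
  proof
    fix k show "restrict w S k = x k"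
      using wk[of k] x PiE_arb[of x S _ k] unfolding msg_set_def by (cases "k \<in> S") auto
  qed
  moreover have "w k < M k" if "k \<in> I" for k
    using PiE_mem[OF w that] wk[of k] x PiE_mem[of x S _ k] unfolding msg_set_def by (cases "k \<in> S") auto
  moreover have "w \<in> extensional I" using w by (simp add: PiE_def)
  ultimately show "w \<in> ?A" by (auto simp: msg_set_def PiE_iff)
qed

lemma card_msg_set: "finite S \<Longrightarrow> card (msg_set S M) = (\<Prod>k\<in>S. M k)"
  unfolding msg_set_def by (simp add: card_PiE)

lemma card_fiber_msg_set:
  assumes I: "finite I" "S \<subseteq> I" and x: "x \<in> msg_set S M"
  shows "card {w \<in> msg_set I M. restrict w S = x} * card (msg_set S M) = card (msg_set I M)"
proof -
  have "card {w \<in> msg_set I M. restrict w S = x} = (\<Prod>k\<in>I. if k \<in> S then 1 else M k)"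
    unfolding fiber_msg_set[OF assms] using I(1) by (subst card_PiE) (auto intro!: prod.cong)
  also have "\<dots> = (\<Prod>k\<in>I - S. M k)"
    using I by (intro prod.mono_neutral_cong_right) auto
  finally have "card {w \<in> msg_set I M. restrict w S = x} = (\<Prod>k\<in>I - S. M k)" .
  moreover have "(\<Prod>k\<in>I. M k) = (\<Prod>k\<in>I - S. M k) * (\<Prod>k\<in>S. M k)"
    by (rule prod.subset_diff) (use I in auto)
  ultimately show ?thesis using I finite_subset[OF I(2,1)] by (simp add: card_msg_set)
qed

lemma restrict_msg_set: "S \<subseteq> I \<Longrightarrow> w \<in> msg_set I M \<Longrightarrow> restrict w S \<in> msg_set S M"
  unfolding msg_set_def by (auto simp: PiE_iff)

text \<open>All fibres of the restriction have equal size, so the marginal of a uniform tuple is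
  uniform. Stated cross-multiplied to avoid division.\<close>

lemma sum_restrict_msg_set:
  fixes g :: "(nat \<Rightarrow> nat) \<Rightarrow> real"
  assumes I: "finite I" "S \<subseteq> I"
  shows "(\<Sum>w\<in>msg_set I M. g (restrict w S)) * card (msg_set S M) = (\<Sum>x\<in>msg_set S M. g x) * card (msg_set I M)"
proof -
  have fS: "finite S" using I finite_subset by auto
  have "(\<Sum>w\<in>msg_set I M. g (restrict w S)) = (\<Sum>x\<in>msg_set S M. \<Sum>w\<in>{w \<in> msg_set I M. restrict w S = x}. g (restrict w S))"
    using restrict_msg_set[OF I(2)] by (intro sum.group[symmetric] finite_msg_set I fS) auto
  also have "\<dots> = (\<Sum>x\<in>msg_set S M. g x * card {w \<in> msg_set I M. restrict w S = x})"
    by (intro sum.cong refl) simp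
  finally have A: "(\<Sum>w\<in>msg_set I M. g (restrict w S))
     = (\<Sum>x\<in>msg_set S M. g x * card {w \<in> msg_set I M. restrict w S = x})" .
  have "(\<Sum>w\<in>msg_set I M. g (restrict w S)) * card (msg_set S M)
     = (\<Sum>x\<in>msg_set S M. g x * real (card {w \<in> msg_set I M. restrict w S = x} * card (msg_set S M)))"
    unfolding A sum_distrib_right of_nat_mult by (simp only: mult.assoc)
  also have "\<dots> = (\<Sum>x\<in>msg_set S M. g x * real (card (msg_set I M)))"
    by (intro sum.cong refl) (simp only: card_fiber_msg_set[OF I])
  finally show ?thesis by (simp only: sum_distrib_right)
qed

text \<open>Stochastic encoders reduced to tables: user \<open>k\<close> with message
  \<open>w\<close> sends the signal \<open>s k w l\<close>, where \<open>l\<close> is a uniform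
  index below \<open>L k\<close> computed from its private real.\<close>

locale mac_scheme =
  fixes K n :: nat and M L :: "nat \<Rightarrow> nat" and s :: "nat \<Rightarrow> nat \<Rightarrow> nat \<Rightarrow> nat \<Rightarrow> real"
  assumes M_pos: "k < K \<Longrightarrow> 0 < M k" and L_pos: "k < K \<Longrightarrow> 0 < L k"
begin

definition enc :: "nat \<Rightarrow> nat \<Rightarrow> real \<Rightarrow> nat \<Rightarrow> real" where
  "enc k w u = (\<lambda>t\<in>{..<n}. s k w (cell_index (L k) u) t)"

definition comb :: "(nat \<Rightarrow> real) \<Rightarrow> (nat \<Rightarrow> nat) \<Rightarrow> (nat \<Rightarrow> nat) \<Rightarrow> nat \<Rightarrow> real" where
  "comb g w l t = (\<Sum>k<K. g k * s k (w k) (l k) t)"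

abbreviation "Msgs \<equiv> msg_set {..<K} M"
abbreviation "Rands \<equiv> PiE {..<K} (\<lambda>k. {..<L k})"
abbreviation "\<Omega> \<equiv> sample_space K n M"
abbreviation "ridx \<omega> \<equiv> rand_index K L (fst (snd \<omega>))"

text \<open>The conditional law of a channel output given the messages, a finite mixture of
  translated Gaussians; taken with \<open>h\<close> for the receiver and \<open>he\<close> for the
  eavesdropper.\<close>

definition law :: "(nat \<Rightarrow> real) \<Rightarrow> (nat \<Rightarrow> nat) \<Rightarrow> (nat \<Rightarrow> real) set \<Rightarrow> real" where
  "law g w A = (\<Sum>l\<in>Rands. gauss_shift n (comb g w l) A) / (\<Prod>k<K. real (L k))"

lemma enc_measurable: "enc k w \<in> lborel \<rightarrow>\<^sub>M sig_space n"
  unfolding enc_def[abs_def] sig_space_def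
  by (intro measurable_restrict) (auto intro!: measurable_compose[OF cell_index_measurable])

lemma rx_Y_eq: "rx_Y K n h enc \<omega> = (\<lambda>t\<in>{..<n}. comb h (fst \<omega>) (ridx \<omega>) t + fst (snd (snd \<omega>)) t)"
  unfolding rx_Y_def comb_def tx_def enc_def rand_index_def
  by (intro restrict_ext arg_cong2[where f="(+)"] sum.cong refl) auto

lemma rx_Z_eq: "rx_Z K n h enc \<omega> = (\<lambda>t\<in>{..<n}. comb h (fst \<omega>) (ridx \<omega>) t + snd (snd (snd \<omega>)) t)"
  unfolding rx_Z_def comb_def tx_def enc_def rand_index_def
  by (intro restrict_ext arg_cong2[where f="(+)"] sum.cong refl) auto

lemma prob_space_\<Omega>: "prob_space \<Omega>"
  by (rule prob_space_sample_space) (rule M_pos)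

lemma card_Msgs_pos: "0 < card Msgs"
  using finite_msg_set[of "{..<K}" M] msg_set_nonempty[of "{..<K}" M] M_pos by (simp add: card_gt_0_iff)

lemma fst_\<Omega>: "\<omega> \<in> space \<Omega> \<Longrightarrow> fst \<omega> \<in> Msgs"
  by (auto simp: sample_space_def space_pair_measure space_uniform_count_measure)

text \<open>The set \<open>B\<close> may depend on the message tuple so that the event of wrong
  decoding is covered.\<close>

lemma measure_rx_Y:
  assumes B: "\<And>w. w \<in> Msgs \<Longrightarrow> B w \<in> sets (sig_space n)"
  shows "{\<omega> \<in> space \<Omega>. rx_Y K n h enc \<omega> \<in> B (fst \<omega>)} \<in> sets \<Omega>"
    and "measure \<Omega> {\<omega> \<in> space \<Omega>. rx_Y K n h enc \<omega> \<in> B (fst \<omega>)} = (\<Sum>w\<in>Msgs. law h w (B w)) / card Msgs"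
proof -
  define NN where "NN = noise_space n \<Otimes>\<^sub>M noise_space n"
  define Q where "Q w l z \<longleftrightarrow> (\<lambda>t\<in>{..<n}. comb h w l t + fst z t) \<in> B w" for w l and z :: "(nat \<Rightarrow> real) \<times> (nat \<Rightarrow> real)"
  have eq: "{z \<in> space NN. Q w l z} = {z \<in> space NN. fst z \<in> {x \<in> space (noise_space n). (\<lambda>t\<in>{..<n}. comb h w l t + x t) \<in> B w}}" for w l
    unfolding Q_def NN_def by (auto simp: space_pair_measure)
  have Qs: "{z \<in> space NN. Q w l z} \<in> sets NN" if "w \<in> Msgs" for w l
    unfolding eq unfolding NN_def by (intro measure_noise_pair gauss_shift_sets B that)
  have Qm: "measure NN {z \<in> space NN. Q w l z} = gauss_shift n (comb h w l) (B w)" if "w \<in> Msgs" for w l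
    unfolding eq unfolding NN_def by (subst measure_noise_pair) (auto intro!: gauss_shift_sets B that simp: gauss_shift_def)
  have E: "{\<omega> \<in> space \<Omega>. rx_Y K n h enc \<omega> \<in> B (fst \<omega>)} = {\<omega> \<in> space \<Omega>. Q (fst \<omega>) (ridx \<omega>) (snd (snd \<omega>))}"
    unfolding Q_def rx_Y_eq ..
  note * = measure_sample_space[where K=K and M=M and L=L and n=n and Q=Q, OF M_pos L_pos Qs[unfolded NN_def], simplified]
  show "{\<omega> \<in> space \<Omega>. rx_Y K n h enc \<omega> \<in> B (fst \<omega>)} \<in> sets \<Omega>" unfolding E by (rule *(1))
  show "measure \<Omega> {\<omega> \<in> space \<Omega>. rx_Y K n h enc \<omega> \<in> B (fst \<omega>)} = (\<Sum>w\<in>Msgs. law h w (B w)) / card Msgs"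
    unfolding E *(2) law_def using Qm[unfolded NN_def]
    by (simp add: sum_divide_distrib[symmetric] mult.commute)
qed

lemma measure_rx_Z:
  assumes B: "\<And>w. w \<in> Msgs \<Longrightarrow> B w \<in> sets (sig_space n)"
  shows "{\<omega> \<in> space \<Omega>. rx_Z K n h enc \<omega> \<in> B (fst \<omega>)} \<in> sets \<Omega>"
    and "measure \<Omega> {\<omega> \<in> space \<Omega>. rx_Z K n h enc \<omega> \<in> B (fst \<omega>)} = (\<Sum>w\<in>Msgs. law h w (B w)) / card Msgs"
proof -
  define NN where "NN = noise_space n \<Otimes>\<^sub>M noise_space n"
  define Q where "Q w l z \<longleftrightarrow> (\<lambda>t\<in>{..<n}. comb h w l t + snd z t) \<in> B w" for w l and z :: "(nat \<Rightarrow> real) \<times> (nat \<Rightarrow> real)"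
  have eq: "{z \<in> space NN. Q w l z} = {z \<in> space NN. snd z \<in> {x \<in> space (noise_space n). (\<lambda>t\<in>{..<n}. comb h w l t + x t) \<in> B w}}" for w l
    unfolding Q_def NN_def by (auto simp: space_pair_measure)
  have Qs: "{z \<in> space NN. Q w l z} \<in> sets NN" if "w \<in> Msgs" for w l
    unfolding eq unfolding NN_def by (intro measure_noise_pair gauss_shift_sets B that)
  have Qm: "measure NN {z \<in> space NN. Q w l z} = gauss_shift n (comb h w l) (B w)" if "w \<in> Msgs" for w l
    unfolding eq unfolding NN_def by (subst measure_noise_pair) (auto intro!: gauss_shift_sets B that simp: gauss_shift_def)
  have E: "{\<omega> \<in> space \<Omega>. rx_Z K n h enc \<omega> \<in> B (fst \<omega>)} = {\<omega> \<in> space \<Omega>. Q (fst \<omega>) (ridx \<omega>) (snd (snd \<omega>))}"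
    unfolding Q_def rx_Z_eq ..
  note * = measure_sample_space[where K=K and M=M and L=L and n=n and Q=Q, OF M_pos L_pos Qs[unfolded NN_def], simplified]
  show "{\<omega> \<in> space \<Omega>. rx_Z K n h enc \<omega> \<in> B (fst \<omega>)} \<in> sets \<Omega>" unfolding E by (rule *(1))
  show "measure \<Omega> {\<omega> \<in> space \<Omega>. rx_Z K n h enc \<omega> \<in> B (fst \<omega>)} = (\<Sum>w\<in>Msgs. law h w (B w)) / card Msgs"
    unfolding E *(2) law_def using Qm[unfolded NN_def]
    by (simp add: sum_divide_distrib[symmetric] mult.commute)
qed

end

lemma gauss_shift_space: "gauss_shift n v (space (sig_space n)) = 1"
proof -
  have "{x \<in> space (noise_space n). (\<lambda>t\<in>{..<n}. v t + x t) \<in> space (sig_space n)} = space (noise_space n)"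
    by (auto simp: space_sig_space)
  then show ?thesis unfolding gauss_shift_def by (simp add: prob_space.prob_space[OF prob_space_noise_space])
qed

section \<open>Messages, output and equivocation of a scheme\<close>

context mac_scheme
begin

lemma prod_L_pos: "0 < (\<Prod>k<K. real (L k))"
  using L_pos by (intro prod_pos) auto

lemma card_Rands: "real (card Rands) = (\<Prod>k<K. real (L k))"
  by (subst card_PiE) auto

lemma law_space: "law g w (space (sig_space n)) = 1"
  unfolding law_def gauss_shift_space sum_constant mult_1_right card_Rands using L_pos by simp

lemma law_empty: "law g w {} = 0"
  by (simp add: law_def gauss_shift_def)

lemma rx_Z_measurable: "rx_Z K n he enc \<in> \<Omega> \<rightarrow>\<^sub>M sig_space n"
proof (rule measurableI)
  fix A assume "A \<in> sets (sig_space n)"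
  then show "rx_Z K n he enc -` A \<inter> space \<Omega> \<in> sets \<Omega>"
    using measure_rx_Z(1)[of "\<lambda>_. A" he] by (simp add: vimage_def Int_def conj_commute)
qed (simp add: space_sig_space rx_Z_def)

lemma rx_Z_absolutely_continuous: "absolutely_continuous (sig_space n) (distr \<Omega> (sig_space n) (rx_Z K n he enc))"
  unfolding absolutely_continuous_def
proof
  interpret prob_space \<Omega> by (rule prob_space_\<Omega>)
  fix N assume N: "N \<in> null_sets (sig_space n)"
  then have Ns: "N \<in> sets (sig_space n)" by auto
  have "gauss_shift n v N = 0" for v
    using noise_shift_null[OF N, of v] by (simp add: gauss_shift_def measure_def)
  then have "prob {\<omega> \<in> space \<Omega>. rx_Z K n he enc \<omega> \<in> N} = 0"
    using measure_rx_Z(2)[of "\<lambda>_. N" he] Ns by (simp add: law_def)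
  then have "emeasure \<Omega> (rx_Z K n he enc -` N \<inter> space \<Omega>) = 0"
    by (simp add: emeasure_eq_measure vimage_def Int_def conj_commute)
  then show "N \<in> null_sets (distr \<Omega> (sig_space n) (rx_Z K n he enc))"
    using Ns by (simp add: null_sets_def emeasure_distr rx_Z_measurable)
qed

lemma measure_msg_rx_Z:
  assumes "\<And>w. w \<in> Msgs \<Longrightarrow> B w \<in> sets (sig_space n)"
  shows "{\<omega> \<in> space \<Omega>. R (fst \<omega>) \<and> rx_Z K n h enc \<omega> \<in> B (fst \<omega>)} \<in> sets \<Omega>"
    and "measure \<Omega> {\<omega> \<in> space \<Omega>. R (fst \<omega>) \<and> rx_Z K n h enc \<omega> \<in> B (fst \<omega>)}
       = (\<Sum>w\<in>{w \<in> Msgs. R w}. law h w (B w)) / card Msgs"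
proof -
  define B' where "B' w = (if R w then B w else {})" for w
  have B': "w \<in> Msgs \<Longrightarrow> B' w \<in> sets (sig_space n)" for w using assms by (simp add: B'_def)
  have E: "{\<omega> \<in> space \<Omega>. R (fst \<omega>) \<and> rx_Z K n h enc \<omega> \<in> B (fst \<omega>)}
      = {\<omega> \<in> space \<Omega>. rx_Z K n h enc \<omega> \<in> B' (fst \<omega>)}" by (auto simp: B'_def)
  show "{\<omega> \<in> space \<Omega>. R (fst \<omega>) \<and> rx_Z K n h enc \<omega> \<in> B (fst \<omega>)} \<in> sets \<Omega>"
    unfolding E by (rule measure_rx_Z(1)[of B', OF B'])
  have "(\<Sum>w\<in>Msgs. law h w (B' w)) = (\<Sum>w\<in>{w \<in> Msgs. R w}. law h w (B w))"
    by (rule sum.mono_neutral_cong_right) (auto simp: finite_msg_set B'_def law_empty)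
  then show "measure \<Omega> {\<omega> \<in> space \<Omega>. R (fst \<omega>) \<and> rx_Z K n h enc \<omega> \<in> B (fst \<omega>)}
       = (\<Sum>w\<in>{w \<in> Msgs. R w}. law h w (B w)) / card Msgs"
    unfolding E using measure_rx_Z(2)[of B', OF B'] by simp
qed

lemma msg_measurable: "(\<lambda>\<omega>. restrict (fst \<omega>) S) \<in> \<Omega> \<rightarrow>\<^sub>M count_space (msg_set S M)" if "S \<subseteq> {..<K}"
proof (rule measurableI)
  show "restrict (fst \<omega>) S \<in> space (count_space (msg_set S M))" if "\<omega> \<in> space \<Omega>" for \<omega>
    using restrict_msg_set[OF \<open>S \<subseteq> {..<K}\<close> fst_\<Omega>[OF that]] by simp
  fix A
  have "{\<omega> \<in> space \<Omega>. restrict (fst \<omega>) S \<in> A \<and> rx_Z K n h enc \<omega> \<in> space (sig_space n)} \<in> sets \<Omega>"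
    by (rule measure_msg_rx_Z(1)) auto
  then show "(\<lambda>\<omega>. restrict (fst \<omega>) S) -` A \<inter> space \<Omega> \<in> sets \<Omega>"
    by (simp add: vimage_def Int_def conj_commute space_sig_space rx_Z_def)
qed

lemma prob_msg:
  assumes S: "S \<subseteq> {..<K}" and x: "x \<in> msg_set S M"
  shows "measure \<Omega> {\<omega> \<in> space \<Omega>. restrict (fst \<omega>) S = x} = 1 / card (msg_set S M)"
proof -
  have "measure \<Omega> {\<omega> \<in> space \<Omega>. restrict (fst \<omega>) S = x}
     = measure \<Omega> {\<omega> \<in> space \<Omega>. restrict (fst \<omega>) S = x \<and> rx_Z K n h enc \<omega> \<in> space (sig_space n)}"
    by (simp add: space_sig_space rx_Z_def)
  also have "\<dots> = card {w \<in> Msgs. restrict w S = x} / card Msgs"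
    by (subst measure_msg_rx_Z(2)) (auto simp: law_space)
  also have "\<dots> = 1 / card (msg_set S M)"
  proof -
    have eq: "real (card {w \<in> Msgs. restrict w S = x}) * real (card (msg_set S M)) = real (card Msgs)"
      using card_fiber_msg_set[OF _ S x] by (simp flip: of_nat_mult)
    have "card (msg_set S M) \<noteq> 0" using eq card_Msgs_pos by (intro notI) simp
    then show ?thesis using eq card_Msgs_pos by (simp add: field_simps)
  qed
  finally show ?thesis .
qed

lemma msg_entropy:
  assumes S: "S \<subseteq> {..<K}"
  shows "prob_space.entropy \<Omega> 2 (count_space (msg_set S M)) (\<lambda>\<omega>. restrict (fst \<omega>) S) = log 2 (card (msg_set S M))"
proof -
  interpret prob_space \<Omega> by (rule prob_space_\<Omega>)
  interpret information_space \<Omega> 2 by standard simp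
  let ?F = "msg_set S M" and ?X = "\<lambda>\<omega>. restrict (fst \<omega>) S"
  have fF: "finite ?F" using S finite_subset by (intro finite_msg_set) auto
  have mF: "measure (count_space ?F) ?F = real (card ?F)" using fF by (simp add: measure_count_space)
  have "distributed \<Omega> (count_space ?F) ?X (\<lambda>x. ennreal (indicator ?F x / measure (count_space ?F) ?F))"
    unfolding distributed_def
  proof (intro conjI)
    show "?X \<in> \<Omega> \<rightarrow>\<^sub>M count_space ?F" by (rule msg_measurable[OF S])
    show "distr \<Omega> (count_space ?F) ?X = density (count_space ?F) (\<lambda>x. ennreal (indicator ?F x / measure (count_space ?F) ?F))"
    proof (rule measure_eqI_finite[of _ ?F])
      fix x assume x: "x \<in> ?F"
      have "emeasure (distr \<Omega> (count_space ?F) ?X) {x} = emeasure \<Omega> {\<omega> \<in> space \<Omega>. restrict (fst \<omega>) S = x}"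
        using x msg_measurable[OF S] by (simp add: emeasure_distr vimage_def Int_def conj_commute)
      also have "\<dots> = ennreal (1 / card ?F)" by (simp add: emeasure_eq_measure prob_msg[OF S x])
      also have "\<dots> = emeasure (density (count_space ?F) (\<lambda>x. ennreal (indicator ?F x / measure (count_space ?F) ?F))) {x}"
        using x fF by (simp add: emeasure_density nn_integral_count_space_finite mF if_distrib[of ennreal] indicator_def cong: sum.cong if_cong)
      finally show "emeasure (distr \<Omega> (count_space ?F) ?X) {x}
        = emeasure (density (count_space ?F) (\<lambda>x. ennreal (indicator ?F x / measure (count_space ?F) ?F))) {x}" .
    qed (use fF in auto)
  qed auto
  from entropy_uniform[OF this] mF show ?thesis by simp
qed

text \<open>Bounding the difference of two laws by \<open>d w + d w'\<close>, not by a uniform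
  constant, leaves only the average of \<open>d\<close> in the result, and that is what a random
  codebook controls. One factor 2 of the 4 comes from the two terms, the other from
  \<open>conditional_entropy_uniform_ge\<close>.\<close>

lemma equivocation:
  assumes S: "S \<subseteq> {..<K}"
    and d: "\<And>w w' A. w \<in> Msgs \<Longrightarrow> w' \<in> Msgs \<Longrightarrow> A \<in> sets (sig_space n) \<Longrightarrow> law he w A - law he w' A \<le> d w + d w'"
  defines "H \<equiv> prob_space.conditional_entropy \<Omega> 2 (count_space (msg_set S M)) (sig_space n)
      (\<lambda>\<omega>. restrict (fst \<omega>) S) (rx_Z K n he enc)"
  shows "(1 - 4 * ((\<Sum>w\<in>Msgs. d w) / card Msgs)) * log 2 (card (msg_set S M)) - 1 \<le> H" and "0 \<le> H"
proof -
  interpret prob_space \<Omega> by (rule prob_space_\<Omega>)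
  interpret B: product_sigma_finite "\<lambda>_::nat. lborel :: real measure" ..
  have sf: "sigma_finite_measure (sig_space n)"
    unfolding sig_space_def by (rule B.sigma_finite) simp
  let ?F = "msg_set S M" and ?X = "\<lambda>\<omega>. restrict (fst \<omega>) S" and ?Y = "rx_Z K n he enc"
  define \<eta> where "\<eta> = 2 * ((\<Sum>w\<in>Msgs. d w) / card Msgs)"
  define m where "m = real (card Msgs)"
  have m: "m > 0" using card_Msgs_pos by (simp add: m_def)
  have fS: "finite S" using S finite_subset by auto
  have fF: "finite ?F" by (intro finite_msg_set fS)
  have F0: "?F \<noteq> {}" using S M_pos by (intro msg_set_nonempty) auto
  have cF: "real (card ?F) > 0" using fF F0 by (simp add: card_gt_0_iff)
  have leak: "(\<Sum>x\<in>?F. prob {\<omega> \<in> space \<Omega>. ?X \<omega> = x \<and> ?Y \<omega> \<in> A x} - prob {\<omega> \<in> space \<Omega>. ?Y \<omega> \<in> A x} / card ?F) \<le> \<eta>"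
    if A: "\<And>x. x \<in> ?F \<Longrightarrow> A x \<in> sets (sig_space n)" for A
  proof -
    have Aw: "A (restrict w S) \<in> sets (sig_space n)" if "w \<in> Msgs" for w
      by (rule A[OF restrict_msg_set[OF S that]])
    define g where "g x = (\<Sum>w'\<in>Msgs. law he w' (A x))" for x
    have 1: "prob {\<omega> \<in> space \<Omega>. ?X \<omega> = x \<and> ?Y \<omega> \<in> A x} = (\<Sum>w\<in>{w \<in> Msgs. restrict w S = x}. law he w (A (restrict w S))) / m" if "x \<in> ?F" for x
      using measure_msg_rx_Z(2)[of "\<lambda>_. A x" "\<lambda>w. restrict w S = x" he] A[OF that] by (simp add: m_def)
    have 2: "prob {\<omega> \<in> space \<Omega>. ?Y \<omega> \<in> A x} = g x / m" if "x \<in> ?F" for x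
      using measure_rx_Z(2)[of "\<lambda>_. A x" he] A[OF that] by (simp add: m_def g_def)
    have "(\<Sum>x\<in>?F. prob {\<omega> \<in> space \<Omega>. ?X \<omega> = x \<and> ?Y \<omega> \<in> A x})
        = (\<Sum>x\<in>?F. (\<Sum>w\<in>{w \<in> Msgs. restrict w S = x}. law he w (A (restrict w S))) / m)"
      by (intro sum.cong refl 1)
    also have "\<dots> = (\<Sum>x\<in>?F. \<Sum>w\<in>{w \<in> Msgs. restrict w S = x}. law he w (A (restrict w S))) / m"
      by (rule sum_divide_distrib[symmetric])
    also have "(\<Sum>x\<in>?F. \<Sum>w\<in>{w \<in> Msgs. restrict w S = x}. law he w (A (restrict w S))) = (\<Sum>w\<in>Msgs. law he w (A (restrict w S)))"
      using restrict_msg_set[OF S] by (intro sum.group finite_msg_set fS) auto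
    finally have P1: "(\<Sum>x\<in>?F. prob {\<omega> \<in> space \<Omega>. ?X \<omega> = x \<and> ?Y \<omega> \<in> A x}) = (\<Sum>w\<in>Msgs. law he w (A (restrict w S))) / m" .
    have "(\<Sum>x\<in>?F. prob {\<omega> \<in> space \<Omega>. ?Y \<omega> \<in> A x} / card ?F) = (\<Sum>x\<in>?F. g x / m / card ?F)"
      by (intro sum.cong refl) (simp add: 2)
    also have "\<dots> = (\<Sum>x\<in>?F. g x) / m / card ?F" by (simp add: sum_divide_distrib)
    also have "(\<Sum>x\<in>?F. g x) = (\<Sum>w\<in>Msgs. g (restrict w S)) * card ?F / m"
      using sum_restrict_msg_set[OF _ S, of g M] m unfolding m_def by (simp add: field_simps)
    also have "(\<Sum>w\<in>Msgs. g (restrict w S)) * card ?F / m / m / card ?F = (\<Sum>w\<in>Msgs. g (restrict w S)) / m / m"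
      using cF by simp
    finally have P2: "(\<Sum>x\<in>?F. prob {\<omega> \<in> space \<Omega>. ?Y \<omega> \<in> A x} / card ?F) = (\<Sum>w\<in>Msgs. g (restrict w S)) / m / m" .
    \<comment> \<open>The output law is the average of \<open>law he w'\<close> over all
      \<open>w'\<close>, so the leak is a double average of pairwise differences.\<close>
    have "(\<Sum>w\<in>Msgs. m * law he w (A (restrict w S)) - g (restrict w S))
        = (\<Sum>w\<in>Msgs. \<Sum>w'\<in>Msgs. law he w (A (restrict w S)) - law he w' (A (restrict w S)))"
      by (intro sum.cong refl) (simp add: sum_subtractf g_def m_def)
    also have "\<dots> \<le> (\<Sum>w\<in>Msgs. \<Sum>w'\<in>Msgs. d w + d w')"
      by (intro sum_mono d Aw)
    also have "\<dots> = 2 * m * (\<Sum>w\<in>Msgs. d w)"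
      by (simp add: sum.distrib m_def sum_distrib_left[symmetric])
    finally have "m * (\<Sum>w\<in>Msgs. law he w (A (restrict w S))) - (\<Sum>w\<in>Msgs. g (restrict w S)) \<le> 2 * m * (\<Sum>w\<in>Msgs. d w)"
      by (simp add: sum_subtractf sum_distrib_left)
    then have "(m * (\<Sum>w\<in>Msgs. law he w (A (restrict w S))) - (\<Sum>w\<in>Msgs. g (restrict w S))) / (m * m) \<le> 2 * m * (\<Sum>w\<in>Msgs. d w) / (m * m)"
      using m by (intro divide_right_mono) auto
    then show ?thesis unfolding sum_subtractf P1 P2 \<eta>_def m_def[symmetric] using m
      by (simp add: diff_divide_distrib)
  qed
  note * = conditional_entropy_uniform_ge[OF fF F0 sf msg_measurable[OF S] rx_Z_measurable
      prob_msg[OF S] rx_Z_absolutely_continuous leak]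
  show "0 \<le> H" unfolding H_def by (rule *(2))
  show "(1 - 4 * ((\<Sum>w\<in>Msgs. d w) / card Msgs)) * log 2 (card (msg_set S M)) - 1 \<le> H"
    using *(1) unfolding H_def \<eta>_def by simp
qed

lemma power_constraint:
  assumes "\<And>k w l. k < K \<Longrightarrow> w < M k \<Longrightarrow> l < L k \<Longrightarrow> (\<Sum>t<n. (s k w l t)\<^sup>2) / real n \<le> P" and k: "k < K"
  shows "(\<integral>\<^sup>+\<omega>. ennreal ((\<Sum>t<n. (tx n enc k \<omega> t)\<^sup>2) / real n) \<partial>\<Omega>) \<le> ennreal P"
proof -
  interpret prob_space \<Omega> by (rule prob_space_\<Omega>)
  have "(\<integral>\<^sup>+\<omega>. ennreal ((\<Sum>t<n. (tx n enc k \<omega> t)\<^sup>2) / real n) \<partial>\<Omega>) \<le> (\<integral>\<^sup>+\<omega>. ennreal P \<partial>\<Omega>)"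
  proof (rule nn_integral_mono)
    fix \<omega> assume "\<omega> \<in> space \<Omega>"
    from fst_\<Omega>[OF this] have "fst \<omega> k < M k" using k by (auto simp: msg_set_def)
    from assms(1)[OF k this cell_index_less[OF L_pos[OF k]], of "fst (snd \<omega>) k"]
    show "ennreal ((\<Sum>t<n. (tx n enc k \<omega> t)\<^sup>2) / real n) \<le> ennreal P"
      by (intro ennreal_leI) (simp add: tx_def enc_def)
  qed
  also have "\<dots> = ennreal P" by (simp add: emeasure_space_1)
  finally show ?thesis .
qed

end

section \<open>Random codebooks\<close>

text \<open>Averages over the function space \<open>PiE\<close> serve as expectations over a random
  codebook with independent uniform entries. The marginal of one entry is found by counting fibres;
  the next lemma does the same for two entries.\<close>

lemma avg_PiE_component:
  fixes f :: "'b \<Rightarrow> real"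
  assumes I: "finite I" "i \<in> I" and B: "finite B" "B \<noteq> {}"
  shows "(\<Sum>c\<in>PiE I (\<lambda>_. B). f (c i)) / card (PiE I (\<lambda>_. B)) = (\<Sum>x\<in>B. f x) / card B"
proof -
  let ?C = "PiE I (\<lambda>_. B)"
  define N where "N = card B"
  have N: "N > 0" using B by (simp add: N_def card_gt_0_iff)
  have fC: "finite ?C" using I B by (intro finite_PiE) auto
  have fib: "card {c \<in> ?C. c i = x} = N ^ (card I - 1)" if "x \<in> B" for x
  proof -
    have "{c \<in> ?C. c i = x} = PiE I (\<lambda>k. if k = i then {x} else B)"
      using that I by (auto simp: PiE_def Pi_def extensional_def split: if_splits)
    then have "card {c \<in> ?C. c i = x} = (\<Prod>k\<in>I. if k = i then 1 else N)"
      using I by (simp add: card_PiE N_def if_distrib cong: if_cong)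
    also have "\<dots> = (\<Prod>k\<in>I - {i}. N)"
      using I by (subst prod.remove[of I i]) (auto intro!: prod.cong)
    finally show ?thesis using I by simp
  qed
  have "(\<Sum>c\<in>?C. f (c i)) = (\<Sum>x\<in>B. \<Sum>c\<in>{c \<in> ?C. c i = x}. f (c i))"
    using I by (intro sum.group[symmetric] fC B) auto
  also have "\<dots> = (\<Sum>x\<in>B. real (N ^ (card I - 1)) * f x)"
    by (intro sum.cong refl) (simp add: fib)
  finally have "(\<Sum>c\<in>?C. f (c i)) = real (N ^ (card I - 1)) * (\<Sum>x\<in>B. f x)" by (simp only: sum_distrib_left)
  moreover have "card ?C = N * N ^ (card I - 1)"
  proof -
    have "0 < card I" using I by (auto simp: card_gt_0_iff)
    then have "card I = Suc (card I - 1)" by simp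
    moreover have "card ?C = N ^ card I" using I by (simp add: card_PiE N_def)
    ultimately show ?thesis by (metis power_Suc)
  qed
  ultimately show ?thesis using N unfolding N_def[symmetric] by simp
qed

lemma avg_PiE_two_components:
  fixes F :: "'b \<Rightarrow> 'b \<Rightarrow> real"
  assumes I: "finite I" "i \<in> I" "j \<in> I" "i \<noteq> j" and B: "finite B" "B \<noteq> {}"
  shows "(\<Sum>c\<in>PiE I (\<lambda>_. B). F (c i) (c j)) / card (PiE I (\<lambda>_. B)) = (\<Sum>x\<in>B. \<Sum>y\<in>B. F x y) / (real (card B) * real (card B))"
proof -
  let ?C = "PiE I (\<lambda>_. B)"
  define N where "N = card B"
  have N: "N > 0" using B by (simp add: N_def card_gt_0_iff)
  have fC: "finite ?C" using I B by (intro finite_PiE) auto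
  have cI: "card I = Suc (Suc (card I - 2))"
  proof -
    have "card {i, j} \<le> card I" using I by (intro card_mono) auto
    then show ?thesis using I by simp
  qed
  have fib: "card {c \<in> ?C. (c i, c j) = p} = N ^ (card I - 2)" if "p \<in> B \<times> B" for p
  proof -
    obtain x y where p: "p = (x, y)" "x \<in> B" "y \<in> B" using \<open>p \<in> B \<times> B\<close> by auto
    have "{c \<in> ?C. (c i, c j) = p} = PiE I (\<lambda>k. if k = i then {x} else if k = j then {y} else B)"
      using p I by (auto simp: PiE_def Pi_def extensional_def split: if_splits)
    then have "card {c \<in> ?C. (c i, c j) = p} = (\<Prod>k\<in>I. card (if k = i then {x} else if k = j then {y} else B))"
      using I(1) by (simp only: card_PiE)
    also have "\<dots> = (\<Prod>k\<in>I. if k = i then 1 else if k = j then 1 else N)"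
      by (intro prod.cong refl) (auto simp: N_def)
    also have "\<dots> = (\<Prod>k\<in>I - {i}. if k = j then 1 else N)"
      using I by (subst prod.remove[of I i]) (auto intro!: prod.cong)
    also have "\<dots> = (\<Prod>k\<in>I - {i} - {j}. N)"
      using I by (subst prod.remove[of "I - {i}" j]) (auto intro!: prod.cong)
    finally show ?thesis using I by (simp add: numeral_2_eq_2)
  qed
  have "(\<Sum>c\<in>?C. F (c i) (c j)) = (\<Sum>p\<in>B \<times> B. \<Sum>c\<in>{c \<in> ?C. (c i, c j) = p}. F (c i) (c j))"
    using I B by (intro sum.group[symmetric] fC) auto
  also have "\<dots> = (\<Sum>p\<in>B \<times> B. \<Sum>c\<in>{c \<in> ?C. (c i, c j) = p}. F (fst p) (snd p))"
    by (intro sum.cong refl) auto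
  also have "\<dots> = (\<Sum>p\<in>B \<times> B. real (N ^ (card I - 2)) * F (fst p) (snd p))"
    by (intro sum.cong refl) (simp only: sum_constant fib of_nat_id)
  also have "\<dots> = (\<Sum>x\<in>B. \<Sum>y\<in>B. real (N ^ (card I - 2)) * F x y)"
    by (simp add: sum.cartesian_product split_beta)
  finally have "(\<Sum>c\<in>?C. F (c i) (c j)) = real (N ^ (card I - 2)) * (\<Sum>x\<in>B. \<Sum>y\<in>B. F x y)" by (simp only: sum_distrib_left)
  moreover have "card ?C = N * N * N ^ (card I - 2)"
  proof -
    have "card ?C = N ^ card I" using I by (simp add: card_PiE N_def)
    also have "\<dots> = N ^ Suc (Suc (card I - 2))" using cI by simp
    finally show ?thesis by (simp only: power_Suc mult.assoc)
  qed
  ultimately show ?thesis using N unfolding N_def[symmetric] by simp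
qed

text \<open>Distinct entries are independent and \<open>h\<close> is centred, so all cross terms
  vanish.\<close>

lemma second_moment_PiE:
  fixes h :: "'b \<Rightarrow> real"
  assumes I: "finite I" "J \<subseteq> I" and B: "finite B" "B \<noteq> {}" and h: "(\<Sum>x\<in>B. h x) = 0"
  shows "(\<Sum>c\<in>PiE I (\<lambda>_. B). (\<Sum>i\<in>J. h (c i))\<^sup>2) / card (PiE I (\<lambda>_. B)) = card J * ((\<Sum>x\<in>B. (h x)\<^sup>2) / card B)"
proof -
  let ?C = "PiE I (\<lambda>_. B)"
  have fJ: "finite J" using I finite_subset by auto
  have "(\<Sum>c\<in>?C. (\<Sum>i\<in>J. h (c i))\<^sup>2) = (\<Sum>c\<in>?C. \<Sum>i\<in>J. \<Sum>j\<in>J. h (c i) * h (c j))"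
    by (simp add: power2_eq_square sum_product)
  also have "\<dots> = (\<Sum>i\<in>J. \<Sum>j\<in>J. \<Sum>c\<in>?C. h (c i) * h (c j))"
    by (subst sum.swap, intro sum.cong refl, rule sum.swap)
  finally have "(\<Sum>c\<in>?C. (\<Sum>i\<in>J. h (c i))\<^sup>2) / card ?C = (\<Sum>i\<in>J. \<Sum>j\<in>J. (\<Sum>c\<in>?C. h (c i) * h (c j)) / card ?C)"
    by (simp add: sum_divide_distrib)
  also have "\<dots> = (\<Sum>i\<in>J. \<Sum>j\<in>J. if j = i then (\<Sum>x\<in>B. (h x)\<^sup>2) / card B else 0)"
  proof (intro sum.cong refl)
    fix i j assume "i \<in> J" "j \<in> J"
    then have ij: "i \<in> I" "j \<in> I" using I(2) by auto
    show "(\<Sum>c\<in>?C. h (c i) * h (c j)) / card ?C = (if j = i then (\<Sum>x\<in>B. (h x)\<^sup>2) / card B else 0)"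
    proof (cases "j = i")
      case True
      then show ?thesis using avg_PiE_component[OF I(1) _ B, of i "\<lambda>x. (h x)\<^sup>2"] ij I(2)
        by (auto simp: power2_eq_square)
    next
      case False
      have "(\<Sum>x\<in>B. \<Sum>y\<in>B. h x * h y) = 0" by (simp add: sum_product[symmetric] h)
      then show ?thesis using avg_PiE_two_components[OF I(1) ij _ B, of "\<lambda>x y. h x * h y"] False
        by auto
    qed
  qed
  also have "\<dots> = card J * ((\<Sum>x\<in>B. (h x)\<^sup>2) / card B)"
    using fJ by simp
  finally show ?thesis .
qed

text \<open>Variance bound for an empirical mean, linearized by the inequality between arithmetic
  and geometric mean. The free parameter \<theta> replaces a square root, so that the bounds for all
  \<open>v\<close> can later be summed.\<close>

lemma mean_abs_deviation_PiE:
  fixes g :: "'b \<Rightarrow> real" and \<theta> :: real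
  assumes I: "finite I" "J \<subseteq> I" "J \<noteq> {}" and B: "finite B" "B \<noteq> {}" and \<theta>: "\<theta> > 0"
  shows "(\<Sum>c\<in>PiE I (\<lambda>_. B). \<bar>(\<Sum>i\<in>J. g (c i)) / card J - (\<Sum>x\<in>B. g x) / card B\<bar>) / card (PiE I (\<lambda>_. B))
      \<le> \<theta> / 2 + (\<Sum>x\<in>B. (g x)\<^sup>2) / (2 * \<theta> * card J * card B)"
proof -
  let ?C = "PiE I (\<lambda>_. B)"
  define \<mu> where "\<mu> = (\<Sum>x\<in>B. g x) / card B"
  define h where "h x = g x - \<mu>" for x
  have fJ: "finite J" using I finite_subset by auto
  define n where "n = real (card J)"
  define N where "N = real (card B)"
  have pos: "n > 0" "N > 0" using fJ I B by (auto simp: n_def N_def card_gt_0_iff)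
  have fC: "finite ?C" using I B by (intro finite_PiE) auto
  have C0: "?C \<noteq> {}" using B by (simp add: PiE_eq_empty_iff)
  have cC: "real (card ?C) > 0" using fC C0 by (simp add: card_gt_0_iff)
  have h0: "(\<Sum>x\<in>B. h x) = 0" using pos by (simp add: h_def sum_subtractf \<mu>_def N_def)
  \<comment> \<open>Centring only lowers the second moment.\<close>
  have h2: "(\<Sum>x\<in>B. (h x)\<^sup>2) \<le> (\<Sum>x\<in>B. (g x)\<^sup>2)"
  proof -
    have "(\<Sum>x\<in>B. (g x)\<^sup>2) = (\<Sum>x\<in>B. (h x)\<^sup>2 + 2 * \<mu> * h x + \<mu>\<^sup>2)"
      by (intro sum.cong refl) (simp add: h_def power2_eq_square algebra_simps)
    also have "\<dots> = (\<Sum>x\<in>B. (h x)\<^sup>2) + 2 * \<mu> * (\<Sum>x\<in>B. h x) + N * \<mu>\<^sup>2"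
      by (simp add: sum.distrib sum_distrib_left N_def)
    finally show ?thesis using h0 pos by simp
  qed
  have dev: "(\<Sum>i\<in>J. g (c i)) / n - \<mu> = (\<Sum>i\<in>J. h (c i)) / n" for c
    using pos by (simp add: h_def sum_subtractf n_def diff_divide_distrib)
  have am: "\<bar>z\<bar> \<le> \<theta> / 2 + z\<^sup>2 / (2 * \<theta>)" for z
  proof -
    have "0 \<le> (\<bar>z\<bar> - \<theta>)\<^sup>2" by simp
    then have "2 * \<theta> * \<bar>z\<bar> \<le> \<theta>\<^sup>2 + z\<^sup>2" by (simp add: power2_diff algebra_simps)
    then have "2 * \<theta> * \<bar>z\<bar> / (2 * \<theta>) \<le> (\<theta>\<^sup>2 + z\<^sup>2) / (2 * \<theta>)" using \<theta> by (intro divide_right_mono) auto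
    then show ?thesis using \<theta> by (simp add: add_divide_distrib power2_eq_square)
  qed
  have "(\<Sum>c\<in>?C. \<bar>(\<Sum>i\<in>J. g (c i)) / n - \<mu>\<bar>) \<le> (\<Sum>c\<in>?C. \<theta> / 2 + ((\<Sum>i\<in>J. h (c i)) / n)\<^sup>2 / (2 * \<theta>))"
    unfolding dev by (intro sum_mono am)
  also have "\<dots> = card ?C * (\<theta> / 2) + (\<Sum>c\<in>?C. (\<Sum>i\<in>J. h (c i))\<^sup>2) / (n\<^sup>2 * (2 * \<theta>))"
    by (simp only: sum.distrib power_divide divide_divide_eq_left sum_divide_distrib[symmetric] sum_constant)
  finally have "(\<Sum>c\<in>?C. \<bar>(\<Sum>i\<in>J. g (c i)) / n - \<mu>\<bar>) / card ?C
     \<le> (card ?C * (\<theta> / 2) + (\<Sum>c\<in>?C. (\<Sum>i\<in>J. h (c i))\<^sup>2) / (n\<^sup>2 * (2 * \<theta>))) / card ?C"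
    by (rule divide_right_mono) simp
  also have "\<dots> = \<theta> / 2 + ((\<Sum>c\<in>?C. (\<Sum>i\<in>J. h (c i))\<^sup>2) / card ?C) / (n\<^sup>2 * (2 * \<theta>))"
    using cC by (simp only: add_divide_distrib) simp
  also have "(\<Sum>c\<in>?C. (\<Sum>i\<in>J. h (c i))\<^sup>2) / card ?C = n * ((\<Sum>x\<in>B. (h x)\<^sup>2) / N)"
    unfolding n_def N_def by (rule second_moment_PiE[OF I(1,2) B h0])
  also have "n * ((\<Sum>x\<in>B. (h x)\<^sup>2) / N) / (n\<^sup>2 * (2 * \<theta>)) = (\<Sum>x\<in>B. (h x)\<^sup>2) / (2 * \<theta> * n * N)"
    using pos by (simp add: power2_eq_square field_simps)
  also have "\<dots> \<le> (\<Sum>x\<in>B. (g x)\<^sup>2) / (2 * \<theta> * n * N)"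
    using h2 pos \<theta> by (intro divide_right_mono) auto
  finally show ?thesis unfolding \<mu>_def n_def N_def by simp
qed

text \<open>Leakage and conflicts are averaged as one sum, so a single codebook is good for both.
  \<open>D\<close> is an L1 distance between the law of a message's codewords, seen through the
  kernels \<open>g v\<close>, and the law of a uniform entry; \<theta> trades the size of
  \<open>V\<close> against the second moment \<open>G\<close>.\<close>

lemma random_codebook:
  fixes B :: "'b set" and V :: "'v set" and g :: "'v \<Rightarrow> 'b \<Rightarrow> real" and M L :: nat and \<theta> :: real
  assumes B: "finite B" "B \<noteq> {}" and mlpos: "M > 0" "L > 0" and \<theta>: "\<theta> > 0"
    and G: "(\<Sum>v\<in>V. \<Sum>x\<in>B. (g v x)\<^sup>2) \<le> G"
    and near: "\<And>x. x \<in> B \<Longrightarrow> real (card {y \<in> B. near x y}) \<le> b"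
  defines "D \<equiv> \<lambda>c w. \<Sum>v\<in>V. \<bar>(\<Sum>l<L. g v (c (w, l))) / L - (\<Sum>x\<in>B. g v x) / card B\<bar>"
    and "conflict \<equiv> \<lambda>c w l. \<exists>w'<M. \<exists>l'<L. w' \<noteq> w \<and> near (c (w, l)) (c (w', l'))"
  shows "\<exists>c\<in>PiE ({..<M} \<times> {..<L}) (\<lambda>_. B).
    (\<Sum>w<M. D c w) / M + (\<Sum>w<M. \<Sum>l<L. of_bool (conflict c w l)) / (real M * real L)
      \<le> card V * \<theta> / 2 + G / (2 * \<theta> * L * card B) + real M * real L * b / card B"
proof -
  define I where "I = {..<M} \<times> {..<L}"
  let ?C = "PiE I (\<lambda>_. B)"
  define a where "a f = (\<Sum>c\<in>?C. f c) / card ?C" for f :: "(nat \<times> nat \<Rightarrow> 'b) \<Rightarrow> real"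
  have fI: "finite I" by (simp add: I_def)
  have fC: "finite ?C" using fI B by (intro finite_PiE) auto
  have C0: "?C \<noteq> {}" using B by (simp add: PiE_eq_empty_iff)
  have cC: "real (card ?C) > 0" using fC C0 by (simp add: card_gt_0_iff)
  have a_add: "a (\<lambda>c. f c + f' c) = a f + a f'" for f f'
    by (simp add: a_def sum.distrib add_divide_distrib)
  have a_div: "a (\<lambda>c. f c / r) = a f / r" for f r
    by (simp add: a_def sum_divide_distrib mult.commute)
  have a_sum: "a (\<lambda>c. \<Sum>i\<in>A. f i c) = (\<Sum>i\<in>A. a (f i))" for A and f :: "'i \<Rightarrow> _"
    unfolding a_def by (subst sum.swap) (simp add: sum_divide_distrib)
  have a_mono: "a f \<le> a f'" if "\<And>c. c \<in> ?C \<Longrightarrow> f c \<le> f' c" for f f'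
    unfolding a_def by (intro divide_right_mono sum_mono that) auto
  have ND: "real (card B) > 0" using B by (simp add: card_gt_0_iff)
  have aD: "a (\<lambda>c. D c w) \<le> card V * \<theta> / 2 + G / (2 * \<theta> * L * card B)" if w: "w < M" for w
  proof -
    let ?J = "{w} \<times> {..<L}"
    have J: "?J \<subseteq> I" "?J \<noteq> {}" "card ?J = L" using w mlpos by (auto simp: I_def card_cartesian_product)
    have sJ: "(\<Sum>i\<in>?J. f i) = (\<Sum>l<L. f (w, l))" for f :: "nat \<times> nat \<Rightarrow> real"
    proof -
      have "?J = Pair w ` {..<L}" by auto
      then show ?thesis by (simp add: sum.reindex inj_on_def)
    qed
    have "a (\<lambda>c. \<bar>(\<Sum>l<L. g v (c (w, l))) / L - (\<Sum>x\<in>B. g v x) / card B\<bar>)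
        \<le> \<theta> / 2 + (\<Sum>x\<in>B. (g v x)\<^sup>2) / (2 * \<theta> * L * card B)" for v
      using mean_abs_deviation_PiE[OF fI J(1,2) B \<theta>, of "g v"] unfolding a_def J(3) sJ .
    then have "a (\<lambda>c. D c w) \<le> (\<Sum>v\<in>V. \<theta> / 2 + (\<Sum>x\<in>B. (g v x)\<^sup>2) / (2 * \<theta> * L * card B))"
      unfolding D_def a_sum by (intro sum_mono)
    also have "\<dots> = card V * \<theta> / 2 + (\<Sum>v\<in>V. \<Sum>x\<in>B. (g v x)\<^sup>2) / (2 * \<theta> * L * card B)"
      by (simp add: sum.distrib sum_divide_distrib)
    also have "\<dots> \<le> card V * \<theta> / 2 + G / (2 * \<theta> * L * card B)"
      using G \<theta> by (intro add_left_mono divide_right_mono) auto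
    finally show ?thesis .
  qed
  have aK: "a (\<lambda>c. of_bool (conflict c w l)) \<le> real M * real L * b / card B" if wl: "w < M" "l < L" for w l
  proof -
    \<comment> \<open>Union bound over the entries of all other messages. Such an entry differs from
      \<open>(w, l)\<close>, so the two codewords are independent and uniform.\<close>
    have "a (\<lambda>c. of_bool (conflict c w l)) \<le> a (\<lambda>c. \<Sum>i\<in>{i \<in> I. fst i \<noteq> w}. of_bool (near (c (w, l)) (c i)))"
    proof (rule a_mono)
      fix c
      show "of_bool (conflict c w l) \<le> (\<Sum>i\<in>{i \<in> I. fst i \<noteq> w}. of_bool (near (c (w, l)) (c i)) :: real)"
      proof (cases "conflict c w l")
        case True
        then obtain w' l' where *: "w' < M" "l' < L" "w' \<noteq> w" "near (c (w, l)) (c (w', l'))"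
          by (auto simp: conflict_def)
        then have "(of_bool (near (c (w, l)) (c (w', l'))) :: real) \<le> (\<Sum>i\<in>{i \<in> I. fst i \<noteq> w}. of_bool (near (c (w, l)) (c i)))"
          using fI by (intro member_le_sum) (auto simp: I_def)
        with * True show ?thesis by simp
      qed (simp add: sum_nonneg)
    qed
    also have "\<dots> = (\<Sum>i\<in>{i \<in> I. fst i \<noteq> w}. a (\<lambda>c. of_bool (near (c (w, l)) (c i))))" by (rule a_sum)
    also have "\<dots> \<le> (\<Sum>i\<in>{i \<in> I. fst i \<noteq> w}. b / card B)"
    proof (rule sum_mono)
      fix i assume i: "i \<in> {i \<in> I. fst i \<noteq> w}"
      have "a (\<lambda>c. of_bool (near (c (w, l)) (c i))) = (\<Sum>x\<in>B. \<Sum>y\<in>B. of_bool (near x y)) / (real (card B) * real (card B))"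
        unfolding a_def using i wl by (intro avg_PiE_two_components fI B) (auto simp: I_def)
      also have "(\<Sum>x\<in>B. \<Sum>y\<in>B. of_bool (near x y)) = (\<Sum>x\<in>B. real (card {y \<in> B. near x y}))"
        using B by (intro sum.cong refl) (simp add: of_bool_def sum.If_cases Int_def)
      also have "\<dots> \<le> (\<Sum>x\<in>B. b)" by (intro sum_mono near)
      also have "\<dots> / (real (card B) * real (card B)) = b / card B" using ND by simp
      finally show "a (\<lambda>c. of_bool (near (c (w, l)) (c i))) \<le> b / card B"
        using ND by (simp add: divide_right_mono)
    qed
    also have "\<dots> = card {i \<in> I. fst i \<noteq> w} * (b / card B)" by simp
    also have "\<dots> \<le> card I * (b / card B)"
    proof (intro mult_right_mono)
      obtain x where "x \<in> B" using B by auto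
      from near[OF this] have "0 \<le> b" by linarith
      then show "0 \<le> b / card B" by simp
    qed (use fI in \<open>auto intro!: card_mono\<close>)
    finally show ?thesis by (simp add: I_def)
  qed
  let ?f = "\<lambda>c. (\<Sum>w<M. D c w) / M + (\<Sum>w<M. \<Sum>l<L. of_bool (conflict c w l)) / (real M * real L)"
  let ?X = "card V * \<theta> / 2 + G / (2 * \<theta> * L * card B) + real M * real L * b / card B"
  have "a ?f = (\<Sum>w<M. a (\<lambda>c. D c w)) / M + (\<Sum>w<M. \<Sum>l<L. a (\<lambda>c. of_bool (conflict c w l))) / (real M * real L)"
    by (simp only: a_add a_div a_sum)
  also have "\<dots> \<le> (\<Sum>w<M. card V * \<theta> / 2 + G / (2 * \<theta> * L * card B)) / M
      + (\<Sum>w<M. \<Sum>l<L. real M * real L * b / card B) / (real M * real L)"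
    by (intro add_mono divide_right_mono sum_mono aD aK) auto
  also have "\<dots> = ?X" using mlpos by simp
  finally have aX: "a ?f \<le> ?X" .
  \<comment> \<open>Some codebook does no worse than the average.\<close>
  have "\<exists>c\<in>?C. ?f c \<le> ?X"
  proof (rule ccontr)
    assume "\<not> (\<exists>c\<in>?C. ?f c \<le> ?X)"
    then have "(\<Sum>c\<in>?C. ?X) < (\<Sum>c\<in>?C. ?f c)" using fC C0 by (intro sum_strict_mono) auto
    then have "?X < a ?f" unfolding a_def using cC by (simp add: field_simps)
    with aX show False by simp
  qed
  then show ?thesis unfolding I_def .
qed

section \<open>Jammed integer vectors\<close>

lemma sum_PiE_insert:
  assumes "i \<notin> I"
  shows "(\<Sum>f\<in>PiE (insert i I) B. F f) = (\<Sum>f\<in>PiE I B. \<Sum>y\<in>B i. F (f(i := y)))"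
proof -
  have "(\<Sum>f\<in>PiE (insert i I) B. F f) = (\<Sum>p\<in>B i \<times> PiE I B. F ((snd p)(i := fst p)))"
    unfolding PiE_insert_eq
    by (subst sum.reindex) (use inj_combinator[OF assms, of B] in \<open>auto simp: split_beta\<close>)
  also have "\<dots> = (\<Sum>y\<in>B i. \<Sum>f\<in>PiE I B. F (f(i := y)))"
    by (simp add: sum.cartesian_product split_beta)
  also have "\<dots> = (\<Sum>f\<in>PiE I B. \<Sum>y\<in>B i. F (f(i := y)))" by (rule sum.swap)
  finally show ?thesis .
qed

lemma sum_PiE_coordinate:
  fixes f :: "nat \<Rightarrow> real" and M :: "'i \<Rightarrow> nat"
  assumes I: "finite I" "k \<in> I"
  shows "(\<Sum>w\<in>PiE I (\<lambda>i. {..<M i}). f (w k)) * M k = card (PiE I (\<lambda>i. {..<M i})) * (\<Sum>y<M k. f y)"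
proof -
  have e: "insert k (I - {k}) = I" using I by auto
  have "(\<Sum>w\<in>PiE I (\<lambda>i. {..<M i}). f (w k)) = (\<Sum>w\<in>PiE (I - {k}) (\<lambda>i. {..<M i}). \<Sum>y<M k. f y)"
    using sum_PiE_insert[of k "I - {k}" "\<lambda>w. f (w k)" "\<lambda>i. {..<M i}"] unfolding e by simp
  also have "\<dots> = (\<Prod>i\<in>I - {k}. M i) * (\<Sum>y<M k. f y)" using I by (simp add: card_PiE)
  finally have 1: "(\<Sum>w\<in>PiE I (\<lambda>i. {..<M i}). f (w k)) = (\<Prod>i\<in>I - {k}. M i) * (\<Sum>y<M k. f y)" .
  have 2: "card (PiE I (\<lambda>i. {..<M i})) = M k * (\<Prod>i\<in>I - {k}. M i)"
    using I by (simp add: card_PiE prod.remove)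
  show ?thesis unfolding 1 2 by simp
qed

definition vecs :: "nat \<Rightarrow> nat \<Rightarrow> (nat \<Rightarrow> nat) set" where
  "vecs n Q = PiE {..<n} (\<lambda>_. {..<Q})"

definition vadd :: "nat \<Rightarrow> (nat \<Rightarrow> nat) \<Rightarrow> (nat \<Rightarrow> nat) \<Rightarrow> nat \<Rightarrow> nat" where
  "vadd n u x = (\<lambda>t\<in>{..<n}. u t + x t)"

text \<open>Probability that a uniformly distributed jamming vector added to \<open>x\<close> gives \<open>v\<close>.\<close>
definition jam_prob :: "nat \<Rightarrow> nat \<Rightarrow> (nat \<Rightarrow> nat) \<Rightarrow> (nat \<Rightarrow> nat) \<Rightarrow> real" where
  "jam_prob n Q v x = card {u \<in> vecs n Q. vadd n u x = v} / card (vecs n Q)"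

lemma finite_vecs: "finite (vecs n Q)"
  unfolding vecs_def by (intro finite_PiE) auto

lemma card_vecs: "card (vecs n Q) = Q ^ n"
  unfolding vecs_def by (simp add: card_PiE)

lemma vecs_nonempty: "Q > 0 \<Longrightarrow> vecs n Q \<noteq> {}"
  unfolding vecs_def PiE_eq_empty_iff by (metis empty_iff lessThan_iff)

text \<open>The channel adds reals, so integers add without reduction modulo \<open>Q\<close>. The
  alphabet doubles: this is the excess of at most one bit per symbol that the randomization has to
  absorb.\<close>

lemma vadd_mem: "u \<in> vecs n Q \<Longrightarrow> x \<in> vecs n Q \<Longrightarrow> vadd n u x \<in> vecs n (2 * Q)"
proof -
  assume "u \<in> vecs n Q" "x \<in> vecs n Q"
  then have "u t + x t < 2 * Q" if "t < n" for t
    using PiE_mem[of u "{..<n}" "\<lambda>_. {..<Q}" t] PiE_mem[of x "{..<n}" "\<lambda>_. {..<Q}" t] that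
    unfolding vecs_def by fastforce
  then show ?thesis by (auto simp: vecs_def vadd_def)
qed

lemma sum_jam_prob:
  assumes "x \<in> vecs n Q"
  shows "(\<Sum>v\<in>vecs n (2 * Q). \<psi> v * jam_prob n Q v x) = (\<Sum>u\<in>vecs n Q. \<psi> (vadd n u x)) / card (vecs n Q)"
proof -
  have "(\<Sum>u\<in>vecs n Q. \<psi> (vadd n u x)) = (\<Sum>v\<in>vecs n (2 * Q). \<Sum>u\<in>{u \<in> vecs n Q. vadd n u x = v}. \<psi> (vadd n u x))"
    using vadd_mem[OF _ assms] by (intro sum.group[symmetric] finite_vecs) auto
  also have "\<dots> = (\<Sum>v\<in>vecs n (2 * Q). \<psi> v * card {u \<in> vecs n Q. vadd n u x = v})"
    by (intro sum.cong refl) simp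
  finally show ?thesis by (simp add: jam_prob_def sum_divide_distrib)
qed

text \<open>The jamming vector is determined by \<open>v\<close> and \<open>x\<close>, so at most
  one vector counts.\<close>

lemma jam_prob_le: "jam_prob n Q v x \<le> 1 / card (vecs n Q)"
proof -
  have "card {u \<in> vecs n Q. vadd n u x = v} \<le> 1"
  proof -
    have "u t = u' t" if "u \<in> vecs n Q" "vadd n u x = v" "u' \<in> vecs n Q" "vadd n u' x = v" for u u' t
    proof (cases "t < n")
      case True
      have "vadd n u x t = vadd n u' x t" using that by simp
      then show ?thesis using True by (simp add: vadd_def)
    next
      case False
      then show ?thesis using that by (simp add: vecs_def PiE_def extensional_def)
    qed
    then have "u = u'" if "u \<in> vecs n Q" "vadd n u x = v" "u' \<in> vecs n Q" "vadd n u' x = v" for u u'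
      using that by blast
    then show ?thesis by (intro card_le_Suc0_iff_eq[THEN iffD2, unfolded One_nat_def[symmetric]]) (auto simp: finite_vecs)
  qed
  then show ?thesis unfolding jam_prob_def by (intro divide_right_mono) auto
qed

text \<open>One factor is at most \<open>1 / card (vecs n Q)\<close>, and for each \<open>x\<close>
  the other factor sums to 1 over \<open>v\<close>. This is the second moment constant
  \<open>G\<close> for \<open>random_codebook\<close>.\<close>

lemma sum_jam_prob_squares:
  assumes "Q > 0"
  shows "(\<Sum>v\<in>vecs n (2 * Q). \<Sum>x\<in>vecs n Q. (jam_prob n Q v x)\<^sup>2) \<le> 1"
proof -
  let ?N = "real (card (vecs n Q))"
  have N: "?N > 0" using assms by (simp add: card_vecs)
  have "(\<Sum>v\<in>vecs n (2 * Q). \<Sum>x\<in>vecs n Q. (jam_prob n Q v x)\<^sup>2)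
      \<le> (\<Sum>v\<in>vecs n (2 * Q). \<Sum>x\<in>vecs n Q. 1 / ?N * jam_prob n Q v x)"
    unfolding power2_eq_square by (intro sum_mono mult_right_mono jam_prob_le) (simp add: jam_prob_def)
  also have "\<dots> = (\<Sum>x\<in>vecs n Q. \<Sum>v\<in>vecs n (2 * Q). 1 / ?N * jam_prob n Q v x)" by (rule sum.swap)
  also have "\<dots> = (\<Sum>x\<in>vecs n Q. 1 / ?N)"
    by (intro sum.cong refl, subst sum_jam_prob) (use N in auto)
  also have "\<dots> = 1" using N by simp
  finally show ?thesis .
qed

text \<open>A crude count is enough: at most \<open>2 ^ n\<close> choices of the differing
  positions, then at most \<open>Q ^ r\<close> fillings.\<close>

lemma card_hamming_ball:
  assumes Q: "Q > 0"
  shows "card {y \<in> vecs n Q. card {t \<in> {..<n}. x t \<noteq> y t} \<le> r} \<le> 2 ^ n * Q ^ r"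
proof -
  let ?P = "{S. S \<subseteq> {..<n} \<and> card S \<le> r}"
  let ?C = "\<lambda>S. PiE {..<n} (\<lambda>t. if t \<in> S then {..<Q} else {x t})"
  have fP: "finite ?P" by simp
  have "{y \<in> vecs n Q. card {t \<in> {..<n}. x t \<noteq> y t} \<le> r} \<subseteq> (\<Union>S\<in>?P. ?C S)"
  proof
    fix y assume y: "y \<in> {y \<in> vecs n Q. card {t \<in> {..<n}. x t \<noteq> y t} \<le> r}"
    have "{t \<in> {..<n}. x t \<noteq> y t} \<in> ?P" using y by auto
    moreover have "y \<in> ?C {t \<in> {..<n}. x t \<noteq> y t}" using y by (auto simp: vecs_def PiE_iff)
    ultimately show "y \<in> (\<Union>S\<in>?P. ?C S)" by (rule UN_I)
  qed
  then have "card {y \<in> vecs n Q. card {t \<in> {..<n}. x t \<noteq> y t} \<le> r} \<le> card (\<Union>S\<in>?P. ?C S)"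
  proof (rule card_mono[rotated])
    show "finite (\<Union>S\<in>?P. ?C S)"
    proof (rule finite_UN_I[OF fP])
      show "finite (?C S)" for S by (rule finite_PiE) auto
    qed
  qed
  also have "\<dots> \<le> (\<Sum>S\<in>?P. card (?C S))" by (rule card_UN_le[OF fP])
  also have "\<dots> \<le> (\<Sum>S\<in>?P. Q ^ r)"
  proof (rule sum_mono)
    fix S assume S: "S \<in> ?P"
    have "card (?C S) = (\<Prod>t<n. if t \<in> S then Q else 1)"
      by (subst card_PiE) (auto intro!: prod.cong)
    also have "\<dots> = (\<Prod>t\<in>S. Q)" using S by (intro prod.mono_neutral_cong_right) auto
    also have "\<dots> = Q ^ card S" by simp
    also have "\<dots> \<le> Q ^ r" using S Q by (intro power_increasing) auto
    finally show "card (?C S) \<le> Q ^ r" .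
  qed
  also have "\<dots> = card ?P * Q ^ r" by simp
  also have "card ?P \<le> card (Pow {..<n})" by (intro card_mono) auto
  then have "card ?P * Q ^ r \<le> 2 ^ n * Q ^ r" by (simp add: card_Pow)
  finally show ?thesis .
qed

text \<open>Distance between the jammed codewords of message \<open>w\<close> and jammed uniform vectors.\<close>
definition codeword_bias :: "nat \<Rightarrow> nat \<Rightarrow> nat \<Rightarrow> (nat \<Rightarrow> nat \<Rightarrow> nat \<Rightarrow> nat) \<Rightarrow> nat \<Rightarrow> real" where
  "codeword_bias n Q L c w = (\<Sum>v\<in>vecs n (2 * Q).
     \<bar>(\<Sum>l<L. jam_prob n Q v (c w l)) / L - (\<Sum>x\<in>vecs n Q. jam_prob n Q v x) / card (vecs n Q)\<bar>)"

text \<open>Close codewords of the same message do not count: confusing them still yields the right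
  message.\<close>

definition codeword_conflict :: "nat \<Rightarrow> nat \<Rightarrow> nat \<Rightarrow> nat \<Rightarrow> (nat \<Rightarrow> nat \<Rightarrow> nat \<Rightarrow> nat) \<Rightarrow> nat \<Rightarrow> nat \<Rightarrow> bool" where
  "codeword_conflict n M L r c w l \<longleftrightarrow>
     (\<exists>w'<M. \<exists>l'<L. w' \<noteq> w \<and> card {t \<in> {..<n}. c w l t \<noteq> c w' l' t} \<le> r)"

lemma codeword_bias_nonneg: "0 \<le> codeword_bias n Q L c w"
  unfolding codeword_bias_def by (intro sum_nonneg) simp

lemma codeword_bias:
  assumes c: "\<And>l. l < L \<Longrightarrow> c w l \<in> vecs n Q" and \<psi>: "\<And>v. \<bar>\<psi> v\<bar> \<le> 1"
  shows "\<bar>(\<Sum>l<L. \<Sum>u\<in>vecs n Q. \<psi> (vadd n u (c w l))) / (real L * card (vecs n Q))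
      - (\<Sum>x\<in>vecs n Q. \<Sum>u\<in>vecs n Q. \<psi> (vadd n u x)) / (real (card (vecs n Q)) * card (vecs n Q))\<bar>
    \<le> codeword_bias n Q L c w"
proof -
  let ?N = "real (card (vecs n Q))" and ?V = "vecs n (2 * Q)"
  have 1: "(\<Sum>l<L. \<Sum>u\<in>vecs n Q. \<psi> (vadd n u (c w l))) / (real L * ?N) = (\<Sum>v\<in>?V. \<psi> v * ((\<Sum>l<L. jam_prob n Q v (c w l)) / L))"
  proof -
    have "(\<Sum>v\<in>?V. \<psi> v * ((\<Sum>l<L. jam_prob n Q v (c w l)) / L)) = (\<Sum>v\<in>?V. \<Sum>l<L. \<psi> v * jam_prob n Q v (c w l)) / L"
      by (simp add: sum_divide_distrib sum_distrib_left)
    also have "(\<Sum>v\<in>?V. \<Sum>l<L. \<psi> v * jam_prob n Q v (c w l)) = (\<Sum>l<L. \<Sum>v\<in>?V. \<psi> v * jam_prob n Q v (c w l))"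
      by (rule sum.swap)
    also have "\<dots> = (\<Sum>l<L. (\<Sum>u\<in>vecs n Q. \<psi> (vadd n u (c w l))) / ?N)"
      by (intro sum.cong refl sum_jam_prob c) simp
    finally show ?thesis by (simp add: sum_divide_distrib[symmetric] mult.commute)
  qed
  have 2: "(\<Sum>x\<in>vecs n Q. \<Sum>u\<in>vecs n Q. \<psi> (vadd n u x)) / (?N * ?N) = (\<Sum>v\<in>?V. \<psi> v * ((\<Sum>x\<in>vecs n Q. jam_prob n Q v x) / ?N))"
  proof -
    have "(\<Sum>v\<in>?V. \<psi> v * ((\<Sum>x\<in>vecs n Q. jam_prob n Q v x) / ?N)) = (\<Sum>v\<in>?V. \<Sum>x\<in>vecs n Q. \<psi> v * jam_prob n Q v x) / ?N"
      by (simp add: sum_divide_distrib sum_distrib_left)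
    also have "(\<Sum>v\<in>?V. \<Sum>x\<in>vecs n Q. \<psi> v * jam_prob n Q v x) = (\<Sum>x\<in>vecs n Q. \<Sum>v\<in>?V. \<psi> v * jam_prob n Q v x)"
      by (rule sum.swap)
    also have "\<dots> = (\<Sum>x\<in>vecs n Q. (\<Sum>u\<in>vecs n Q. \<psi> (vadd n u x)) / ?N)"
      by (intro sum.cong refl sum_jam_prob)
    finally show ?thesis by (simp add: sum_divide_distrib[symmetric])
  qed
  have "\<bar>\<Sum>v\<in>?V. \<psi> v * ((\<Sum>l<L. jam_prob n Q v (c w l)) / L) - \<psi> v * ((\<Sum>x\<in>vecs n Q. jam_prob n Q v x) / ?N)\<bar>
     \<le> (\<Sum>v\<in>?V. \<bar>\<psi> v * ((\<Sum>l<L. jam_prob n Q v (c w l)) / L) - \<psi> v * ((\<Sum>x\<in>vecs n Q. jam_prob n Q v x) / ?N)\<bar>)"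
    by (rule sum_abs)
  also have "\<dots> \<le> codeword_bias n Q L c w"
    unfolding codeword_bias_def
  proof (rule sum_mono)
    fix v
    let ?a = "(\<Sum>l<L. jam_prob n Q v (c w l)) / L" and ?b = "(\<Sum>x\<in>vecs n Q. jam_prob n Q v x) / ?N"
    have "\<bar>\<psi> v * ?a - \<psi> v * ?b\<bar> = \<bar>\<psi> v\<bar> * \<bar>?a - ?b\<bar>" by (simp only: right_diff_distrib[symmetric] abs_mult)
    also have "\<dots> \<le> 1 * \<bar>?a - ?b\<bar>" using \<psi> by (intro mult_right_mono) auto
    finally show "\<bar>\<psi> v * ?a - \<psi> v * ?b\<bar> \<le> \<bar>?a - ?b\<bar>" by simp
  qed
  finally show ?thesis unfolding 1 2 sum_subtractf .
qed

text \<open>The number \<open>16 ^ n\<close> of indices per message makes the bias exponentially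
  small; \<open>32 ^ n\<close> is this number times the \<open>2 ^ n\<close> of the Hamming ball
  count.\<close>

lemma wiretap_codebook:
  assumes Q: "Q > 0" and M: "M > 0"
  shows "\<exists>c. (\<forall>w<M. \<forall>l<16 ^ n. c w l \<in> vecs n Q) \<and>
    (\<Sum>w<M. codeword_bias n Q (16 ^ n) c w) / M
      + (\<Sum>w<M. \<Sum>l<16 ^ n. of_bool (codeword_conflict n M (16 ^ n) r c w l)) / (real M * 16 ^ n)
    \<le> 1 / 2 ^ n + real M * 32 ^ n * real Q ^ r / real Q ^ n"
proof -
  \<comment> \<open>There are \<open>(2 * Q) ^ n\<close> sums, so the linear term is
    \<open>2 ^ n / 4 ^ n\<close>, up to a factor 1/2. The second moment term then becomes
    \<open>4 ^ n / 16 ^ n\<close>, again up to 1/2; together they stay below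
    \<open>1 / 2 ^ n\<close>.\<close>
  define \<theta> :: real where "\<theta> = 1 / (4 ^ n * real Q ^ n)"
  define near :: "(nat \<Rightarrow> nat) \<Rightarrow> (nat \<Rightarrow> nat) \<Rightarrow> bool" where
    "near x y \<longleftrightarrow> card {t \<in> {..<n}. x t \<noteq> y t} \<le> r" for x y
  have Q': "real Q > 0" using Q by simp
  have \<theta>: "\<theta> > 0" using Q by (simp add: \<theta>_def)
  have nb: "real (card {y \<in> vecs n Q. near x y}) \<le> 2 ^ n * real Q ^ r" for x
  proof -
    have "real (card {y \<in> vecs n Q. near x y}) \<le> real (2 ^ n * Q ^ r)"
      unfolding near_def of_nat_le_iff by (rule card_hamming_ball[OF Q])
    then show ?thesis by simp
  qed
  have "\<exists>c\<in>PiE ({..<M} \<times> {..<(16::nat) ^ n}) (\<lambda>_. vecs n Q).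
    (\<Sum>w<M. \<Sum>v\<in>vecs n (2 * Q). \<bar>(\<Sum>l<16 ^ n. jam_prob n Q v (c (w, l))) / real (16 ^ n) - (\<Sum>x\<in>vecs n Q. jam_prob n Q v x) / card (vecs n Q)\<bar>) / M
      + (\<Sum>w<M. \<Sum>l<16 ^ n. of_bool (\<exists>w'<M. \<exists>l'<16 ^ n. w' \<noteq> w \<and> near (c (w, l)) (c (w', l')))) / (real M * real (16 ^ n))
      \<le> card (vecs n (2 * Q)) * \<theta> / 2 + 1 / (2 * \<theta> * real (16 ^ n) * card (vecs n Q)) + real M * real (16 ^ n) * (2 ^ n * real Q ^ r) / card (vecs n Q)"
    by (rule random_codebook[OF finite_vecs vecs_nonempty[OF Q] M _ \<theta> sum_jam_prob_squares[OF Q] nb]) simp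
  then obtain c where c: "c \<in> PiE ({..<M} \<times> {..<(16::nat) ^ n}) (\<lambda>_. vecs n Q)"
    and le: "(\<Sum>w<M. \<Sum>v\<in>vecs n (2 * Q). \<bar>(\<Sum>l<16 ^ n. jam_prob n Q v (c (w, l))) / real (16 ^ n) - (\<Sum>x\<in>vecs n Q. jam_prob n Q v x) / card (vecs n Q)\<bar>) / M
      + (\<Sum>w<M. \<Sum>l<16 ^ n. of_bool (\<exists>w'<M. \<exists>l'<16 ^ n. w' \<noteq> w \<and> near (c (w, l)) (c (w', l')))) / (real M * real (16 ^ n))
      \<le> card (vecs n (2 * Q)) * \<theta> / 2 + 1 / (2 * \<theta> * real (16 ^ n) * card (vecs n Q)) + real M * real (16 ^ n) * (2 ^ n * real Q ^ r) / card (vecs n Q)"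
    by (elim bexE)
  have t1: "card (vecs n (2 * Q)) * \<theta> / 2 = (1 / 2 ^ n) / 2"
  proof -
    have "(4::real) ^ n = 2 ^ n * 2 ^ n" using power_mult_distrib[of "2::real" 2 n] by simp
    then show ?thesis using Q' by (simp add: card_vecs \<theta>_def power_mult_distrib)
  qed
  have t2: "1 / (2 * \<theta> * real (16 ^ n) * card (vecs n Q)) \<le> (1 / 2 ^ n) / 2"
  proof -
    have "(16::real) ^ n = 4 ^ n * 4 ^ n" using power_mult_distrib[of "4::real" 4 n] by simp
    then have "1 / (2 * \<theta> * real (16 ^ n) * card (vecs n Q)) = (1 / 4 ^ n) / 2"
      using Q' by (simp add: card_vecs \<theta>_def)
    also have "\<dots> \<le> (1 / 2 ^ n) / 2" by (simp add: divide_simps power_mono)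
    finally show ?thesis .
  qed
  have t3: "real M * real (16 ^ n) * (2 ^ n * real Q ^ r) / card (vecs n Q) = real M * 32 ^ n * real Q ^ r / real Q ^ n"
  proof -
    have "(32::real) ^ n = 16 ^ n * 2 ^ n" using power_mult_distrib[of "16::real" 2 n] by simp
    then show ?thesis by (simp add: card_vecs)
  qed
  define c' where "c' w l = c (w, l)" for w l :: nat
  have "\<forall>w<M. \<forall>l<16 ^ n. c' w l \<in> vecs n Q" using c by (auto simp: c'_def)
  moreover have "(\<Sum>w<M. codeword_bias n Q (16 ^ n) c' w) / M
      + (\<Sum>w<M. \<Sum>l<16 ^ n. of_bool (codeword_conflict n M (16 ^ n) r c' w l)) / (real M * 16 ^ n)
    \<le> 1 / 2 ^ n + real M * 32 ^ n * real Q ^ r / real Q ^ n"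
    using le t1 t2 t3 unfolding codeword_bias_def codeword_conflict_def c'_def near_def of_nat_power of_nat_numeral
    by linarith
  ultimately show ?thesis by blast
qed

section \<open>Aligned schemes\<close>

lemma vadd_assoc_apply: "t < n \<Longrightarrow> vadd n (vadd n u x) y t = u t + x t + y t"
  by (simp add: vadd_def)

text \<open>User 0 is the helper: one message, and \<open>e\<close> enumerates its
  \<open>Q ^ n\<close> jamming vectors as randomization indices. All other users share the codebook
  \<open>c\<close> with \<open>m\<close> messages of \<open>16 ^ n\<close> codewords each.\<close>

locale aligned_scheme =
  fixes K n Q m :: nat and a :: real and h he :: "nat \<Rightarrow> real"
    and c :: "nat \<Rightarrow> nat \<Rightarrow> nat \<Rightarrow> nat" and e :: "nat \<Rightarrow> nat \<Rightarrow> nat"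
  assumes K_pos: "0 < K" and Q_pos: "0 < Q" and m_pos: "0 < m"
    and he_nz: "k < K \<Longrightarrow> he k \<noteq> 0"
    and c_mem: "w < m \<Longrightarrow> l < 16 ^ n \<Longrightarrow> c w l \<in> vecs n Q"
    and e_bij: "bij_betw e {..<Q ^ n} (vecs n Q)"
begin

definition Ms :: "nat \<Rightarrow> nat" where "Ms k = (if k = 0 then 1 else m)"
definition Ls :: "nat \<Rightarrow> nat" where "Ls k = (if k = 0 then Q ^ n else 16 ^ n)"
definition cw :: "nat \<Rightarrow> nat \<Rightarrow> nat \<Rightarrow> nat \<Rightarrow> nat" where "cw k w l = (if k = 0 then e l else c w l)"
definition sg :: "nat \<Rightarrow> nat \<Rightarrow> nat \<Rightarrow> nat \<Rightarrow> real" where "sg k w l t = a / he k * real (cw k w l t)"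

sublocale mac_scheme K n Ms Ls sg
  by standard (use Q_pos m_pos in \<open>auto simp: Ms_def Ls_def\<close>)

lemma cw_mem: "w < Ms k \<Longrightarrow> l < Ls k \<Longrightarrow> cw k w l \<in> vecs n Q"
  using c_mem bij_betwE[OF e_bij] by (auto simp: cw_def Ms_def Ls_def split: if_splits)

definition others :: "nat \<Rightarrow> (nat \<Rightarrow> nat) \<Rightarrow> (nat \<Rightarrow> nat) \<Rightarrow> nat \<Rightarrow> nat" where
  "others j w r = (\<lambda>t\<in>{..<n}. \<Sum>k\<in>{..<K} - {0, j}. cw k (w k) (r k) t)"

text \<open>The factor \<open>1 / he k\<close> cancels the eavesdropper's gain, so only the integer
  sum survives. The update form of the index tuple singles out the helper and one user
  \<open>j\<close>; the rest is \<open>others\<close>.\<close>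

lemma comb_he:
  assumes j: "j < K" "j \<noteq> 0" and t: "t < n"
  shows "comb he w (r(0 := y, j := z)) t = a * real (vadd n (vadd n (e y) (c (w j) z)) (others j w r) t)"
proof -
  let ?l = "r(0 := y, j := z)"
  have "comb he w ?l t = (\<Sum>k<K. a * real (cw k (w k) (?l k) t))"
    unfolding comb_def sg_def using he_nz by (intro sum.cong) auto
  also have "\<dots> = a * real (\<Sum>k<K. cw k (w k) (?l k) t)"
    by (simp add: sum_distrib_left)
  also have "(\<Sum>k<K. cw k (w k) (?l k) t) = cw 0 (w 0) y t + (\<Sum>k\<in>{..<K} - {0}. cw k (w k) (?l k) t)"
    using K_pos j by (subst sum.remove[of _ 0]) auto
  also have "(\<Sum>k\<in>{..<K} - {0}. cw k (w k) (?l k) t) = cw j (w j) z t + (\<Sum>k\<in>{..<K} - {0} - {j}. cw k (w k) (?l k) t)"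
    using j by (subst sum.remove[of _ j]) auto
  also have "(\<Sum>k\<in>{..<K} - {0} - {j}. cw k (w k) (?l k) t) = others j w r t"
    unfolding others_def using t by (auto intro!: sum.cong)
  finally have "comb he w ?l t = a * real (cw 0 (w 0) y t + (cw j (w j) z t + others j w r t))" .
  moreover have "vadd n (vadd n (e y) (c (w j) z)) (others j w r) t = cw 0 (w 0) y t + (cw j (w j) z t + others j w r t)"
    using j t by (simp add: vadd_assoc_apply cw_def)
  ultimately show ?thesis by (simp only:)
qed

text \<open>The test function for \<open>codeword_bias\<close>: helper and user \<open>j\<close>
  contribute \<open>v\<close>, all other codewords are frozen.\<close>

definition obs :: "nat \<Rightarrow> (nat \<Rightarrow> nat) \<Rightarrow> (nat \<Rightarrow> nat) \<Rightarrow> (nat \<Rightarrow> real) set \<Rightarrow> (nat \<Rightarrow> nat) \<Rightarrow> real" where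
  "obs j w r A v = gauss_shift n (\<lambda>t. a * real (vadd n v (others j w r) t)) A"

lemma law_split:
  assumes j: "j < K" "j \<noteq> 0"
  shows "law he w A = (\<Sum>r\<in>PiE ({..<K} - {0, j}) (\<lambda>k. {..<Ls k}).
    (\<Sum>z<16 ^ n. \<Sum>u\<in>vecs n Q. obs j w r A (vadd n u (c (w j) z))) / (real (16 ^ n) * card (vecs n Q)))
    / card (PiE ({..<K} - {0, j}) (\<lambda>k. {..<Ls k}))"
proof -
  let ?R = "{..<K} - {0, j}"
  let ?P = "PiE ?R (\<lambda>k. {..<Ls k})"
  have e1: "{..<K} = insert j (insert 0 ?R)" using j by auto
  have "(\<Sum>l\<in>Rands. gauss_shift n (comb he w l) A)
      = (\<Sum>f\<in>PiE (insert 0 ?R) (\<lambda>k. {..<Ls k}). \<Sum>z<Ls j. gauss_shift n (comb he w (f(j := z))) A)"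
    by (subst e1, rule sum_PiE_insert) (use j in auto)
  also have "\<dots> = (\<Sum>r\<in>?P. \<Sum>y<Ls 0. \<Sum>z<Ls j. gauss_shift n (comb he w (r(0 := y, j := z))) A)"
    by (rule sum_PiE_insert) auto
  also have "\<dots> = (\<Sum>r\<in>?P. \<Sum>y<Q ^ n. \<Sum>z<16 ^ n. obs j w r A (vadd n (e y) (c (w j) z)))"
  proof -
    have "Ls 0 = Q ^ n" "Ls j = 16 ^ n" using j by (simp_all add: Ls_def)
    then show ?thesis unfolding obs_def
      by (simp only:) (intro sum.cong refl gauss_shift_cong comb_he[OF j])
  qed
  also have "\<dots> = (\<Sum>r\<in>?P. \<Sum>u\<in>vecs n Q. \<Sum>z<16 ^ n. obs j w r A (vadd n u (c (w j) z)))"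
    by (intro sum.cong refl sum.reindex_bij_betw[OF e_bij])
  also have "\<dots> = (\<Sum>r\<in>?P. \<Sum>z<16 ^ n. \<Sum>u\<in>vecs n Q. obs j w r A (vadd n u (c (w j) z)))"
    by (intro sum.cong refl sum.swap)
  finally have S: "(\<Sum>l\<in>Rands. gauss_shift n (comb he w l) A) = \<dots>" .
  have P: "(\<Prod>k<K. real (Ls k)) = real (16 ^ n) * card (vecs n Q) * card ?P"
  proof -
    have "(\<Prod>k<K. real (Ls k)) = real (Ls j) * (real (Ls 0) * (\<Prod>k\<in>?R. real (Ls k)))"
      by (subst e1) (use j in simp)
    then show ?thesis using j by (simp add: Ls_def card_PiE card_vecs)
  qed
  show ?thesis unfolding law_def S P by (simp add: sum_divide_distrib[symmetric])
qed

lemma law_change_one: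
  assumes j: "j < K" "j \<noteq> 0" and w: "w j < m" "i < m"
  shows "\<bar>law he w A - law he (w(j := i)) A\<bar> \<le> codeword_bias n Q (16 ^ n) c (w j) + codeword_bias n Q (16 ^ n) c i"
proof -
  let ?P = "PiE ({..<K} - {0, j}) (\<lambda>k. {..<Ls k})"
  let ?D = "codeword_bias n Q (16 ^ n) c"
  define F where "F r i = (\<Sum>z<16 ^ n. \<Sum>u\<in>vecs n Q. obs j w r A (vadd n u (c i z))) / (real (16 ^ n) * card (vecs n Q))" for r i
  \<comment> \<open>The reference value. It depends on the message tuple only through the users
    other than \<open>j\<close>, so it is common to both sides.\<close>
  define U where "U r = (\<Sum>x\<in>vecs n Q. \<Sum>u\<in>vecs n Q. obs j w r A (vadd n u x)) / (real (card (vecs n Q)) * card (vecs n Q))" for r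
  have FU: "\<bar>F r i - U r\<bar> \<le> ?D i" if "i < m" for r i
    unfolding F_def U_def
    by (rule codeword_bias) (use c_mem that gauss_shift_nonneg gauss_shift_le_1 in \<open>auto simp: obs_def abs_le_iff intro: order_trans[of _ 0]\<close>)
  have ot: "others j (w(j := i)) r = others j w r" for r
    unfolding others_def by (intro restrict_ext sum.cong refl) auto
  have "\<bar>(\<Sum>r\<in>?P. F r (w j)) - (\<Sum>r\<in>?P. F r i)\<bar> \<le> (\<Sum>r\<in>?P. \<bar>F r (w j) - F r i\<bar>)"
    by (simp only: sum_subtractf[symmetric] sum_abs)
  also have "\<dots> \<le> (\<Sum>r\<in>?P. ?D (w j) + ?D i)"
    by (intro sum_mono) (use FU w in \<open>smt (verit)\<close>)
  also have "\<dots> = card ?P * (?D (w j) + ?D i)" by simp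
  finally have le: "\<bar>(\<Sum>r\<in>?P. F r (w j)) - (\<Sum>r\<in>?P. F r i)\<bar> \<le> card ?P * (?D (w j) + ?D i)" .
  have pos: "real (card ?P) > 0"
    using Q_pos by (subst card_PiE) (auto simp: Ls_def)
  have "law he w A = (\<Sum>r\<in>?P. F r (w j)) / card ?P"
    unfolding law_split[OF j] F_def ..
  moreover have "law he (w(j := i)) A = (\<Sum>r\<in>?P. F r i) / card ?P"
    unfolding law_split[OF j] F_def obs_def ot by simp
  ultimately have "\<bar>law he w A - law he (w(j := i)) A\<bar> = \<bar>(\<Sum>r\<in>?P. F r (w j)) - (\<Sum>r\<in>?P. F r i)\<bar> / card ?P"
    using pos by (simp add: diff_divide_distrib[symmetric])
  also have "\<dots> \<le> card ?P * (?D (w j) + ?D i) / card ?P"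
    using le by (intro divide_right_mono) auto
  finally show ?thesis using pos by simp
qed

definition bias :: "(nat \<Rightarrow> nat) \<Rightarrow> real" where
  "bias w = (\<Sum>k\<in>{1..<K}. codeword_bias n Q (16 ^ n) c (w k))"

lemma Msgs_D: "w \<in> Msgs \<Longrightarrow> 0 < k \<Longrightarrow> k < K \<Longrightarrow> w k < m" "w \<in> Msgs \<Longrightarrow> w 0 = 0"
  using K_pos unfolding msg_set_def by (auto simp: PiE_iff Ms_def split: if_splits)

text \<open>Hybrid argument: exchange the messages one user at a time and add up the costs.\<close>

lemma law_diff:
  assumes w: "w \<in> Msgs" "w' \<in> Msgs"
  shows "law he w A - law he w' A \<le> bias w + bias w'"
proof -
  let ?D = "codeword_bias n Q (16 ^ n) c"
  \<comment> \<open>The hybrid tuples from \<open>w\<close> to \<open>w'\<close>. The step for user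
    0 costs nothing because the helper has a single message.\<close>
  define g where "g i = (\<lambda>k\<in>{..<K}. if k < i then w' k else w k)" for i
  have ext: "v \<in> extensional {..<K}" if "v \<in> Msgs" for v using that by (simp add: msg_set_def PiE_def)
  have g0: "g 0 = w" using ext[OF w(1)] by (auto simp: g_def fun_eq_iff extensional_def)
  have gK: "g K = w'" using ext[OF w(2)] by (auto simp: g_def fun_eq_iff extensional_def)
  have "law he w A - law he (g i) A \<le> (\<Sum>k\<in>{1..<i}. ?D (w k) + ?D (w' k))" if "i \<le> K" for i
    using that
  proof (induction i)
    case 0
    then show ?case by (simp add: g0)
  next
    case (Suc i)
    have gS: "g (Suc i) = (g i)(i := w' i)" using Suc.prems by (auto simp: g_def fun_eq_iff less_Suc_eq)
    have gi: "g i i = w i" using Suc.prems by (simp add: g_def)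
    show ?case
    proof (cases "i = 0")
      case True
      then have "g (Suc i) = g i" using gS gi Msgs_D(2)[OF w(1)] Msgs_D(2)[OF w(2)] by (auto simp: fun_eq_iff)
      then show ?thesis using True g0 by simp
    next
      case False
      have "\<bar>law he (g i) A - law he ((g i)(i := w' i)) A\<bar> \<le> ?D (g i i) + ?D (w' i)"
        using False Suc.prems gi Msgs_D(1)[OF w(1)] Msgs_D(1)[OF w(2)] by (intro law_change_one) auto
      moreover have "(\<Sum>k\<in>{1..<Suc i}. ?D (w k) + ?D (w' k)) = (\<Sum>k\<in>{1..<i}. ?D (w k) + ?D (w' k)) + (?D (w i) + ?D (w' i))"
        using False by simp
      moreover have "law he w A - law he (g i) A \<le> (\<Sum>k\<in>{1..<i}. ?D (w k) + ?D (w' k))"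
        using Suc by simp
      ultimately show ?thesis unfolding gS gi by linarith
    qed
  qed
  from this[of K] show ?thesis unfolding gK bias_def by (simp add: sum.distrib)
qed

lemma avg_coordinate:
  fixes f :: "nat \<Rightarrow> real"
  assumes "k < K"
  shows "(\<Sum>w\<in>Msgs. f (w k)) / card Msgs = (\<Sum>i<Ms k. f i) / Ms k"
  using sum_PiE_coordinate[of "{..<K}" k f Ms] assms card_Msgs_pos M_pos[OF assms]
  unfolding msg_set_def by (simp add: field_simps)

lemma avg_bias: "(\<Sum>w\<in>Msgs. bias w) / card Msgs = (real K - 1) * ((\<Sum>i<m. codeword_bias n Q (16 ^ n) c i) / m)"
proof -
  let ?D = "codeword_bias n Q (16 ^ n) c"
  have "(\<Sum>w\<in>Msgs. bias w) / card Msgs = (\<Sum>k\<in>{1..<K}. (\<Sum>w\<in>Msgs. ?D (w k)) / card Msgs)"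
    unfolding bias_def by (subst sum.swap) (simp add: sum_divide_distrib)
  also have "\<dots> = (\<Sum>k\<in>{1..<K}. (\<Sum>i<m. ?D i) / m)"
    by (intro sum.cong refl) (auto simp: avg_coordinate Ms_def)
  finally show ?thesis using K_pos by (simp add: of_nat_diff)
qed

end

section \<open>Decoding\<close>

definition outliers :: "nat \<Rightarrow> real \<Rightarrow> (nat \<Rightarrow> real) \<Rightarrow> nat" where
  "outliers n \<tau> x = card {t \<in> {..<n}. \<tau> \<le> \<bar>x t\<bar>}"

lemma outliers_sets: "{y \<in> space (sig_space n). outliers n \<tau> (\<lambda>t. y t - v t) \<le> r} \<in> sets (sig_space n)"
proof -
  have "real (outliers n \<tau> (\<lambda>t. y t - v t)) = (\<Sum>t<n. indicator {z. \<tau> \<le> \<bar>z\<bar>} (y t - v t))" for y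
    unfolding outliers_def by (simp add: indicator_def sum.If_cases Int_def)
  then have "outliers n \<tau> (\<lambda>t. y t - v t) \<le> r \<longleftrightarrow> (\<Sum>t<n. indicator {z. \<tau> \<le> \<bar>z\<bar>} (y t - v t)) \<le> real r" for y
    by (metis of_nat_le_iff)
  moreover have "{y \<in> space (sig_space n). (\<Sum>t<n. indicator {z. \<tau> \<le> \<bar>z\<bar>} (y t - v t)) \<le> real r} \<in> sets (sig_space n)"
    unfolding sig_space_def by measurable
  ultimately show ?thesis by simp
qed

text \<open>Chebyshev's inequality suffices, because the threshold will be exponential in the
  parameter \<open>s\<close>.\<close>

lemma std_normal_tail:
  assumes "\<tau> > 0"
  shows "measure (density lborel std_normal_density) {x. \<tau> \<le> \<bar>x\<bar>} \<le> 1 / \<tau>\<^sup>2"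
proof -
  interpret prob_space "density lborel std_normal_density" by (rule prob_space_normal_density) simp
  have hb: "has_bochner_integral lborel (\<lambda>x. std_normal_density x * x\<^sup>2) 1"
    using std_normal_moment_even[of 1] by simp
  have i: "integrable (density lborel std_normal_density) (\<lambda>x. x\<^sup>2)"
    using hb by (subst integrable_density) (auto simp: has_bochner_integral_iff)
  have "(\<integral>x. x\<^sup>2 \<partial>density lborel std_normal_density) = 1"
    using hb by (subst integral_density) (auto simp: has_bochner_integral_iff)
  moreover have "measure (density lborel std_normal_density) {x \<in> space (density lborel std_normal_density). \<tau>\<^sup>2 \<le> x\<^sup>2}
      \<le> (\<integral>x. x\<^sup>2 \<partial>density lborel std_normal_density) / \<tau>\<^sup>2"
    using assms i by (intro integral_Markov_inequality_measure[where A = "space (density lborel std_normal_density)"]) auto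
  moreover have "{x \<in> space (density lborel std_normal_density). \<tau>\<^sup>2 \<le> x\<^sup>2} = {x. \<tau> \<le> \<bar>x\<bar>}"
    using assms by (auto simp: abs_le_square_iff[symmetric])
  ultimately show ?thesis by simp
qed

text \<open>Union bound over the \<open>2 ^ n\<close> sets of positions and independence of the
  symbols. No single symbol is reliable, but the fraction of large noise values is.\<close>

lemma noise_outliers:
  assumes p: "measure (density lborel std_normal_density) {x. \<tau> \<le> \<bar>x\<bar>} \<le> p" "p \<le> 1"
  shows "measure (noise_space n) {x \<in> space (noise_space n). r < outliers n \<tau> x} \<le> 2 ^ n * p ^ r"
proof -
  let ?N = "density lborel std_normal_density"
  interpret N1: prob_space ?N by (rule prob_space_normal_density) simp
  interpret N: prob_space "noise_space n" by (rule prob_space_noise_space)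
  interpret product_sigma_finite "\<lambda>_::nat. ?N"
    unfolding product_sigma_finite_def using N1.sigma_finite_measure_axioms by simp
  have p0: "0 \<le> p" using p(1) measure_nonneg order_trans by blast
  \<comment> \<open>Sets with at least \<open>r\<close> elements: the set of outlier positions is
    itself a member, and since \<open>p \<le> 1\<close> every member has probability at most
    \<open>p ^ r\<close>.\<close>
  let ?P = "{S. S \<subseteq> {..<n} \<and> r \<le> card S}"
  let ?E = "\<lambda>S t. if t \<in> S then {x::real. \<tau> \<le> \<bar>x\<bar>} else UNIV"
  have Em: "?E S t \<in> sets ?N" for S t
  proof -
    have "{x::real. \<tau> \<le> \<bar>x\<bar>} \<in> sets borel" by measurable
    then show ?thesis by simp
  qed
  have Cm: "PiE {..<n} (?E S) \<in> sets (noise_space n)" for S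
    unfolding noise_space_def by (rule sets_PiM_I_finite) (use Em in auto)
  have "{x \<in> space (noise_space n). r < outliers n \<tau> x} \<subseteq> (\<Union>S\<in>?P. PiE {..<n} (?E S))"
  proof
    fix x assume x: "x \<in> {x \<in> space (noise_space n). r < outliers n \<tau> x}"
    have "{t \<in> {..<n}. \<tau> \<le> \<bar>x t\<bar>} \<in> ?P" using x by (auto simp: outliers_def)
    moreover have "x \<in> PiE {..<n} (?E {t \<in> {..<n}. \<tau> \<le> \<bar>x t\<bar>})"
      using x by (auto simp: space_noise_space PiE_def)
    ultimately show "x \<in> (\<Union>S\<in>?P. PiE {..<n} (?E S))" by (rule UN_I)
  qed
  moreover have "(\<Union>S\<in>?P. PiE {..<n} (?E S)) \<in> sets (noise_space n)"
    by (rule sets.finite_UN) (use Cm in auto)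
  ultimately have "measure (noise_space n) {x \<in> space (noise_space n). r < outliers n \<tau> x}
      \<le> measure (noise_space n) (\<Union>S\<in>?P. PiE {..<n} (?E S))"
    by (intro N.finite_measure_mono) auto
  also have "\<dots> \<le> (\<Sum>S\<in>?P. measure (noise_space n) (PiE {..<n} (?E S)))"
    by (rule measure_UNION_le) (use Cm in auto)
  also have "\<dots> \<le> (\<Sum>S\<in>?P. p ^ r)"
  proof (rule sum_mono)
    fix S assume S: "S \<in> ?P"
    have "emeasure (noise_space n) (PiE {..<n} (?E S)) = (\<Prod>t<n. emeasure ?N (?E S t))"
      unfolding noise_space_def by (rule emeasure_PiM) (use Em in auto)
    also have "\<dots> = (\<Prod>t<n. ennreal (measure ?N (?E S t)))"
      by (simp only: N1.emeasure_eq_measure)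
    also have "\<dots> = ennreal (\<Prod>t<n. measure ?N (?E S t))" by (rule prod_ennreal) simp
    finally have "measure (noise_space n) (PiE {..<n} (?E S)) = (\<Prod>t<n. measure ?N (?E S t))"
      by (intro measure_eq_emeasure_eq_ennreal prod_nonneg) auto
    also have "\<dots> = (\<Prod>t<n. if t \<in> S then measure ?N {x. \<tau> \<le> \<bar>x\<bar>} else 1)"
      using N1.prob_space by (intro prod.cong) auto
    also have "\<dots> = (\<Prod>t\<in>S. measure ?N {x. \<tau> \<le> \<bar>x\<bar>})"
      using S by (intro prod.mono_neutral_cong_right) auto
    also have "\<dots> = measure ?N {x. \<tau> \<le> \<bar>x\<bar>} ^ card S" by simp
    also have "\<dots> \<le> p ^ card S" using p by (intro power_mono) auto
    also have "\<dots> \<le> p ^ r" using S p p0 by (intro power_decreasing) auto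
    finally show "measure (noise_space n) (PiE {..<n} (?E S)) \<le> p ^ r" .
  qed
  also have "\<dots> = card ?P * p ^ r" by simp
  also have "\<dots> \<le> 2 ^ n * p ^ r"
  proof (rule mult_right_mono)
    have "card ?P \<le> card (Pow {..<n})" by (intro card_mono) auto
    then have "card ?P \<le> 2 ^ n" by (simp add: card_Pow)
    then show "real (card ?P) \<le> 2 ^ n" by (metis of_nat_le_iff of_nat_numeral of_nat_power)
  qed (use p0 in simp)
  finally show ?thesis .
qed

text \<open>\<open>separated\<close> puts the noiseless received points \<open>2 * \<tau>\<close>
  apart, so two different symbol tuples cannot both be within less than \<open>\<tau>\<close> of the
  same received value.\<close>

locale decodable_scheme = aligned_scheme +
  fixes \<tau> :: real and r :: nat
  assumes separated: "\<And>x x'. (\<And>k. k < K \<Longrightarrow> x k < Q) \<Longrightarrow> (\<And>k. k < K \<Longrightarrow> x' k < Q) \<Longrightarrow> \<exists>k<K. x k \<noteq> x' k \<Longrightarrow>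
      2 * \<tau> \<le> \<bar>\<Sum>k<K. h k * (a / he k * real (x k)) - h k * (a / he k * real (x' k))\<bar>"
begin

definition plausible :: "(nat \<Rightarrow> nat) \<Rightarrow> (nat \<Rightarrow> real) \<Rightarrow> bool" where
  "plausible w y \<longleftrightarrow> (\<exists>l\<in>Rands. outliers n \<tau> (\<lambda>t. y t - comb h w l t) \<le> r)"

text \<open>Any plausible message may be chosen; the error analysis shows that typically only the
  true one is. Without a plausible message the value is arbitrary and counts as an error.\<close>

definition decode :: "(nat \<Rightarrow> real) \<Rightarrow> nat \<Rightarrow> nat" where
  "decode y = (SOME w. w \<in> {w \<in> Msgs. plausible w y})"

lemma finite_Rands: "finite Rands"
  by (intro finite_PiE) auto

lemma finite_Msgs: "finite Msgs"
  by (intro finite_msg_set) simp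

lemma plausible_sets: "{y \<in> space (sig_space n). plausible w y} \<in> sets (sig_space n)"
  unfolding plausible_def by (intro sets.sets_Collect_finite_Ex outliers_sets finite_Rands)

lemma decode_measurable: "decode \<in> sig_space n \<rightarrow>\<^sub>M count_space UNIV"
proof -
  \<comment> \<open>The decoder factors through the set of plausible messages, which takes finitely
    many values, so the arbitrary choice made afterwards is harmless for measurability.\<close>
  have "(\<lambda>y. {w \<in> Msgs. plausible w y}) \<in> sig_space n \<rightarrow>\<^sub>M count_space (Pow Msgs)"
  proof (subst measurable_count_space_eq2)
    show "finite (Pow Msgs)" using finite_Msgs by simp
    show "(\<lambda>y. {w \<in> Msgs. plausible w y}) \<in> space (sig_space n) \<rightarrow> Pow Msgs \<and>
      (\<forall>X\<in>Pow Msgs. (\<lambda>y. {w \<in> Msgs. plausible w y}) -` {X} \<inter> space (sig_space n) \<in> sets (sig_space n))"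
    proof (intro conjI ballI)
      fix X assume X: "X \<in> Pow Msgs"
      have "(\<lambda>y. {w \<in> Msgs. plausible w y}) -` {X} \<inter> space (sig_space n)
          = {y \<in> space (sig_space n). \<forall>w\<in>Msgs. plausible w y = (w \<in> X)}"
        using X by auto
      also have "\<dots> \<in> sets (sig_space n)"
      proof (rule sets.sets_Collect_finite_All[OF _ finite_Msgs])
        fix w
        show "{y \<in> space (sig_space n). plausible w y = (w \<in> X)} \<in> sets (sig_space n)"
          using plausible_sets[of w] sets.sets_Collect_neg[OF plausible_sets[of w]] by (cases "w \<in> X") auto
      qed
      finally show "(\<lambda>y. {w \<in> Msgs. plausible w y}) -` {X} \<inter> space (sig_space n) \<in> sets (sig_space n)" .
    qed auto
  qed
  from measurable_compose[OF this, of "\<lambda>A. SOME w. w \<in> A" "count_space UNIV"]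
  show ?thesis unfolding decode_def[abs_def] by simp
qed

text \<open>If the noise has few outliers, the true and the decoded tuple both explain the output
  except at few positions each; elsewhere separation forces all users' symbols to coincide. A wrong
  message then has a codeword within Hamming distance \<open>2 * r\<close> of the true one.\<close>

lemma decode_error_cases:
  assumes w: "w \<in> Msgs" and l: "l \<in> Rands" and err: "decode (\<lambda>t\<in>{..<n}. comb h w l t + x t) \<noteq> w"
  shows "r < outliers n \<tau> x \<or> (\<exists>k\<in>{1..<K}. codeword_conflict n m (16 ^ n) (2 * r) c (w k) (l k))"
proof (subst disj_commute, rule disjCI)
  assume x: "\<not> r < outliers n \<tau> x"
  let ?y = "\<lambda>t\<in>{..<n}. comb h w l t + x t"
  have "outliers n \<tau> (\<lambda>t. ?y t - comb h w l t) = outliers n \<tau> x"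
    unfolding outliers_def by (intro arg_cong[where f=card] Collect_cong conj_cong refl) simp
  then have "outliers n \<tau> (\<lambda>t. ?y t - comb h w l t) \<le> r" using x by linarith
  then have "plausible w ?y" unfolding plausible_def by (rule bexI[OF _ l])
  then have "decode ?y \<in> {w \<in> Msgs. plausible w ?y}"
    unfolding decode_def by (intro someI[of "\<lambda>v. v \<in> {w \<in> Msgs. plausible w ?y}" w]) (simp add: w)
  then obtain l' where w': "decode ?y \<in> Msgs" and l': "l' \<in> Rands"
    and o': "outliers n \<tau> (\<lambda>t. ?y t - comb h (decode ?y) l' t) \<le> r"
    unfolding plausible_def mem_Collect_eq by (elim conjE bexE)
  define w' where "w' = decode ?y"
  have wM: "w k < Ms k" "w' k < Ms k" "l k < Ls k" "l' k < Ls k" if "k < K" for k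
    using w w' l l' that by (auto simp: msg_set_def PiE_iff w'_def)
  \<comment> \<open>The positions where one of the two explanations fails, at most \<open>r\<close>
    for each.\<close>
  define bad where "bad = {t \<in> {..<n}. \<tau> \<le> \<bar>x t\<bar>} \<union> {t \<in> {..<n}. \<tau> \<le> \<bar>?y t - comb h w' l' t\<bar>}"
  have fb: "finite bad" by (simp add: bad_def)
  have "card bad \<le> outliers n \<tau> x + outliers n \<tau> (\<lambda>t. ?y t - comb h w' l' t)"
    unfolding bad_def outliers_def by (rule card_Un_le)
  then have cb: "card bad \<le> 2 * r" using x o' by (simp add: w'_def)
  have agree: "cw k (w k) (l k) t = cw k (w' k) (l' k) t" if t: "t < n" "t \<notin> bad" and k: "k < K" for t k
  proof (rule ccontr)
    assume ne: "cw k (w k) (l k) t \<noteq> cw k (w' k) (l' k) t"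
    have lt: "cw k (w k) (l k) t < Q" "cw k (w' k) (l' k) t < Q" if "k < K" for k
      using cw_mem[OF wM(1,3)[OF that]] cw_mem[OF wM(2,4)[OF that]] t by (auto simp: vecs_def PiE_iff)
    have "2 * \<tau> \<le> \<bar>\<Sum>k<K. h k * (a / he k * real (cw k (w k) (l k) t)) - h k * (a / he k * real (cw k (w' k) (l' k) t))\<bar>"
      using lt ne k by (intro separated) auto
    also have "\<dots> = \<bar>comb h w l t - comb h w' l' t\<bar>"
      by (simp add: comb_def sg_def sum_subtractf)
    also have "\<dots> < 2 * \<tau>" using t unfolding bad_def by auto
    finally show False by simp
  qed
  obtain k where k: "k < K" "w k \<noteq> w' k"
    using err w w' unfolding w'_def[symmetric] msg_set_def PiE_def by (metis IntE extensionalityI lessThan_iff)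
  \<comment> \<open>The helper has one message, so the tuples differ at a user that employs the
    codebook.\<close>
  have k0: "k \<noteq> 0"
  proof
    assume "k = 0"
    then show False using k(2) wM(1,2)[OF k(1)] by (simp add: Ms_def)
  qed
  have "card {t \<in> {..<n}. c (w k) (l k) t \<noteq> c (w' k) (l' k) t} \<le> card bad"
    using agree[OF _ _ k(1)] k0 fb by (intro card_mono) (auto simp: cw_def)
  then have "codeword_conflict n m (16 ^ n) (2 * r) c (w k) (l k)"
    unfolding codeword_conflict_def using cb wM[OF k(1)] k k0
    by (intro exI[of _ "w' k"] exI[of _ "l' k"]) (auto simp: Ms_def Ls_def)
  then show "\<exists>k\<in>{1..<K}. codeword_conflict n m (16 ^ n) (2 * r) c (w k) (l k)" using k k0 by auto
qed

text \<open>An index tuple with a conflict at some user is charged the full error probability 1; the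
  union bound over the \<open>K - 1\<close> users and averaging over messages and indices give the
  conflict density of the codebook.\<close>

lemma decode_error:
  "measure \<Omega> {\<omega> \<in> space \<Omega>. decode (rx_Y K n h enc \<omega>) \<noteq> fst \<omega>}
   \<le> measure (noise_space n) {x \<in> space (noise_space n). r < outliers n \<tau> x}
     + (real K - 1) * ((\<Sum>i<m. \<Sum>j<16 ^ n. of_bool (codeword_conflict n m (16 ^ n) (2 * r) c i j)) / (real m * 16 ^ n))"
proof -
  interpret N: prob_space "noise_space n" by (rule prob_space_noise_space)
  define p where "p = measure (noise_space n) {x \<in> space (noise_space n). r < outliers n \<tau> x}"
  define f where "f i j = (of_bool (codeword_conflict n m (16 ^ n) (2 * r) c i j) :: real)" for i j
  define B where "B w = {y \<in> space (sig_space n). decode y \<noteq> w}" for w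
  have Bs: "B w \<in> sets (sig_space n)" for w
    using measurable_sets[OF decode_measurable, of "- {w}"] by (simp add: B_def vimage_def Int_def conj_commute)
  have os: "{x \<in> space (noise_space n). r < outliers n \<tau> x} \<in> sets (noise_space n)"
  proof -
    have "{y \<in> space (sig_space n). \<not> outliers n \<tau> y \<le> r} \<in> sets (sig_space n)"
      using outliers_sets[of n \<tau> "\<lambda>_. 0" r] by (intro sets.sets_Collect_neg) simp
    then show ?thesis by (simp add: sets_noise_space space_noise_space space_sig_space not_le)
  qed
  have g: "gauss_shift n (comb h w l) (B w) \<le> p + (\<Sum>k\<in>{1..<K}. f (w k) (l k))" if w: "w \<in> Msgs" and l: "l \<in> Rands" for w l
  proof (cases "\<exists>k\<in>{1..<K}. codeword_conflict n m (16 ^ n) (2 * r) c (w k) (l k)")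
    case True
    then obtain k where k: "k \<in> {1..<K}" "f (w k) (l k) = 1" by (auto simp: f_def)
    have "f (w k) (l k) \<le> (\<Sum>k\<in>{1..<K}. f (w k) (l k))" using k by (intro member_le_sum) (auto simp: f_def)
    moreover have "0 \<le> p" by (simp add: p_def)
    ultimately show ?thesis using gauss_shift_le_1[of n "comb h w l" "B w"] k by simp
  next
    case False
    have "gauss_shift n (comb h w l) (B w) \<le> p"
      unfolding gauss_shift_def p_def
      using decode_error_cases[OF w l] False
      by (intro N.finite_measure_mono os) (auto simp: B_def)
    moreover have "0 \<le> (\<Sum>k\<in>{1..<K}. f (w k) (l k))" by (intro sum_nonneg) (simp add: f_def)
    ultimately show ?thesis by simp
  qed
  define PL where "PL = (\<Prod>k<K. real (Ls k))"
  have PL: "PL > 0" unfolding PL_def by (rule prod_L_pos)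
  have cR: "real (card Rands) = PL" unfolding PL_def by (rule card_Rands)
  have avgl: "(\<Sum>l\<in>Rands. f i (l k)) / PL = (\<Sum>j<16 ^ n. f i j) / 16 ^ n" if "k \<in> {1..<K}" for i k
  proof -
    have "(\<Sum>l\<in>Rands. f i (l k)) * Ls k = PL * (\<Sum>j<Ls k. f i j)"
      using sum_PiE_coordinate[of "{..<K}" k "f i" Ls] that unfolding cR by simp
    moreover have "Ls k = 16 ^ n" using that by (simp add: Ls_def)
    ultimately show ?thesis using PL by (simp add: field_simps)
  qed
  have law_le: "law h w (B w) \<le> p + (\<Sum>k\<in>{1..<K}. (\<Sum>j<16 ^ n. f (w k) j) / 16 ^ n)" if "w \<in> Msgs" for w
  proof -
    have "law h w (B w) \<le> (\<Sum>l\<in>Rands. p + (\<Sum>k\<in>{1..<K}. f (w k) (l k))) / PL"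
      unfolding law_def PL_def[symmetric] using PL by (intro divide_right_mono sum_mono g that) auto
    also have "\<dots> = p + (\<Sum>l\<in>Rands. \<Sum>k\<in>{1..<K}. f (w k) (l k)) / PL"
      using PL by (simp add: sum.distrib cR add_divide_distrib)
    also have "(\<Sum>l\<in>Rands. \<Sum>k\<in>{1..<K}. f (w k) (l k)) / PL = (\<Sum>k\<in>{1..<K}. (\<Sum>l\<in>Rands. f (w k) (l k)) / PL)"
      by (subst sum.swap) (rule sum_divide_distrib)
    also have "\<dots> = (\<Sum>k\<in>{1..<K}. (\<Sum>j<16 ^ n. f (w k) j) / 16 ^ n)"
      by (intro sum.cong refl avgl)
    finally show ?thesis .
  qed
  have "{\<omega> \<in> space \<Omega>. decode (rx_Y K n h enc \<omega>) \<noteq> fst \<omega>} = {\<omega> \<in> space \<Omega>. rx_Y K n h enc \<omega> \<in> B (fst \<omega>)}"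
    by (auto simp: B_def space_sig_space rx_Y_def)
  then have "measure \<Omega> {\<omega> \<in> space \<Omega>. decode (rx_Y K n h enc \<omega>) \<noteq> fst \<omega>} = (\<Sum>w\<in>Msgs. law h w (B w)) / card Msgs"
    using measure_rx_Y(2)[of B h] Bs by simp
  also have "\<dots> \<le> (\<Sum>w\<in>Msgs. p + (\<Sum>k\<in>{1..<K}. (\<Sum>j<16 ^ n. f (w k) j) / 16 ^ n)) / card Msgs"
    by (intro divide_right_mono sum_mono law_le) auto
  also have "\<dots> = p + (\<Sum>k\<in>{1..<K}. (\<Sum>w\<in>Msgs. (\<Sum>j<16 ^ n. f (w k) j) / 16 ^ n) / card Msgs)"
    using card_Msgs_pos by (simp only: sum.distrib add_divide_distrib sum_constant) (simp add: sum.swap[of _ Msgs] sum_divide_distrib[symmetric])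
  also have "\<dots> = p + (\<Sum>k\<in>{1..<K}. (\<Sum>i<m. (\<Sum>j<16 ^ n. f i j) / 16 ^ n) / m)"
  proof (intro arg_cong2[where f="(+)"] sum.cong refl)
    fix k assume k: "k \<in> {1..<K}"
    then have "Ms k = m" by (simp add: Ms_def)
    then show "(\<Sum>w\<in>Msgs. (\<Sum>j<16 ^ n. f (w k) j) / 16 ^ n) / card Msgs = (\<Sum>i<m. (\<Sum>j<16 ^ n. f i j) / 16 ^ n) / m"
      using avg_coordinate[of k "\<lambda>i. (\<Sum>j<16 ^ n. f i j) / 16 ^ n"] k by simp
  qed
  also have "\<dots> = p + (real K - 1) * ((\<Sum>i<m. \<Sum>j<16 ^ n. f i j) / (real m * 16 ^ n))"
    using K_pos by (simp add: of_nat_diff sum_divide_distrib[symmetric] mult.commute)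
  finally show ?thesis unfolding p_def f_def .
qed

end

text \<open>\<open>X\<close> bounds both the average bias and the conflict density of one codebook.
  The 1 in \<open>sec\<close> is the bit lost in \<open>equivocation\<close>; it is paid from the
  part of \<open>\<epsilon>\<close> left over by the bias.\<close>

lemma aligned_secret_code:
  fixes K n Q m r :: nat and a \<tau> P \<epsilon> \<beta> X :: real and h he :: "nat \<Rightarrow> real"
  assumes pos: "0 < K" "0 < Q" "0 < m" and he_nz: "\<And>k. k < K \<Longrightarrow> he k \<noteq> 0"
    and separated: "\<And>x x'. (\<And>k. k < K \<Longrightarrow> x k < Q) \<Longrightarrow> (\<And>k. k < K \<Longrightarrow> x' k < Q) \<Longrightarrow> \<exists>k<K. x k \<noteq> x' k \<Longrightarrow>
      2 * \<tau> \<le> \<bar>\<Sum>k<K. h k * (a / he k * real (x k)) - h k * (a / he k * real (x' k))\<bar>"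
    and power: "\<And>k. k < K \<Longrightarrow> a * Q \<le> sqrt P * \<bar>he k\<bar>" "0 \<le> a" "0 \<le> P"
    and noise: "measure (noise_space n) {x \<in> space (noise_space n). r < outliers n \<tau> x} \<le> \<beta>"
    and X: "1 / 2 ^ n + real m * 32 ^ n * real Q ^ (2 * r) / real Q ^ n \<le> X"
    and err: "\<beta> + (real K - 1) * X \<le> \<epsilon>"
    and sec: "1 \<le> (\<epsilon> - 4 * (real K - 1) * X) * log 2 m"
  shows "\<exists>f \<phi>. secret_code K n (\<lambda>k. if k = 0 then 1 else m) P h he f \<phi> \<epsilon>"
proof -
  obtain c where c: "\<And>w l. w < m \<Longrightarrow> l < 16 ^ n \<Longrightarrow> c w l \<in> vecs n Q"
    and cX: "(\<Sum>w<m. codeword_bias n Q (16 ^ n) c w) / m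
      + (\<Sum>w<m. \<Sum>l<16 ^ n. of_bool (codeword_conflict n m (16 ^ n) (2 * r) c w l)) / (real m * 16 ^ n) \<le> X"
    using wiretap_codebook[OF pos(2,3), of n "2 * r"] X by (auto dest: order_trans)
  obtain e where "bij_betw e {0..<card (vecs n Q)} (vecs n Q)"
    using ex_bij_betw_nat_finite[OF finite_vecs] by blast
  then have e: "bij_betw e {..<Q ^ n} (vecs n Q)" by (simp add: card_vecs lessThan_atLeast0)
  interpret decodable_scheme K n Q m a h he c e \<tau> r
    by unfold_locales (fact pos he_nz c e separated)+
  have K1: "0 \<le> real K - 1" using pos by simp
  have Db: "(\<Sum>w<m. codeword_bias n Q (16 ^ n) c w) / m \<le> X"
    and Cb: "(\<Sum>w<m. \<Sum>l<16 ^ n. of_bool (codeword_conflict n m (16 ^ n) (2 * r) c w l)) / (real m * 16 ^ n) \<le> X"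
  proof -
    have "0 \<le> (\<Sum>w<m. codeword_bias n Q (16 ^ n) c w) / m"
      by (intro divide_nonneg_nonneg sum_nonneg codeword_bias_nonneg) auto
    moreover have "0 \<le> (\<Sum>w<m. \<Sum>l<16 ^ n. (of_bool (codeword_conflict n m (16 ^ n) (2 * r) c w l)) :: real) / (real m * 16 ^ n)"
      by (intro divide_nonneg_nonneg sum_nonneg) auto
    ultimately show "(\<Sum>w<m. codeword_bias n Q (16 ^ n) c w) / m \<le> X"
      "(\<Sum>w<m. \<Sum>l<16 ^ n. of_bool (codeword_conflict n m (16 ^ n) (2 * r) c w l)) / (real m * 16 ^ n) \<le> X"
      using cX by linarith+
  qed
  have Mseq: "Ms = (\<lambda>k. if k = 0 then 1 else m)" by (auto simp: Ms_def)
  have "secret_code K n Ms P h he enc decode \<epsilon>"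
    unfolding secret_code_def
  proof (intro conjI allI impI)
    show "enc k w \<in> lborel \<rightarrow>\<^sub>M sig_space n" for k w by (rule enc_measurable)
    show "decode \<in> sig_space n \<rightarrow>\<^sub>M count_space UNIV" by (rule decode_measurable)
    show "(\<integral>\<^sup>+\<omega>. ennreal ((\<Sum>t<n. (tx n enc k \<omega> t)\<^sup>2) / real n) \<partial>\<Omega>) \<le> ennreal P" if k: "k < K" for k
    proof (rule power_constraint[OF _ k])
      fix k w l assume k: "k < K" and w: "w < Ms k" and l: "l < Ls k"
      have "(sg k w l t)\<^sup>2 \<le> P" if t: "t < n" for t
      proof -
        have "cw k w l t < Q" using cw_mem[OF w l] t by (auto simp: vecs_def PiE_iff)
        then have "a * real (cw k w l t) \<le> a * real Q" using power(2) by (intro mult_left_mono) auto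
        also have "\<dots> \<le> sqrt P * \<bar>he k\<bar>" by (rule power(1)[OF k])
        finally have "a * real (cw k w l t) / \<bar>he k\<bar> \<le> sqrt P" using he_nz[OF k] by (simp add: field_simps)
        then have "\<bar>sg k w l t\<bar> \<le> sqrt P" using power(2) by (simp add: sg_def abs_mult)
        then have "(sg k w l t)\<^sup>2 \<le> (sqrt P)\<^sup>2" by (rule abs_le_square_iff[THEN iffD1, OF order_trans]) (use power(3) in simp)
        then show ?thesis using power(3) by simp
      qed
      then have "(\<Sum>t<n. (sg k w l t)\<^sup>2) \<le> (\<Sum>t<n. P)" by (intro sum_mono) auto
      \<comment> \<open>For \<open>n = 0\<close> the quotient is 0 by the convention for
        division.\<close>
      then show "(\<Sum>t<n. (sg k w l t)\<^sup>2) / real n \<le> P"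
        using power(3) by (cases "n = 0") (auto simp: field_simps)
    qed
    have "measure \<Omega> {\<omega> \<in> space \<Omega>. decode (rx_Y K n h enc \<omega>) \<noteq> fst \<omega>} \<le> \<beta> + (real K - 1) * X"
      by (rule order_trans[OF decode_error]) (intro add_mono noise mult_left_mono Cb K1)
    with err show "measure \<Omega> {\<omega> \<in> space \<Omega>. decode (rx_Y K n h enc \<omega>) \<noteq> fst \<omega>} \<le> \<epsilon>" by linarith
    fix S assume S: "S \<subseteq> {..<K}"
    let ?H = "prob_space.conditional_entropy \<Omega> 2 (count_space (msg_set S Ms)) (sig_space n)
            (\<lambda>\<omega>. restrict (fst \<omega>) S) (rx_Z K n he enc)"
    let ?F = "card (msg_set S Ms)"
    have fS: "finite S" using S finite_subset by auto
    have H: "(1 - 4 * ((\<Sum>w\<in>Msgs. bias w) / card Msgs)) * log 2 ?F - 1 \<le> ?H" "0 \<le> ?H"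
      by (rule equivocation[OF S law_diff]; assumption)+
    have "(1 - \<epsilon>) * log 2 ?F \<le> ?H"
    \<comment> \<open>A set without codebook users has message entropy 0, so nonnegativity of the
      equivocation is enough.\<close>
    proof (cases "S \<subseteq> {0}")
      case True
      then have "?F = 1" unfolding card_msg_set[OF fS] by (intro prod.neutral) (auto simp: Ms_def)
      then show ?thesis using H(2) by simp
    next
      case False
      then obtain k where k: "k \<in> S" "k \<noteq> 0" by auto
      have "m = Ms k" using k by (simp add: Ms_def)
      also have "\<dots> \<le> (\<Prod>k\<in>S. Ms k)"
        using k fS m_pos by (intro dvd_imp_le dvd_prodI) (auto simp: Ms_def prod_pos)
      finally have mF: "m \<le> ?F" unfolding card_msg_set[OF fS] .
      have lm: "0 \<le> log 2 m" using m_pos by simp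
      have lF: "log 2 m \<le> log 2 ?F" using mF m_pos by simp
      \<comment> \<open>\<open>sec\<close> forces a positive coefficient, hence it carries over from
        \<open>log 2 m\<close> to the larger entropy of the messages in \<open>S\<close>.\<close>
      have f0: "0 < \<epsilon> - 4 * (real K - 1) * X"
      proof (rule ccontr)
        assume "\<not> ?thesis"
        then have "(\<epsilon> - 4 * (real K - 1) * X) * log 2 m \<le> 0" using lm by (intro mult_nonpos_nonneg) auto
        with sec show False by simp
      qed
      have "1 \<le> (\<epsilon> - 4 * (real K - 1) * X) * log 2 ?F"
        using sec mult_left_mono[OF lF, of "\<epsilon> - 4 * (real K - 1) * X"] f0 by linarith
      moreover have "(\<Sum>w\<in>Msgs. bias w) / card Msgs \<le> (real K - 1) * X"
        unfolding avg_bias by (intro mult_left_mono Db K1)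
      then have "(1 - 4 * ((real K - 1) * X)) * log 2 ?F \<le> (1 - 4 * ((\<Sum>w\<in>Msgs. bias w) / card Msgs)) * log 2 ?F"
        using lF lm by (intro mult_right_mono) auto
      ultimately show ?thesis using H(1) by (simp add: algebra_simps)
    qed
    then show "(1 - \<epsilon>) * prob_space.entropy \<Omega> 2 (count_space (msg_set S Ms)) (\<lambda>\<omega>. restrict (fst \<omega>) S) \<le> ?H"
      unfolding msg_entropy[OF S] .
  qed
  then show ?thesis unfolding Mseq by blast
qed

section \<open>Separation of the linear forms for almost all gains\<close>

text \<open>Tonelli in the single coordinate \<open>j\<close>. The fibre statement is demanded for
  all values of the other coordinates, so degenerate values must be allowed inside
  \<open>Pr\<close>.\<close>

lemma AE_PiM_coordinate:
  fixes Pr :: "('i \<Rightarrow> real) \<Rightarrow> bool"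
  assumes I: "finite I" "j \<in> I"
    and meas: "{g \<in> space (PiM I (\<lambda>_. lborel)). Pr g} \<in> sets (PiM I (\<lambda>_. lborel))"
    and AEx: "\<And>g. AE x in lborel. Pr (g(j := x))"
  shows "AE g in PiM I (\<lambda>_. lborel). Pr g"
proof -
  interpret product_sigma_finite "\<lambda>_::'i. lborel :: real measure" ..
  let ?J = "I - {j}"
  let ?M = "PiM I (\<lambda>_. lborel :: real measure)"
  have I': "insert j ?J = I" using I by auto
  let ?N = "{g \<in> space ?M. \<not> Pr g}"
  have N: "?N \<in> sets ?M" using meas by (rule sets.sets_Collect_neg)
  have "emeasure ?M ?N = (\<integral>\<^sup>+g. indicator ?N g \<partial>?M)" using N by simp
  also have "\<dots> = (\<integral>\<^sup>+g. \<integral>\<^sup>+x. indicator ?N (g(j := x)) \<partial>lborel \<partial>PiM ?J (\<lambda>_. lborel))"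
    using product_nn_integral_insert[of ?J j "indicator ?N"] I N unfolding I' by simp
  also have "\<dots> = (\<integral>\<^sup>+g. 0 \<partial>PiM ?J (\<lambda>_. lborel :: real measure))"
  proof (rule nn_integral_cong)
    fix g :: "'i \<Rightarrow> real"
    have "AE x in lborel. indicator ?N (g(j := x)) = (0 :: ennreal)"
    proof (rule AE_mp[OF AEx[of g]], intro AE_I2 impI)
      fix x assume "Pr (g(j := x))"
      then have "g(j := x) \<notin> ?N" by blast
      then show "indicator ?N (g(j := x)) = (0 :: ennreal)" by (rule indicator_simps(2))
    qed
    then have "(\<integral>\<^sup>+x. indicator ?N (g(j := x)) \<partial>lborel) = (\<integral>\<^sup>+x. 0 \<partial>(lborel :: real measure))"
      by (rule nn_integral_cong_AE)
    then show "(\<integral>\<^sup>+x. indicator ?N (g(j := x)) \<partial>lborel) = 0" by simp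
  qed
  finally have "?N \<in> null_sets ?M" using N by (simp add: null_sets_def)
  then show ?thesis by (rule AE_I') auto
qed

section \<open>Diophantine approximation on dyadic integer boxes\<close>

definition int_box :: "nat \<Rightarrow> nat \<Rightarrow> (nat \<Rightarrow> int) set" where
  "int_box K J = PiE {..<K} (\<lambda>_. {- (2 ^ J) .. 2 ^ J})"

text \<open>The power of 2 is the Dirichlet scale for \<open>K\<close> real coefficients and
  integers up to \<open>2 ^ J\<close>. Of the three factors \<open>Suc J\<close>, one pays for a
  harmonic sum and two make the measures summable over \<open>J\<close>.\<close>

definition sep_eps :: "nat \<Rightarrow> nat \<Rightarrow> real" where
  "sep_eps K J = 1 / (2 ^ (J * (K - 1)) * real (Suc J) ^ 3)"

lemma finite_int_box: "finite (int_box K J)"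
  unfolding int_box_def by (intro finite_PiE) auto

lemma sep_eps_pos: "0 < sep_eps K J"
  by (simp add: sep_eps_def)

text \<open>Harmonic sum by dyadic blocks.\<close>

lemma sum_inverse_abs_le: "(\<Sum>y\<in>{- (2 ^ J) .. (2 ^ J :: int)}. if y = 0 then 0 else 1 / \<bar>real_of_int y\<bar>) \<le> 2 * real (Suc J)"
proof -
  let ?f = "\<lambda>y::int. if y = 0 then 0 else 1 / \<bar>real_of_int y\<bar>"
  have H: "(\<Sum>y\<in>{1..(2 ^ J :: int)}. ?f y) \<le> real (Suc J)"
  proof (induction J)
    case (Suc J)
    have "{1..(2 ^ Suc J :: int)} = {1..2 ^ J} \<union> {2 ^ J + 1..2 ^ Suc J}" by (auto intro: order_trans[of _ "2 ^ J"])
    then have "(\<Sum>y\<in>{1..(2 ^ Suc J :: int)}. ?f y) = (\<Sum>y\<in>{1..(2 ^ J :: int)}. ?f y) + (\<Sum>y\<in>{2 ^ J + 1..(2 ^ Suc J :: int)}. ?f y)"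
      by (simp only:) (rule sum.union_disjoint, auto)
    \<comment> \<open>The block has \<open>2 ^ J\<close> terms, each at most
      \<open>1 / 2 ^ J\<close>, so it adds at most 1.\<close>
    also have "(\<Sum>y\<in>{2 ^ J + 1..(2 ^ Suc J :: int)}. ?f y) \<le> (\<Sum>y\<in>{2 ^ J + 1..(2 ^ Suc J :: int)}. 1 / 2 ^ J)"
    proof (rule sum_mono)
      fix y :: int assume "y \<in> {2 ^ J + 1..2 ^ Suc J}"
      then have y: "2 ^ J \<le> y" "0 < (2::int) ^ J" by auto
      then have "real_of_int (2 ^ J) \<le> real_of_int y" by (subst of_int_le_iff)
      then have "2 ^ J \<le> real_of_int y" by simp
      moreover have "0 < y" using y by linarith
      ultimately show "?f y \<le> 1 / 2 ^ J" by (auto intro!: divide_left_mono)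
    qed
    also have "\<dots> = 1" by simp
    finally show ?case using Suc.IH by simp
  qed simp
  have "{- (2 ^ J) .. (2 ^ J :: int)} = uminus ` {1..2 ^ J} \<union> ({0} \<union> {1..2 ^ J})"
  proof (intro set_eqI iffI)
    fix y :: int assume y: "y \<in> {- (2 ^ J) .. 2 ^ J}"
    show "y \<in> uminus ` {1..2 ^ J} \<union> ({0} \<union> {1..2 ^ J})"
      using y by (cases "y < 0") (auto intro!: image_eqI[of _ _ "- y"])
  next
    fix y :: int assume "y \<in> uminus ` {1..2 ^ J} \<union> ({0} \<union> {1..2 ^ J})"
    moreover have "(0::int) < 2 ^ J" by simp
    ultimately show "y \<in> {- (2 ^ J) .. 2 ^ J}" by auto
  qed
  then have "(\<Sum>y\<in>{- (2 ^ J) .. (2 ^ J :: int)}. ?f y) = (\<Sum>y\<in>uminus ` {1..(2 ^ J :: int)}. ?f y) + (\<Sum>y\<in>{0} \<union> {1..(2 ^ J :: int)}. ?f y)"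
    by (simp only:) (rule sum.union_disjoint, auto)
  also have "(\<Sum>y\<in>uminus ` {1..(2 ^ J :: int)}. ?f y) = (\<Sum>y\<in>{1..(2 ^ J :: int)}. ?f y)"
    by (subst sum.reindex) (auto intro!: sum.cong)
  also have "(\<Sum>y\<in>{0} \<union> {1..(2 ^ J :: int)}. ?f y) = (\<Sum>y\<in>{1..(2 ^ J :: int)}. ?f y)"
    by simp
  finally show ?thesis using H by simp
qed

lemma sum_int_box_inverse:
  assumes "j < K"
  shows "(\<Sum>q\<in>int_box K J. if q j = 0 then 0 else 1 / \<bar>real_of_int (q j)\<bar>) \<le> 4 ^ (K - 1) * 2 ^ (J * (K - 1)) * (2 * real (Suc J))"
proof -
  let ?I = "{- (2 ^ J) .. (2 ^ J :: int)}" and ?R = "{..<K} - {j}"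
  define f :: "int \<Rightarrow> real" where "f y = (if y = 0 then 0 else 1 / \<bar>real_of_int y\<bar>)" for y
  have e: "insert j ?R = {..<K}" using assms by auto
  have "(\<Sum>q\<in>int_box K J. f (q j)) = (\<Sum>q\<in>PiE ?R (\<lambda>_. ?I). \<Sum>y\<in>?I. f y)"
    using sum_PiE_insert[of j ?R "\<lambda>q. f (q j)" "\<lambda>_. ?I"] unfolding e int_box_def by simp
  also have "\<dots> = real (card (PiE ?R (\<lambda>_. ?I))) * (\<Sum>y\<in>?I. f y)" by simp
  also have "\<dots> \<le> (4 ^ (K - 1) * 2 ^ (J * (K - 1))) * (2 * real (Suc J))"
  proof (intro mult_mono)
    have "card ?I \<le> 4 * 2 ^ J"
    proof -
      have "card ?I = nat (2 * 2 ^ J + 1)" by simp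
      also have "\<dots> \<le> nat (4 * 2 ^ J)"
      proof (rule nat_mono)
        have "(1::int) \<le> 2 ^ J" by simp
        then show "2 * 2 ^ J + 1 \<le> (4 * 2 ^ J :: int)" by linarith
      qed
      also have "\<dots> = 4 * 2 ^ J" by (simp add: nat_mult_distrib nat_power_eq)
      finally show ?thesis .
    qed
    then have "card ?I ^ (K - 1) \<le> (4 * 2 ^ J) ^ (K - 1)" by (intro power_mono) auto
    moreover have "card (PiE ?R (\<lambda>_. ?I)) = card ?I ^ (K - 1)"
      using assms by (subst card_PiE) auto
    ultimately have "card (PiE ?R (\<lambda>_. ?I)) \<le> 4 ^ (K - 1) * 2 ^ (J * (K - 1))"
      by (simp only: power_mult_distrib power_mult)
    then have "real (card (PiE ?R (\<lambda>_. ?I))) \<le> real (4 ^ (K - 1) * 2 ^ (J * (K - 1)))"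
      by (rule of_nat_mono)
    then show "real (card (PiE ?R (\<lambda>_. ?I))) \<le> 4 ^ (K - 1) * 2 ^ (J * (K - 1))" by simp
    show "(\<Sum>y\<in>?I. f y) \<le> 2 * real (Suc J)" unfolding f_def by (rule sum_inverse_abs_le)
    show "0 \<le> (\<Sum>y\<in>?I. f y)" by (intro sum_nonneg) (simp add: f_def)
  qed auto
  finally show ?thesis unfolding f_def .
qed

lemma emeasure_affine_small:
  assumes "\<alpha> \<noteq> (0::real)" "0 \<le> \<epsilon>"
  shows "{x. \<bar>x * \<alpha> + c\<bar> < \<epsilon>} \<in> sets lborel" "emeasure lborel {x. \<bar>x * \<alpha> + c\<bar> < \<epsilon>} = ennreal (2 * \<epsilon> / \<bar>\<alpha>\<bar>)"
proof -
  have eq: "{x. \<bar>x * \<alpha> + c\<bar> < \<epsilon>} = {- c / \<alpha> - \<epsilon> / \<bar>\<alpha>\<bar> <..< - c / \<alpha> + \<epsilon> / \<bar>\<alpha>\<bar>}"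
  proof (intro set_eqI)
    fix x
    have "\<bar>x * \<alpha> + c\<bar> = \<bar>\<alpha>\<bar> * \<bar>x + c / \<alpha>\<bar>"
    proof -
      have "\<bar>\<alpha>\<bar> * \<bar>x + c / \<alpha>\<bar> = \<bar>\<alpha> * (x + c / \<alpha>)\<bar>" by (rule abs_mult[symmetric])
      also have "\<alpha> * (x + c / \<alpha>) = x * \<alpha> + c" using assms(1) by (simp add: distrib_left)
      finally show ?thesis ..
    qed
    then have "\<bar>x * \<alpha> + c\<bar> < \<epsilon> \<longleftrightarrow> \<bar>x + c / \<alpha>\<bar> < \<epsilon> / \<bar>\<alpha>\<bar>"
      using assms(1) by (simp add: pos_less_divide_eq mult.commute)
    then show "x \<in> {x. \<bar>x * \<alpha> + c\<bar> < \<epsilon>} \<longleftrightarrow> x \<in> {- c / \<alpha> - \<epsilon> / \<bar>\<alpha>\<bar> <..< - c / \<alpha> + \<epsilon> / \<bar>\<alpha>\<bar>}"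
      by (auto simp: abs_less_iff)
  qed
  show "{x. \<bar>x * \<alpha> + c\<bar> < \<epsilon>} \<in> sets lborel" unfolding eq by simp
  have "0 \<le> \<epsilon> / \<bar>\<alpha>\<bar>" using assms by simp
  then show "emeasure lborel {x. \<bar>x * \<alpha> + c\<bar> < \<epsilon>} = ennreal (2 * \<epsilon> / \<bar>\<alpha>\<bar>)"
    unfolding eq by (subst emeasure_lborel_Ioo) auto
qed

text \<open>Khinchin--Groshev, convergence case, in one variable: the bound on the bad sets is summable
  because the volume of the integer box grows like the reciprocal of \<open>sep_eps\<close>, up to \<open>(J + 1) ^ 2\<close>.\<close>
lemma AE_linear_form_separated:
  fixes C :: "(nat \<Rightarrow> int) \<Rightarrow> real"
  assumes j: "j < K" and b: "b \<noteq> (0::real)"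
  shows "AE x in lborel. \<forall>\<^sub>F J in sequentially. \<forall>q\<in>int_box K J. q j \<noteq> 0 \<longrightarrow>
     sep_eps K J \<le> \<bar>x / b * real_of_int (q j) + C q\<bar>"
proof -
  define A where "A J q = {x::real. \<bar>x * (of_int (q j) / b) + C q\<bar> < sep_eps K J}" for J and q :: "nat \<Rightarrow> int"
  define Q where "Q J = {q \<in> int_box K J. q j \<noteq> 0}" for J
  \<comment> \<open>For fixed \<open>q\<close> the bad \<open>x\<close> form an interval whose
    length is inversely proportional to \<open>|q j|\<close>; this is where the harmonic sum over
    the box comes from.\<close>
  define Bad where "Bad J = (\<Union>q\<in>Q J. A J q)" for J
  have fQ: "finite (Q J)" for J unfolding Q_def using finite_int_box by simp
  have A: "A J q \<in> sets lborel" "emeasure lborel (A J q) = ennreal (2 * sep_eps K J * \<bar>b\<bar> / \<bar>real_of_int (q j)\<bar>)" if "q \<in> Q J" for J q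
  proof -
    have "of_int (q j) / b \<noteq> 0" using that b by (simp add: Q_def)
    note * = emeasure_affine_small[OF this less_imp_le[OF sep_eps_pos], of "C q" K J]
    show "A J q \<in> sets lborel" unfolding A_def by (rule *(1))
    show "emeasure lborel (A J q) = ennreal (2 * sep_eps K J * \<bar>b\<bar> / \<bar>real_of_int (q j)\<bar>)"
      unfolding A_def *(2) using b by (simp add: abs_divide)
  qed
  have Bs: "Bad J \<in> sets lborel" for J
    unfolding Bad_def using fQ A by (intro sets.finite_UN) auto
  have Bm: "emeasure lborel (Bad J) \<le> ennreal (4 * \<bar>b\<bar> * 4 ^ (K - 1) * (1 / (real (Suc J))\<^sup>2))" for J
  proof -
    have "emeasure lborel (Bad J) \<le> (\<Sum>q\<in>Q J. emeasure lborel (A J q))"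
      unfolding Bad_def using fQ A by (intro emeasure_subadditive_finite) auto
    also have "\<dots> = (\<Sum>q\<in>Q J. ennreal (2 * sep_eps K J * \<bar>b\<bar> / \<bar>real_of_int (q j)\<bar>))"
      by (intro sum.cong refl A(2))
    also have "\<dots> = ennreal (\<Sum>q\<in>Q J. 2 * sep_eps K J * \<bar>b\<bar> / \<bar>real_of_int (q j)\<bar>)"
      using sep_eps_pos[of K J] by (intro sum_ennreal) auto
    also have "(\<Sum>q\<in>Q J. 2 * sep_eps K J * \<bar>b\<bar> / \<bar>real_of_int (q j)\<bar>)
        = (\<Sum>q\<in>int_box K J. 2 * sep_eps K J * \<bar>b\<bar> * (if q j = 0 then 0 else 1 / \<bar>real_of_int (q j)\<bar>))"
      unfolding Q_def by (rule sum.mono_neutral_cong_left) (auto simp: finite_int_box)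
    also have "\<dots> = 2 * sep_eps K J * \<bar>b\<bar> * (\<Sum>q\<in>int_box K J. if q j = 0 then 0 else 1 / \<bar>real_of_int (q j)\<bar>)"
      by (rule sum_distrib_left[symmetric])
    also have "\<dots> \<le> 2 * sep_eps K J * \<bar>b\<bar> * (4 ^ (K - 1) * 2 ^ (J * (K - 1)) * (2 * real (Suc J)))"
      using sep_eps_pos[of K J] by (intro mult_left_mono sum_int_box_inverse j) auto
    also have "\<dots> = 4 * \<bar>b\<bar> * 4 ^ (K - 1) * (1 / (real (Suc J))\<^sup>2)"
      by (simp add: sep_eps_def power2_eq_square power3_eq_cube divide_simps)
    finally show ?thesis by (simp add: ennreal_leI)
  qed
  have "AE x in lborel. \<forall>\<^sub>F J in sequentially. x \<in> space lborel - Bad J"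
  proof (rule borel_cantelli_AE1[OF Bs])
    show fin: "emeasure lborel (Bad J) < \<infinity>" for J by (rule le_less_trans[OF Bm[of J]]) simp
    have le: "measure lborel (Bad J) \<le> 4 * \<bar>b\<bar> * 4 ^ (K - 1) * (1 / (real (Suc J))\<^sup>2)" for J
      unfolding measure_def by (rule enn2real_leI[OF _ Bm[of J]]) simp
    have "summable (\<lambda>J. 1 / (real (Suc J))\<^sup>2)"
      using inverse_power_summable[of 2, where 'a=real] by (subst summable_Suc_iff) (simp add: inverse_eq_divide)
    then have sm: "summable (\<lambda>J. 4 * \<bar>b\<bar> * 4 ^ (K - 1) * (1 / (real (Suc J))\<^sup>2))" by (rule summable_mult)
    show "summable (\<lambda>J. measure lborel (Bad J))"
    proof (rule summable_comparison_test'[OF sm, of 0])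
      show "norm (measure lborel (Bad J)) \<le> 4 * \<bar>b\<bar> * 4 ^ (K - 1) * (1 / (real (Suc J))\<^sup>2)" for J
        unfolding real_norm_def abs_of_nonneg[OF measure_nonneg] by (rule le)
    qed
  qed
  then show ?thesis
  proof eventually_elim
    case (elim x)
    then show ?case
    proof eventually_elim
      case (elim J)
      show ?case
      proof (intro ballI impI)
        fix q assume "q \<in> int_box K J" "q j \<noteq> 0"
        then have "x \<notin> A J q" using elim by (auto simp: Bad_def Q_def)
        then show "sep_eps K J \<le> \<bar>x / b * real_of_int (q j) + C q\<bar>" by (simp add: A_def not_less)
      qed
    qed
  qed
qed

text \<open>A nonzero \<open>q\<close> has some nonzero coordinate \<open>j\<close>, and varying
  only the gain \<open>g j\<close> reduces the claim to one variable. Finitely many \<open>j\<close>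
  are then combined.\<close>

lemma AE_channel_separated:
  "AE g in PiM {..<2 * K} (\<lambda>_. lborel). (\<forall>k<K. g (K + k) \<noteq> (0::real)) \<and>
     (\<forall>\<^sub>F J in sequentially. \<forall>q\<in>int_box K J. (\<exists>k<K. q k \<noteq> 0) \<longrightarrow>
        sep_eps K J \<le> \<bar>\<Sum>k<K. g k / g (K + k) * real_of_int (q k)\<bar>)"
proof -
  let ?M = "PiM {..<2 * K} (\<lambda>_. lborel :: real measure)"
  have comp: "(\<lambda>g. g i) \<in> borel_measurable ?M" if "i < 2 * K" for i
    using measurable_component_singleton[of i "{..<2 * K}" "\<lambda>_. lborel :: real measure"] that by simp
  have nz: "AE g in ?M. g (K + k) \<noteq> 0" if k: "k < K" for k
  proof (rule AE_PiM_coordinate[of _ "K + k"])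
    show "{g \<in> space ?M. g (K + k) \<noteq> 0} \<in> sets ?M"
      using comp[of "K + k"] k by (intro borel_measurable_neq) auto
    show "AE x in lborel. (g(K + k := x)) (K + k) \<noteq> 0" for g :: "nat \<Rightarrow> real"
      using AE_lborel_singleton[of "0::real"] by simp
  qed (use k in auto)
  \<comment> \<open>The disjunct \<open>g (K + j) = 0\<close> makes the fibre statement true for
    every choice of the other gains; it is discarded through \<open>nz\<close> at the end.\<close>
  define Pr where "Pr j g \<longleftrightarrow> g (K + j) = 0 \<or> (\<forall>\<^sub>F J in sequentially. \<forall>q\<in>int_box K J. q j \<noteq> 0 \<longrightarrow>
        sep_eps K J \<le> \<bar>\<Sum>k<K. g k / g (K + k) * real_of_int (q k)\<bar>)" for j and g :: "nat \<Rightarrow> real"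
  have sep: "AE g in ?M. Pr j g" if j: "j < K" for j
  proof (rule AE_PiM_coordinate[of _ j])
    have m1: "{g \<in> space ?M. sep_eps K J \<le> \<bar>\<Sum>k<K. g k / g (K + k) * real_of_int (q k)\<bar>} \<in> sets ?M" for J and q :: "nat \<Rightarrow> int"
    proof -
      have "(\<lambda>g. \<Sum>k<K. g k / g (K + k) * real_of_int (q k)) \<in> borel_measurable ?M"
        by (intro borel_measurable_sum borel_measurable_times borel_measurable_divide comp borel_measurable_const) auto
      then show ?thesis by (intro borel_measurable_le borel_measurable_abs borel_measurable_const)
    qed
    have m0: "{g \<in> space ?M. g (K + j) = 0} \<in> sets ?M"
      using comp[of "K + j"] j by (intro borel_measurable_eq) auto
    have m2: "{g \<in> space ?M. q j \<noteq> 0 \<longrightarrow> sep_eps K J \<le> \<bar>\<Sum>k<K. g k / g (K + k) * real_of_int (q k)\<bar>} \<in> sets ?M" for J q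
      using m1 by (cases "q j = 0") auto
    have m3: "{g \<in> space ?M. \<forall>q\<in>int_box K J. q j \<noteq> 0 \<longrightarrow> sep_eps K J \<le> \<bar>\<Sum>k<K. g k / g (K + k) * real_of_int (q k)\<bar>} \<in> sets ?M" for J
      by (intro sets.sets_Collect_finite_All finite_int_box m2)
    have m4: "{g \<in> space ?M. N \<le> J \<longrightarrow> (\<forall>q\<in>int_box K J. q j \<noteq> 0 \<longrightarrow> sep_eps K J \<le> \<bar>\<Sum>k<K. g k / g (K + k) * real_of_int (q k)\<bar>)} \<in> sets ?M" for N J
      using m3[of J] by (cases "N \<le> J") simp_all
    show "{g \<in> space ?M. Pr j g} \<in> sets ?M"
      unfolding Pr_def eventually_sequentially
      by (intro sets.sets_Collect_disj m0 sets.sets_Collect_countable_Ex sets.sets_Collect_countable_All m4)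
  next
    fix g :: "nat \<Rightarrow> real"
    show "AE x in lborel. Pr j (g(j := x))"
    proof (cases "g (K + j) = 0")
      case True
      then show ?thesis using j by (simp add: Pr_def)
    next
      case False
      \<comment> \<open>The part of the form that stays constant when \<open>g j\<close> varies:
        \<open>j\<close> is left out, and the denominators have indices from \<open>K\<close>
        on.\<close>
      define C where "C q = (\<Sum>k\<in>{..<K} - {j}. g k / g (K + k) * real_of_int (q k))" for q
      have "(\<Sum>k<K. (g(j := x)) k / (g(j := x)) (K + k) * real_of_int (q k)) = x / g (K + j) * real_of_int (q j) + C q" for x :: real and q :: "nat \<Rightarrow> int"
      proof -
        have "(\<Sum>k<K. (g(j := x)) k / (g(j := x)) (K + k) * real_of_int (q k))
          = (g(j := x)) j / (g(j := x)) (K + j) * real_of_int (q j) + (\<Sum>k\<in>{..<K} - {j}. (g(j := x)) k / (g(j := x)) (K + k) * real_of_int (q k))"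
          by (rule sum.remove) (use j in auto)
        also have "(\<Sum>k\<in>{..<K} - {j}. (g(j := x)) k / (g(j := x)) (K + k) * real_of_int (q k)) = C q"
          unfolding C_def using j by (intro sum.cong refl) auto
        finally show ?thesis using j by simp
      qed
      then show ?thesis unfolding Pr_def
        using AE_linear_form_separated[OF j False, of C] by (auto elim!: eventually_mono)
    qed
  qed (use j in auto)
  have "AE g in ?M. (\<forall>k\<in>{..<K}. g (K + k) \<noteq> 0) \<and> (\<forall>j\<in>{..<K}. Pr j g)"
    using nz sep by (auto simp: AE_finite_all intro!: AE_conjI)
  then show ?thesis
  proof eventually_elim
    case (elim g)
    have "\<forall>\<^sub>F J in sequentially. \<forall>j\<in>{..<K}. \<forall>q\<in>int_box K J. q j \<noteq> 0 \<longrightarrow>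
        sep_eps K J \<le> \<bar>\<Sum>k<K. g k / g (K + k) * real_of_int (q k)\<bar>"
      using elim by (intro eventually_ball_finite) (auto simp: Pr_def)
    then have "\<forall>\<^sub>F J in sequentially. \<forall>q\<in>int_box K J. (\<exists>k<K. q k \<noteq> 0) \<longrightarrow>
        sep_eps K J \<le> \<bar>\<Sum>k<K. g k / g (K + k) * real_of_int (q k)\<bar>"
      by eventually_elim auto
    with elim show ?case by auto
  qed
qed

section \<open>Achievable rates\<close>

lemma (in mac_scheme) law_nonneg: "0 \<le> law g w A"
  unfolding law_def by (intro divide_nonneg_nonneg sum_nonneg gauss_shift_nonneg prod_nonneg) auto

lemma (in mac_scheme) law_le_1: "law g w A \<le> 1"
proof -
  have "(\<Sum>l\<in>Rands. gauss_shift n (comb g w l) A) \<le> (\<Sum>l\<in>Rands. 1)"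
    by (intro sum_mono gauss_shift_le_1)
  then show ?thesis unfolding law_def using prod_L_pos card_Rands by simp
qed

text \<open>Rate zero is achievable at every power; this covers the small powers at which the
  aligned scheme does not apply.\<close>

lemma trivial_secret_code:
  assumes "0 \<le> P" "0 \<le> \<epsilon>"
  shows "\<exists>f \<phi>. secret_code K n (\<lambda>_. 1) P h he f \<phi> \<epsilon>"
proof -
  interpret mac_scheme K n "\<lambda>_. 1" "\<lambda>_. 1" "\<lambda>_ _ _ _. 0" by standard simp_all
  define w0 :: "nat \<Rightarrow> nat" where "w0 = (\<lambda>k\<in>{..<K}. 0)"
  have W: "w = w0" if "w \<in> Msgs" for w
    using that by (auto simp: msg_set_def w0_def fun_eq_iff PiE_iff extensional_def)
  have "secret_code K n (\<lambda>_. 1) P h he enc (\<lambda>_. w0) \<epsilon>"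
    unfolding secret_code_def
  proof (intro conjI allI impI)
    show "enc k w \<in> lborel \<rightarrow>\<^sub>M sig_space n" for k w by (rule enc_measurable)
    show "(\<lambda>_. w0) \<in> sig_space n \<rightarrow>\<^sub>M count_space UNIV" by simp
    show "(\<integral>\<^sup>+\<omega>. ennreal ((\<Sum>t<n. (tx n enc k \<omega> t)\<^sup>2) / real n) \<partial>\<Omega>) \<le> ennreal P" if "k < K" for k
      by (rule power_constraint[OF _ that]) (use assms in simp)
    have E: "{\<omega> \<in> space \<Omega>. w0 \<noteq> fst \<omega>} = {}" using W[OF fst_\<Omega>] by blast
    show "measure \<Omega> {\<omega> \<in> space \<Omega>. w0 \<noteq> fst \<omega>} \<le> \<epsilon>" unfolding E using assms by simp
    fix S assume S: "S \<subseteq> {..<K}"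
    have dd: "law he w A - law he w' A \<le> 1 + 1" for w w' A
      using law_le_1[of he w A] law_nonneg[of he w' A] by linarith
    have H: "0 \<le> prob_space.conditional_entropy \<Omega> 2 (count_space (msg_set S (\<lambda>_. 1))) (sig_space n)
          (\<lambda>\<omega>. restrict (fst \<omega>) S) (rx_Z K n he enc)"
      by (rule equivocation(2)[OF S, where d = "\<lambda>_. 1"]) (rule dd)
    have F: "card (msg_set S (\<lambda>_. 1)) = 1" using finite_subset[OF S] by (simp add: card_msg_set)
    show "(1 - \<epsilon>) * prob_space.entropy \<Omega> 2 (count_space (msg_set S (\<lambda>_. 1))) (\<lambda>\<omega>. restrict (fst \<omega>) S)
      \<le> prob_space.conditional_entropy \<Omega> 2 (count_space (msg_set S (\<lambda>_. 1))) (sig_space n)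
          (\<lambda>\<omega>. restrict (fst \<omega>) S) (rx_Z K n he enc)"
      unfolding msg_entropy[OF S] F using H by simp
  qed
  then show ?thesis by blast
qed

lemma achievable_secure_zero:
  assumes "0 \<le> P"
  shows "achievable_secure K P h he (\<lambda>_. 0)"
  unfolding achievable_secure_def using trivial_secret_code[OF assms] by (auto intro: less_imp_le)

text \<open>One fixed power. Threshold \<open>2 ^ (2 * s)\<close> and outlier fraction
  \<open>1 / s\<close> turn into the conditions \<open>scale\<close> and \<open>R\<close>: in the
  latter, \<open>2 * J / s\<close> is the cost of Hamming radius \<open>2 * (n div s)\<close>, and 6
  is 4 bits of randomization, 1 for the Hamming ball and 1 for decay.\<close>

lemma achievable_secure_aligned:
  fixes K J s :: nat and P \<mu> R :: real and h he :: "nat \<Rightarrow> real"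
  assumes K: "0 < K" and he_nz: "\<And>k. k < K \<Longrightarrow> he k \<noteq> 0"
    and \<mu>: "0 \<le> \<mu>" "\<And>k. k < K \<Longrightarrow> \<mu> \<le> \<bar>he k\<bar>" and P: "0 \<le> P" and s: "1 \<le> s"
    and sep: "\<And>q. q \<in> int_box K J \<Longrightarrow> \<exists>k<K. q k \<noteq> 0 \<Longrightarrow> sep_eps K J \<le> \<bar>\<Sum>k<K. h k / he k * real_of_int (q k)\<bar>"
    and scale: "2 * 2 ^ (2 * s) \<le> sqrt P * \<mu> / 2 ^ J * sep_eps K J"
    and R: "0 < R" "R + 6 + 2 * J / s \<le> J"
  shows "achievable_secure K P h he (\<lambda>k. if k = 0 then 0 else R)"
proof -
  \<comment> \<open>Alignment demands one common amplitude; the lower bound \<open>\<mu>\<close> on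
    the gains lets every user meet its power constraint with it.\<close>
  define a where "a = sqrt P * \<mu> / 2 ^ J"
  have a0: "0 \<le> a" using \<mu> P by (simp add: a_def)
  have aQ: "a * real (2 ^ J) \<le> sqrt P * \<bar>he k\<bar>" if "k < K" for k
    using \<mu>(2)[OF that] P by (simp add: a_def mult_left_mono)
  have separated: "2 * 2 ^ (2 * s) \<le> \<bar>\<Sum>k<K. h k * (a / he k * real (x k)) - h k * (a / he k * real (x' k))\<bar>"
    if x: "\<And>k. k < K \<Longrightarrow> x k < 2 ^ J" "\<And>k. k < K \<Longrightarrow> x' k < 2 ^ J" "\<exists>k<K. x k \<noteq> x' k" for x x' :: "nat \<Rightarrow> nat"
  proof -
    \<comment> \<open>Differences of two inputs below \<open>2 ^ J\<close> lie in the box, and the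
      received difference is \<open>a\<close> times the linear form at \<open>q\<close>.\<close>
    define q where "q = (\<lambda>k\<in>{..<K}. int (x k) - int (x' k))"
    have "q \<in> int_box K J"
    proof -
      have "int (x k) < 2 ^ J" "int (x' k) < 2 ^ J" if "k < K" for k
        using x(1,2)[OF that] by (metis of_nat_less_iff of_nat_numeral of_nat_power)+
      then show ?thesis unfolding int_box_def q_def by (auto intro!: less_imp_le simp: algebra_simps; smt (verit) of_nat_0_le_iff)
    qed
    moreover have "\<exists>k<K. q k \<noteq> 0" using x(3) by (auto simp: q_def)
    ultimately have "a * sep_eps K J \<le> a * \<bar>\<Sum>k<K. h k / he k * real_of_int (q k)\<bar>"
      using a0 by (intro mult_left_mono sep)
    also have "\<dots> = \<bar>a * (\<Sum>k<K. h k / he k * real_of_int (q k))\<bar>" using a0 by (simp add: abs_mult)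
    also have "a * (\<Sum>k<K. h k / he k * real_of_int (q k)) = (\<Sum>k<K. h k * (a / he k * real (x k)) - h k * (a / he k * real (x' k)))"
      unfolding sum_distrib_left by (intro sum.cong refl) (simp add: q_def algebra_simps)
    finally show ?thesis using scale unfolding a_def by linarith
  qed
  define m where "m n = nat \<lceil>2 powr (real n * R)\<rceil>" for n :: nat
  have m1: "2 powr (real n * R) \<le> real (m n)" for n unfolding m_def by linarith
  have m2: "real (m n) \<le> 2 * 2 powr (real n * R)" for n
  proof -
    have "1 \<le> 2 powr (real n * R)" using R(1) by (intro ge_one_powr_ge_zero) auto
    moreover have "real (m n) \<le> 2 powr (real n * R) + 1" unfolding m_def using powr_ge_zero[of 2 "real n * R"] by linarith
    ultimately show ?thesis by linarith
  qed
  have mpos: "0 < m n" for n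
  proof -
    have "0 < 2 powr (real n * R)" by simp
    then have "0 < real (m n)" using m1[of n] by linarith
    then show ?thesis by simp
  qed
  have mlog: "real n * R \<le> log 2 (m n)" for n
    using m1[of n] mpos[of n] by (simp add: le_log_iff)
  \<comment> \<open>One unit is the bias; the other two are the conflict term, doubled by the
    rounding up in \<open>m n\<close>.\<close>
  define X :: "nat \<Rightarrow> real" where "X n = 3 / 2 ^ n" for n :: nat
  define \<beta> :: "nat \<Rightarrow> real" where "\<beta> n = 2 ^ (4 * s) / 2 ^ n" for n :: nat
  have noise: "measure (noise_space n) {x \<in> space (noise_space n). n div s < outliers n (2 ^ (2 * s)) x} \<le> \<beta> n" for n
  proof -
    have "measure (noise_space n) {x \<in> space (noise_space n). n div s < outliers n (2 ^ (2 * s)) x} \<le> 2 ^ n * (1 / 2 ^ (4 * s)) ^ (n div s)"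
    proof (rule noise_outliers)
      have "1 / (2 ^ (2 * s))\<^sup>2 = (1 / 2 ^ (4 * s) :: real)" by (simp add: power_mult[symmetric])
      then show "measure (density lborel std_normal_density) {x. 2 ^ (2 * s) \<le> \<bar>x\<bar>} \<le> 1 / 2 ^ (4 * s)"
        using std_normal_tail[of "2 ^ (2 * s)"] by simp
    qed simp
    also have "\<dots> \<le> \<beta> n"
    proof -
      \<comment> \<open>Each outlier has probability at most \<open>2 powr (- 4 * s)\<close>, and
        about \<open>n / s\<close> of them occur, which beats the \<open>2 ^ n\<close> position
        sets. The constant \<open>2 ^ (4 * s)\<close> covers the rounding in
        \<open>n div s\<close>.\<close>
      have "n < s * Suc (n div s)" using s dividend_less_times_div[of s n] by simp
      then have "2 * n \<le> 4 * s * Suc (n div s)" by (simp add: algebra_simps)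
      then have "(2::real) ^ (2 * n) \<le> 2 ^ (4 * s * Suc (n div s))" by (intro power_increasing) auto
      also have "\<dots> = (2 ^ (4 * s)) ^ Suc (n div s)" by (rule power_mult)
      also have "\<dots> = 2 ^ (4 * s) * (2 ^ (4 * s)) ^ (n div s)" by (rule power_Suc)
      finally have "2 ^ n * (2::real) ^ n \<le> 2 ^ (4 * s) * (2 ^ (4 * s)) ^ (n div s)" by (simp add: mult_2 power_add)
      then show ?thesis by (simp add: \<beta>_def power_divide field_simps)
    qed
    finally show ?thesis .
  qed
  have Xb: "1 / 2 ^ n + real (m n) * 32 ^ n * real (2 ^ J) ^ (2 * (n div s)) / real (2 ^ J) ^ n \<le> X n" for n
  proof -
    have "s * (n div s) \<le> n" by simp
    then have "real s * real (n div s) \<le> real n" by (metis of_nat_le_iff of_nat_mult)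
    then have "real (n div s) \<le> real n / real s" using s by (simp add: field_simps)
    then have "2 * real J * real (n div s) \<le> 2 * real J * (real n / real s)" by (intro mult_left_mono) auto
    moreover have "real n * (R + 6 + 2 * J / s) \<le> real n * J" using R(2) by (intro mult_left_mono) auto
    ultimately have "real n * R + 6 * real n + 2 * real J * real (n div s) \<le> real n * J"
      by (simp add: algebra_simps)
    then have "2 powr (real n * R + 6 * real n + 2 * real J * real (n div s)) \<le> 2 powr (real n * J)"
      by (intro powr_mono) auto
    moreover have "2 powr (6 * real n) = (2::real) ^ (6 * n)" by (subst powr_realpow[symmetric]) auto
    moreover have "2 powr (2 * real J * real (n div s)) = (2::real) ^ (2 * J * (n div s))" by (subst powr_realpow[symmetric]) auto
    moreover have "2 powr (real n * J) = (2::real) ^ (n * J)" by (subst powr_realpow[symmetric]) auto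
    ultimately have le: "2 powr (real n * R) * 2 ^ (6 * n) * 2 ^ (2 * J * (n div s)) \<le> 2 ^ (n * J)"
      by (simp add: powr_add)
    have "real (m n) * 32 ^ n * real (2 ^ J) ^ (2 * (n div s)) \<le> 2 * 2 powr (real n * R) * 32 ^ n * real (2 ^ J) ^ (2 * (n div s))"
      by (intro mult_right_mono m2) auto
    also have "\<dots> = 2 * (2 powr (real n * R) * 2 ^ (6 * n) * 2 ^ (2 * J * (n div s))) / 2 ^ n"
    proof -
      have "(2::real) ^ (6 * n) = 32 ^ n * 2 ^ n" using power_mult[of "2::real" 6 n] power_mult_distrib[of "32::real" 2 n] by simp
      moreover have "real (2 ^ J) ^ (2 * (n div s)) = 2 ^ (2 * J * (n div s))"
        by (simp add: power_mult[symmetric] mult.assoc mult.left_commute)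
      ultimately show ?thesis by simp
    qed
    also have "\<dots> \<le> 2 * 2 ^ (n * J) / 2 ^ n" using le by (intro divide_right_mono mult_left_mono) auto
    finally have "real (m n) * 32 ^ n * real (2 ^ J) ^ (2 * (n div s)) / real (2 ^ J) ^ n \<le> 2 * 2 ^ (n * J) / 2 ^ n / real (2 ^ J) ^ n"
      by (rule divide_right_mono) simp
    also have "\<dots> = 2 / 2 ^ n"
      by (simp add: power_mult[symmetric] mult.commute)
    finally show ?thesis by (simp add: X_def)
  qed
  show ?thesis
    unfolding achievable_secure_def
  proof (intro conjI allI impI)
    show "0 \<le> (if k = 0 then 0 else R)" for k :: nat using R by simp
    fix \<epsilon> :: real assume \<epsilon>: "0 < \<epsilon>"
    have z: "(\<lambda>n. 1 / 2 ^ n) \<longlonglongrightarrow> (0::real)"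
      using LIMSEQ_realpow_zero[of "1 / 2 :: real"] by (simp add: power_one_over)
    have "(\<lambda>n. (2 ^ (4 * s) + (real K - 1) * 3) * (1 / 2 ^ n)) \<longlonglongrightarrow> (2 ^ (4 * s) + (real K - 1) * 3) * 0"
      by (intro tendsto_mult tendsto_const z)
    then have "\<forall>\<^sub>F n in sequentially. (2 ^ (4 * s) + (real K - 1) * 3) * (1 / 2 ^ n) < \<epsilon>"
      using \<epsilon> by (intro order_tendstoD) auto
    moreover have "(\<lambda>n. (12 * (real K - 1)) * (1 / 2 ^ n)) \<longlonglongrightarrow> (12 * (real K - 1)) * 0"
      by (intro tendsto_mult tendsto_const z)
    then have "\<forall>\<^sub>F n in sequentially. (12 * (real K - 1)) * (1 / 2 ^ n) < \<epsilon> / 2"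
      using \<epsilon> by (intro order_tendstoD) auto
    \<comment> \<open>Makes \<open>log 2 (m n)\<close> at least \<open>2 / \<epsilon>\<close>, so
      the half of \<open>\<epsilon>\<close> that the bias leaves over pays for the lost bit.\<close>
    moreover have "\<forall>\<^sub>F n in sequentially. 2 / \<epsilon> / R \<le> real n"
      by (rule eventually_nat_real) (rule eventually_ge_at_top)
    ultimately have "\<forall>\<^sub>F n in sequentially. \<exists>f \<phi>. secret_code K n (\<lambda>k. if k = 0 then 1 else m n) P h he f \<phi> \<epsilon>"
    proof eventually_elim
      case (elim n)
      define z :: real where "z = 1 / 2 ^ n"
      have \<beta>z: "\<beta> n = 2 ^ (4 * s) * z" and Xz: "X n = 3 * z" by (simp_all add: \<beta>_def X_def z_def)
      have err: "\<beta> n + (real K - 1) * X n \<le> \<epsilon>"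
        using elim(1) unfolding \<beta>z Xz z_def[symmetric] by (simp add: algebra_simps)
      have half: "\<epsilon> / 2 \<le> \<epsilon> - 4 * (real K - 1) * X n"
        using elim(2) unfolding Xz z_def[symmetric] by (simp add: algebra_simps)
      have "2 / \<epsilon> \<le> real n * R" using elim(3) R(1) by (simp only: pos_divide_le_eq)
      then have "2 / \<epsilon> \<le> log 2 (m n)" using mlog[of n] by linarith
      then have "\<epsilon> / 2 * (2 / \<epsilon>) \<le> (\<epsilon> - 4 * (real K - 1) * X n) * log 2 (m n)"
        using half \<epsilon> by (intro mult_mono) auto
      then have sec: "1 \<le> (\<epsilon> - 4 * (real K - 1) * X n) * log 2 (m n)" using \<epsilon> by simp
      show ?case
        by (rule aligned_secret_code[OF K _ mpos he_nz separated aQ a0 P noise Xb err sec]) auto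
    qed
    moreover have "(\<lambda>k::nat. nat \<lceil>2 powr (real n * (if k = 0 then 0 else R))\<rceil>) = (\<lambda>k. if k = 0 then 1 else m n)" for n
      by (auto simp: m_def)
    ultimately show "\<exists>N. \<forall>n\<ge>N. \<exists>f \<phi>. secret_code K n (\<lambda>k. nat \<lceil>2 powr (real n * (if k = 0 then 0 else R))\<rceil>) P h he f \<phi> \<epsilon>"
      by (simp only: eventually_sequentially)
  qed
qed

text \<open>With x half the binary logarithm of the power, \<open>K * J + 2 * s\<close> plus
  logarithmic terms must stay below x. Separation holds for all large \<open>J\<close> and
  \<open>Js\<close> tends to infinity, so every large power is covered, as the limit
  demands.\<close>

lemma sdof_achievable_aligned:
  fixes K :: nat and h he :: "nat \<Rightarrow> real"
  assumes K: "K \<ge> 2" and he_nz: "\<And>k. k < K \<Longrightarrow> he k \<noteq> 0"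
    and sep: "\<forall>\<^sub>F J in sequentially. \<forall>q\<in>int_box K J. (\<exists>k<K. q k \<noteq> 0) \<longrightarrow>
        sep_eps K J \<le> \<bar>\<Sum>k<K. h k / he k * real_of_int (q k)\<bar>"
  shows "sdof_achievable K h he ((real K - 1) / real K)"
proof -
  define \<mu> where "\<mu> = Min ((\<lambda>k. \<bar>he k\<bar>) ` {..<K})"
  have \<mu>: "0 < \<mu>" unfolding \<mu>_def using he_nz K by (subst Min_gr_iff) (auto simp: lessThan_empty_iff)
  have \<mu>_le: "\<mu> \<le> \<bar>he k\<bar>" if "k < K" for k unfolding \<mu>_def using that by (intro Min_le) auto
  define \<kappa> where "\<kappa> = real K"
  have \<kappa>: "2 \<le> \<kappa>" using K by (simp add: \<kappa>_def)
  define L where "L P = 1 / 2 * log 2 P" for P :: real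
  \<comment> \<open>From \<open>J \<ge> x / \<kappa> - 2 * sqrt x - 1\<close> subtract the 6 bits
    and at most \<open>sqrt x\<close> for the Hamming radius; the coefficient 4 leaves room.\<close>
  define rate where "rate x = x / \<kappa> - 4 * sqrt x - 7" for x
  \<comment> \<open>Lowering \<open>J\<close> by \<open>2 * sqrt x\<close> lowers
    \<open>\<kappa> * J\<close> by at least \<open>4 * sqrt x\<close>, since
    \<open>\<kappa> \<ge> 2\<close>. This margin pays for the noise threshold and the logarithmic
    terms in \<open>ev_scale\<close>.\<close>
  define Js where "Js x = nat \<lfloor>x / \<kappa> - 2 * sqrt x\<rfloor>" for x
  have LP: "filterlim L at_top at_top" unfolding L_def by real_asymp
  have "filterlim (\<lambda>x. x / \<kappa> - 2 * sqrt x) at_top at_top" using \<kappa> by real_asymp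
  then have "filterlim Js at_top at_top"
    unfolding Js_def
    by (intro filterlim_compose[OF filterlim_nat_sequentially] filterlim_compose[OF filterlim_floor_sequentially])
  then have ev_sep: "\<forall>\<^sub>F x in at_top. \<forall>q\<in>int_box K (Js x). (\<exists>k<K. q k \<noteq> 0) \<longrightarrow>
        sep_eps K (Js x) \<le> \<bar>\<Sum>k<K. h k / he k * real_of_int (q k)\<bar>"
    using sep by (rule eventually_compose_filterlim[rotated])
  have ev_rate: "\<forall>\<^sub>F x in at_top. 0 < rate x"
    unfolding rate_def using \<kappa> by real_asymp
  have ev_scale: "\<forall>\<^sub>F x in at_top. 1 + 2 * (sqrt x + 1) + 3 * log 2 (x + 1) - log 2 \<mu> \<le> 4 * sqrt x"
    by real_asymp
  have ev_one: "\<forall>\<^sub>F x in at_top. (1::real) \<le> x" by (rule eventually_ge_at_top)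
  have ach: "\<forall>\<^sub>F x in at_top. 0 < rate x \<and> (\<forall>P>0. L P = x \<longrightarrow> achievable_secure K P h he (\<lambda>k. if k = 0 then 0 else rate x))"
    using ev_sep ev_rate ev_scale ev_one
  proof eventually_elim
    case (elim x)
    \<comment> \<open>Balances the rate loss \<open>2 * J / s\<close> against the threshold exponent
      \<open>2 * s\<close>: both are of order \<open>sqrt x\<close>.\<close>
    define s where "s = nat \<lceil>sqrt x\<rceil>"
    define J where "J = Js x"
    have sq: "1 \<le> sqrt x" using elim(4) by simp
    have s: "1 \<le> s" "sqrt x \<le> real s" "real s \<le> sqrt x + 1"
      unfolding s_def using sq by linarith+
    have xx: "sqrt x * sqrt x = x" using elim(4) by simp
    have pos: "0 \<le> x / \<kappa> - 2 * sqrt x" using elim(2)[unfolded rate_def] sq by linarith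
    have J: "real J \<le> x / \<kappa> - 2 * sqrt x" "x / \<kappa> - 2 * sqrt x - 1 \<le> real J"
      unfolding J_def Js_def using pos by linarith+
    have "achievable_secure K P h he (\<lambda>k. if k = 0 then 0 else rate x)" if P: "0 < P" "L P = x" for P
    proof (rule achievable_secure_aligned[where J = J and s = s and \<mu> = \<mu>])
      show "0 < K" using K by simp
      show "he k \<noteq> 0" if "k < K" for k by (rule he_nz[OF that])
      show "0 \<le> \<mu>" using \<mu> by simp
      show "\<mu> \<le> \<bar>he k\<bar>" if "k < K" for k by (rule \<mu>_le[OF that])
      show "0 \<le> P" using P by simp
      show "1 \<le> s" by (rule s)
      show "0 < rate x" by (rule elim(2))
      show "sep_eps K J \<le> \<bar>\<Sum>k<K. h k / he k * real_of_int (q k)\<bar>" if "q \<in> int_box K J" "\<exists>k<K. q k \<noteq> 0" for q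
        using elim(1) that unfolding J_def by blast
      show "rate x + 6 + real (2 * J) / real s \<le> real J"
      proof -
        have "2 * real J / real s \<le> 2 * (x / \<kappa>) / sqrt x"
          using J(1) sq s by (intro frac_le mult_left_mono) auto
        also have "\<dots> = 2 * sqrt x / \<kappa>" using xx sq \<kappa> by (simp add: field_simps)
        also have "\<dots> \<le> sqrt x" using \<kappa> sq by (simp add: field_simps)
        finally have "real (2 * J) / real s \<le> sqrt x" by simp
        then show ?thesis using J(2) sq unfolding rate_def by linarith
      qed
      show "2 * 2 ^ (2 * s) \<le> sqrt P * \<mu> / 2 ^ J * sep_eps K J"
      proof -
        have KJ: "\<kappa> * real J \<le> x - 4 * sqrt x"
        proof -
          have "\<kappa> * real J \<le> \<kappa> * (x / \<kappa> - 2 * sqrt x)" using J(1) \<kappa> by (intro mult_left_mono) auto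
          also have "\<dots> = x - 2 * (\<kappa> * sqrt x)" using \<kappa> by (simp add: field_simps)
          also have "\<dots> \<le> x - 4 * sqrt x" using mult_right_mono[OF \<kappa>, of "sqrt x"] sq by simp
          finally show ?thesis .
        qed
        have Jx: "real (Suc J) \<le> x + 1"
        proof -
          have "x / \<kappa> \<le> x" using \<kappa> elim(4) by (simp add: field_simps)
          then show ?thesis unfolding of_nat_Suc using J(1) sq by linarith
        qed
        have sqP: "sqrt P = 2 powr x"
        proof (rule real_sqrt_unique)
          have "log 2 P = x + x" using P(2) by (simp add: L_def)
          moreover have "2 powr (log 2 P) = P" using P(1) by simp
          ultimately have "2 powr (x + x) = P" by (simp only:)
          then show "(2 powr x)\<^sup>2 = P" by (simp only: powr_add power2_eq_square)
        qed simp
        have mm: "\<mu> = 2 powr (log 2 \<mu>)" using \<mu> by simp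
        \<comment> \<open>The amplitude contributes \<open>J\<close> and the separation
          \<open>J * (K - 1)\<close> to the exponent; their sum \<open>K * J\<close> is the source
          of the denominator \<open>K\<close> in the result.\<close>
        have e: "sqrt P * \<mu> / 2 ^ J * sep_eps K J = 2 powr (x + log 2 \<mu> - \<kappa> * real J - 3 * log 2 (real (Suc J)))"
        proof -
          have "J + J * (K - 1) = K * J" using K by (cases K) auto
          then have "(2::real) ^ J * 2 ^ (J * (K - 1)) = 2 ^ (K * J)" by (simp flip: power_add)
          also have "\<dots> = 2 powr (\<kappa> * real J)" by (subst powr_realpow[symmetric]) (auto simp: \<kappa>_def)
          finally have A: "(2::real) ^ J * 2 ^ (J * (K - 1)) = 2 powr (\<kappa> * real J)" .
          have B: "real (Suc J) ^ 3 = 2 powr (3 * log 2 (real (Suc J)))"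
          proof -
            have "2 powr (3 * log 2 (real (Suc J))) = (2 powr log 2 (real (Suc J))) powr 3" by (simp only: powr_powr mult.commute)
            also have "\<dots> = real (Suc J) powr 3" by (subst powr_log_cancel) auto
            also have "\<dots> = real (Suc J) ^ 3" by (subst powr_numeral) auto
            finally show ?thesis ..
          qed
          have "sqrt P * \<mu> / 2 ^ J * sep_eps K J = sqrt P * \<mu> / ((2 ^ J * 2 ^ (J * (K - 1))) * real (Suc J) ^ 3)"
            by (simp only: sep_eps_def times_divide_eq_right mult_1_right divide_divide_eq_left mult.assoc)
          also have "\<dots> = 2 powr x * 2 powr log 2 \<mu> / (2 powr (\<kappa> * real J) * 2 powr (3 * log 2 (real (Suc J))))"
            unfolding A B sqP using mm by simp
          also have "\<dots> = 2 powr (x + log 2 \<mu> - \<kappa> * real J - 3 * log 2 (real (Suc J)))"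
            by (simp only: powr_add[symmetric] powr_diff[symmetric] diff_diff_eq)
          finally show ?thesis .
        qed
        have "3 * log 2 (real (Suc J)) \<le> 3 * log 2 (x + 1)" using Jx by (intro mult_left_mono log_mono) auto
        moreover have "u + 3 * v - w \<le> 4 * y \<Longrightarrow> 3 * v' \<le> 3 * v \<Longrightarrow> kj \<le> x - 4 * y \<Longrightarrow> u \<le> x + w - kj - 3 * v'"
          for u v v' w y kj :: real by linarith
        ultimately have "1 + 2 * (sqrt x + 1) \<le> x + log 2 \<mu> - \<kappa> * real J - 3 * log 2 (real (Suc J))"
          using elim(3) KJ by blast
        then have "1 + 2 * real s \<le> x + log 2 \<mu> - \<kappa> * real J - 3 * log 2 (real (Suc J))"
          using s(3) by argo
        then have "2 powr (1 + 2 * real s) \<le> 2 powr (x + log 2 \<mu> - \<kappa> * real J - 3 * log 2 (real (Suc J)))"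
          by (intro powr_mono) auto
        moreover have "2 powr (1 + 2 * real s) = 2 * 2 ^ (2 * s)"
          by (simp add: powr_add powr_realpow[symmetric])
        ultimately show ?thesis unfolding e by simp
      qed
    qed
    then show ?case using elim(2) by blast
  qed
  from ach obtain x0 where x0: "\<And>x. x0 \<le> x \<Longrightarrow> 0 < rate x \<and> (\<forall>P>0. L P = x \<longrightarrow> achievable_secure K P h he (\<lambda>k. if k = 0 then 0 else rate x))"
    unfolding eventually_at_top_linorder by blast
  \<comment> \<open>Rate zero below the threshold \<open>x0\<close>: achievability is required at
    every positive power, while the limit sees only large ones.\<close>
  define R where "R P = (if x0 \<le> L P then (\<lambda>k::nat. if k = 0 then 0 else rate (L P)) else (\<lambda>_. 0))" for P
  have "achievable_secure K P h he (R P)" if "0 < P" for P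
    using x0[of "L P"] that achievable_secure_zero[of P K h he] by (auto simp: R_def)
  moreover have "((\<lambda>P. (\<Sum>k<K. R P k) / (1 / 2 * log 2 P)) \<longlongrightarrow> (real K - 1) / real K) at_top"
  proof -
    have sumR: "(\<Sum>k<K. if k = 0 then 0 else y) = (real K - 1) * y" for y :: real
    proof -
      have "{..<K} = insert 0 {1..<K}" using K by auto
      then have "(\<Sum>k<K. if k = 0 then 0 else y) = (\<Sum>k\<in>{1..<K}. y)" by (simp add: sum.insert)
      then show ?thesis using K by (simp add: of_nat_diff)
    qed
    have "((\<lambda>x. (\<kappa> - 1) * (x / \<kappa> - 4 * sqrt x - 7) / x) \<longlongrightarrow> (\<kappa> - 1) * inverse \<kappa>) at_top"
      using \<kappa> by real_asymp
    then have "((\<lambda>x. (\<kappa> - 1) * (x / \<kappa> - 4 * sqrt x - 7) / x) \<longlongrightarrow> (\<kappa> - 1) / \<kappa>) at_top"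
      by (simp only: divide_inverse[of "\<kappa> - 1" \<kappa>])
    then have "((\<lambda>P. (\<kappa> - 1) * rate (L P) / L P) \<longlongrightarrow> (\<kappa> - 1) / \<kappa>) at_top"
      unfolding rate_def by (rule filterlim_compose[OF _ LP])
    moreover have "\<forall>\<^sub>F P in at_top. (\<kappa> - 1) * rate (L P) / L P = (\<Sum>k<K. R P k) / (1 / 2 * log 2 P)"
    proof -
      have "\<forall>\<^sub>F P in at_top. x0 \<le> L P" using LP by (simp add: filterlim_at_top)
      then show ?thesis
      proof eventually_elim
        case (elim P)
        then show ?case by (simp only: R_def if_True sumR) (simp add: \<kappa>_def L_def)
      qed
    qed
    ultimately show ?thesis unfolding \<kappa>_def by (rule Lim_transform_eventually)
  qed
  ultimately show ?thesis unfolding sdof_achievable_def by blast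
qed

theorem theorem2:
  fixes K :: nat
  assumes "K \<ge> 2"
  shows "AE g in PiM {..<2 * K} (\<lambda>_. lborel).
           sdof_achievable K (\<lambda>k. g k) (\<lambda>k. g (K + k)) ((real K - 1) / real K)"
  using AE_channel_separated[of K]
proof eventually_elim
  case (elim g)
  then show ?case by (intro sdof_achievable_aligned[OF assms]) auto
qed

end
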